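(* Let $K$ be an (oriented) virtual knot. If $K$ is concordant to an almost classical knot, then its generalized Alexander polynomial satisfies $\Delta^0_K(s,t)=0$. In particular, if $K$ is a slice virtual knot, then $\Delta^0_K(s,t)=0$.
   Context: A virtual link diagram is an immersion of oriented circles in the plane whose double points are each either classical (with over/under information) or virtual. The generalized Reidemeister moves are planar isotopy, the classical Reidemeister moves, and the detour move (an arc passing only through virtual crossings may be replaced by any other arc with the same endpoints, with all its double points virtual). Virtual links are equivalence classes of diagrams under these moves; a virtual knot is a one-component virtual link. A diagram of a link in $\Sigma\times I$ on a surface $\Sigma$ determines a virtual link through its Gauss code. Almost classical: a virtual knot is almost classical if some diagram of it admits an Alexander numbering; equivalently, if it can be represented by a knot $K\subset\Sigma\times I$, with $\Sigma$ a closed connected oriented surface, that is homologically trivial, i.e. $[K]=0\in H_1(\Sigma\times I;\mathbb{Z})$. Concordance: a birth (death) is the addition (removal) of a trivial unknotted unlinked component; a saddle cuts and rejoins two arcs respecting orientations. Virtual knots $K$ and $K'$ are concordant if they are represented by diagrams related by a finite sequence of generalized Reidemeister moves, $b$ births, $d$ deaths and $s$ saddles with $b+d=s$ (the traced surface being a connected cobordism from $K$ to $K'$, hence an annulus). A virtual knot is slice if it is concordant to the unknot. Generalized Alexander polynomial: take a diagram of $K$ with $n\ge 1$ classical crossings. The short arcs are the $2n$ arcs running from one classical crossing to the next (passing through virtual crossings). Number the crossings, and number the short arcs $a_1,\dots,a_{2n}$ so that the two short arcs coming into the $i$-th crossing are $a_{2i-1}$ and $a_{2i}$, where, if the $i$-th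 crossing is positive, $a_{2i-1}$ is the incoming undercrossing arc and $a_{2i}$ the incoming overcrossing arc, and, if it is negative, $a_{2i-1}$ is the incoming overcrossing arc and $a_{2i}$ the incoming undercrossing arc. Let $M$ be the block diagonal $2n\times 2n$ matrix whose $i$-th diagonal $2\times2$ block is $$M_+=\begin{bmatrix} t^{-1} & 1-(st)^{-1}\\ 0 & s^{-1}\end{bmatrix}\quad\text{or}\quad M_-=\begin{bmatrix} s & 0\\ 1-st & t\end{bmatrix}$$ according to whether the $i$-th crossing is positive or negative. Let $P$ be the permutation matrix whose $(i,j)$ entry is $1$ if $a_j$ immediately follows $a_i$ as one travels along the knot, and $0$ otherwise. Then $\Delta^0_K(s,t)=\det(M-P)\in\mathbb{Z}[s^{\pm1},t^{\pm1}]$, well defined up to multiplication by powers of $st$. *)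

theory Defs
  imports
    "HOL-Library.Poly_Mapping"
    "HOL-Library.Product_Plus"
    "Jordan_Normal_Form.Determinant"
begin

section \<open>Virtual link diagrams\<close>

text \<open>
  An oriented virtual link diagram is recorded up to planar isotopy by listing, for every component,
  the crossing passages (classical and virtual) in the cyclic order in which they are met; a
  component that meets no crossing is the empty word.  At a crossing turn both strands
  so that they point upwards: \<open>FromLeft\<close> is the strand running from bottom left to top right,
  \<open>FromRight\<close> the one running from bottom right to top left.  A classical crossing is therefore
  positive iff its \<open>FromLeft\<close> strand is the overcrossing one.

  The cyclic order of the four half-edges at each crossing turns the words into a combinatorial map,
  and a family of words comes from an immersion in the plane iff that map has genus 0.
  What is forgotten is the choice of the unbounded face and the relative
  position of disconnected pieces; both can be changed by detour moves (an arc is rerouted around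
  the other side of a disconnected piece, or of the sphere).
\<close>

datatype side = FromLeft | FromRight

datatype level = Over | Under | Virtual

datatype passage = Passage (crossing: nat) (side: side) (level: level)

type_synonym code = "passage list list"

definition passages :: "code \<Rightarrow> passage set" where
  "passages D = set (concat D)"

definition crossings :: "code \<Rightarrow> nat set" where
  "crossings D = crossing ` passages D"

definition wf_code :: "code \<Rightarrow> bool" where
  "wf_code D \<longleftrightarrow> distinct (concat D) \<and>
     (\<forall>c\<in>crossings D. \<exists>(l, r)\<in>{(Over, Under), (Under, Over), (Virtual, Virtual)}.
        {p \<in> passages D. crossing p = c} = {Passage c FromLeft l, Passage c FromRight r})"

definition follows :: "code \<Rightarrow> passage \<Rightarrow> passage \<Rightarrow> bool" where
  "follows D p q \<longleftrightarrow> (\<exists>w\<in>set D. \<exists>j<length w. p = w ! j \<and> q = w ! (Suc j mod length w))"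

datatype half_edge = Incoming passage | Outgoing passage

definition half_edges :: "code \<Rightarrow> half_edge set" where
  "half_edges D = Incoming ` passages D \<union> Outgoing ` passages D"

definition edges :: "code \<Rightarrow> (half_edge \<times> half_edge) set" where
  "edges D = {(Outgoing p, Incoming q) | p q. follows D p q}"

text \<open>One step counterclockwise around a crossing.\<close>

definition rotation :: "code \<Rightarrow> (half_edge \<times> half_edge) set" where
  "rotation D = (\<Union>(p, q)\<in>{(p, q). p \<in> passages D \<and> q \<in> passages D \<and>
        crossing p = crossing q \<and> side p = FromLeft \<and> side q = FromRight}.
     {(Incoming p, Incoming q), (Incoming q, Outgoing p),
      (Outgoing p, Outgoing q), (Outgoing q, Incoming p)})"

definition faces :: "code \<Rightarrow> half_edge set set" where
  "faces D = half_edges D // ((edges D \<union> (edges D)\<inverse>) O rotation D)\<^sup>*"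

definition pieces :: "code \<Rightarrow> half_edge set set" where
  "pieces D = half_edges D // (edges D \<union> (edges D)\<inverse> \<union> rotation D)\<^sup>*"

text \<open>
  Euler's formula \<open>V - E + F = 2\<close> for each connected piece of the underlying 4-valent graph
  (crossingless circles contribute to neither side).
\<close>

definition planar :: "code \<Rightarrow> bool" where
  "planar D \<longleftrightarrow>
     int (card (crossings D)) - int (card (edges D)) + int (card (faces D)) = 2 * int (card (pieces D))"

definition virtual_link_diagram :: "code \<Rightarrow> bool" where
  "virtual_link_diagram D \<longleftrightarrow> wf_code D \<and> planar D"

definition virtual_knot_diagram :: "code \<Rightarrow> bool" where
  "virtual_knot_diagram D \<longleftrightarrow> virtual_link_diagram D \<and> length D = 1"


section \<open>Generalized Reidemeister moves\<close>

text \<open>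
  Two codes describe the same diagram if they differ by the names of the crossings, the base points
  on the components and the order of the components; \<open>\<pi>\<close> sends the position of a component in the
  first code to its position in the second.
\<close>

definition plane_isotopy :: "(nat \<Rightarrow> nat) \<Rightarrow> code \<Rightarrow> code \<Rightarrow> bool" where
  "plane_isotopy \<pi> D D' \<longleftrightarrow> bij_betw \<pi> {..<length D} {..<length D'} \<and>
     (\<exists>f. inj_on f (crossings D) \<and>
        (\<forall>i<length D. \<exists>k. D' ! \<pi> i =
           rotate k (map (\<lambda>p. Passage (f (crossing p)) (side p) (level p)) (D ! i))))"

text \<open>
  A code with holes \<open>Inr 0, \<dots>, Inr (k - 1)\<close>, each occurring once, is the part of a diagram
  that stays fixed while \<open>k\<close> arcs are replaced.
\<close>

type_synonym holed_code = "(passage + nat) list list"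

definition holes :: "holed_code \<Rightarrow> nat list" where
  "holes E = [i. Inr i \<leftarrow> concat E]"

definition has_holes :: "nat \<Rightarrow> holed_code \<Rightarrow> bool" where
  "has_holes k E \<longleftrightarrow> distinct (holes E) \<and> set (holes E) = {..<k}"

definition fill :: "passage list list \<Rightarrow> holed_code \<Rightarrow> code" where
  "fill xs E = map (\<lambda>w. concat (map (\<lambda>x. case x of Inl p \<Rightarrow> [p] | Inr i \<Rightarrow> xs ! i) w)) E"

definition local_move :: "passage list list \<Rightarrow> passage list list \<Rightarrow> code \<Rightarrow> code \<Rightarrow> bool" where
  "local_move xs ys D D' \<longleftrightarrow> length xs = length ys \<and>
     (\<exists>E. has_holes (length xs) E \<and> D = fill xs E \<and> D' = fill ys E)"

definition erase :: "nat set \<Rightarrow> holed_code \<Rightarrow> holed_code" where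
  "erase C E = map (filter (\<lambda>x. case x of Inl p \<Rightarrow> crossing p \<notin> C | Inr i \<Rightarrow> True)) E"

definition arrange :: "bool \<Rightarrow> passage \<Rightarrow> passage \<Rightarrow> passage list" where
  "arrange b p q = (if b then [p, q] else [q, p])"

definition over_side :: "bool \<Rightarrow> side" where
  "over_side positive = (if positive then FromLeft else FromRight)"

definition under_side :: "bool \<Rightarrow> side" where
  "under_side positive = (if positive then FromRight else FromLeft)"

text \<open>
  The three arcs of a third Reidemeister move: the top strand 1, the middle strand 2 and the bottom
  strand 3, with crossing \<open>x\<close> of strands 1 and 2, \<open>y\<close> of 1 and 3, \<open>z\<close> of 2 and 3, whose signs are
  positive iff \<open>e12\<close>, \<open>e13\<close>, \<open>e23\<close> respectively.  Represent the strands by oriented lines with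
  directions \<open>u1\<close>, \<open>u2\<close>, \<open>u3\<close>, where \<open>eij\<close> iff \<open>det(ui, uj) > 0\<close>, place the intersection of lines 1 and 2
  at the origin, and let line 3 be \<open>{v. det(u3, v) = -a}\<close> with \<open>a \<noteq> 0\<close>.  Line 3 meets line 1 at
  \<open>(a / det(u1, u3)) u1\<close> and line 2 at \<open>(a / det(u2, u3)) u2\<close>, so with \<open>h\<close> standing for \<open>a > 0\<close>,
  \<open>x\<close> precedes \<open>y\<close> on line 1 iff \<open>h = e13\<close>, and \<open>x\<close> precedes \<open>z\<close> on line 2 iff \<open>h = e23\<close>;
  on line 3, \<open>y\<close> precedes \<open>z\<close> iff \<open>a det(u1, u2) det(u1, u3) det(u2, u3) > 0\<close>.
  The move pushes line 3 across the origin, that is, it negates \<open>h\<close>.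
\<close>

definition triangle_arcs ::
    "nat \<Rightarrow> nat \<Rightarrow> nat \<Rightarrow> bool \<Rightarrow> bool \<Rightarrow> bool \<Rightarrow> bool \<Rightarrow> passage list list" where
  "triangle_arcs x y z e12 e13 e23 h =
     [arrange (h = e13)
        (Passage x (over_side e12) Over) (Passage y (over_side e13) Over),
      arrange (h = e23)
        (Passage x (under_side e12) Under) (Passage z (over_side e23) Over),
      arrange (h = (e12 = (e13 = e23)))
        (Passage y (under_side e13) Under) (Passage z (under_side e23) Under)]"

text \<open>
  In \<open>detour\<close>, the arc \<open>w\<close> is replaced by \<open>w'\<close>; what remains of the diagram, once the crossings lying
  on the arc are deleted, is unchanged.
\<close>

inductive reidemeister_move :: "code \<Rightarrow> code \<Rightarrow> bool" where
  R1: "a \<noteq> b \<Longrightarrow> {l, m} = {Over, Under} \<Longrightarrow>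
    local_move [[]] [[Passage c a l, Passage c b m]] D D' \<Longrightarrow>
    reidemeister_move D D'"
| R2: "a \<noteq> b \<Longrightarrow>
    us \<in> {[Passage c b Under, Passage d a Under], [Passage d a Under, Passage c b Under]} \<Longrightarrow>
    local_move [[], []] [[Passage c a Over, Passage d b Over], us] D D' \<Longrightarrow>
    reidemeister_move D D'"
| R3: "local_move (triangle_arcs x y z e12 e13 e23 h) (triangle_arcs x y z e12 e13 e23 (\<not> h)) D D' \<Longrightarrow>
    reidemeister_move D D'"
| detour: "has_holes 1 E \<Longrightarrow> has_holes 1 E' \<Longrightarrow>
    \<forall>p\<in>set w \<union> set w'. level p = Virtual \<Longrightarrow>
    erase (crossing ` set w) E = erase (crossing ` set w') E' \<Longrightarrow>
    reidemeister_move (fill [w] E) (fill [w'] E')"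


definition elementary_equivalence :: "code \<Rightarrow> code \<Rightarrow> bool" where
  "elementary_equivalence D D' \<longleftrightarrow> virtual_link_diagram D \<and> virtual_link_diagram D' \<and>
     ((\<exists>\<pi>. plane_isotopy \<pi> D D') \<or> reidemeister_move D D')"

type_synonym virtual_link = "code set"

definition virtual_link_of :: "code \<Rightarrow> virtual_link" where
  "virtual_link_of D = {D'. equivclp elementary_equivalence D D'}"

definition virtual_knot :: "virtual_link \<Rightarrow> bool" where
  "virtual_knot K \<longleftrightarrow> (\<exists>D. virtual_knot_diagram D \<and> K = virtual_link_of D)"

definition unknot :: virtual_link where
  "unknot = virtual_link_of [[]]"


section \<open>Almost classical knots\<close>

text \<open>
  A half-edge carries the number of the short arc containing it, so numbers are constant along edges
  and through virtual crossings.  At a classical crossing with both strands pointing upwards, the two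
  half-edges on the left carry \<open>k + 1\<close> and the two on the right carry \<open>k\<close> (the opposite convention
  amounts to negating the numbering).
\<close>

definition alexander_numbering :: "code \<Rightarrow> (half_edge \<Rightarrow> int) \<Rightarrow> bool" where
  "alexander_numbering D \<nu> \<longleftrightarrow>
     (\<forall>(g, h)\<in>edges D. \<nu> g = \<nu> h) \<and>
     (\<forall>p\<in>passages D. level p = Virtual \<longrightarrow> \<nu> (Incoming p) = \<nu> (Outgoing p)) \<and>
     (\<forall>p\<in>passages D. \<forall>q\<in>passages D.
        crossing p = crossing q \<and> side p = FromLeft \<and> side q = FromRight \<and> level p \<noteq> Virtual \<longrightarrow>
        \<nu> (Incoming p) = \<nu> (Outgoing q) \<and>
        \<nu> (Incoming q) = \<nu> (Outgoing p) \<and>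
        \<nu> (Incoming p) = \<nu> (Incoming q) + 1)"

definition almost_classical :: "virtual_link \<Rightarrow> bool" where
  "almost_classical K \<longleftrightarrow> virtual_knot K \<and> (\<exists>D\<in>K. \<exists>\<nu>. alexander_numbering D \<nu>)"


section \<open>Concordance\<close>

datatype event = Equivalence | Birth | Death | Saddle

text \<open>
  The relation in the third argument says which component of the first diagram is joined to which
  component of the second by the piece of surface traced by the step.
\<close>

inductive cobordism_step :: "code \<Rightarrow> event \<Rightarrow> (nat \<times> nat) set \<Rightarrow> code \<Rightarrow> bool" where
  isotopy: "plane_isotopy \<pi> D D' \<Longrightarrow>
    cobordism_step D Equivalence {(i, \<pi> i) | i. i < length D} D'"
| move: "reidemeister_move D D' \<or> reidemeister_move D' D \<Longrightarrow>
    cobordism_step D Equivalence (Id_on {..<length D}) D'"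
| birth: "cobordism_step D Birth (Id_on {..<length D}) (D @ [[]])"
| death: "cobordism_step (D @ [[]]) Death (Id_on {..<length D}) D"
| split: "cobordism_step (D @ [u @ v]) Saddle
    (Id_on {..length D} \<union> {(length D, Suc (length D))}) (D @ [u, v])"
| merge: "cobordism_step (D @ [u, v]) Saddle
    (Id_on {..length D} \<union> {(Suc (length D), length D)}) (D @ [u @ v])"

text \<open>
  The traced surface is connected iff the graph on all components of all diagrams of the sequence,
  with the edges provided by the steps, is connected.
\<close>

definition diagrams_concordant :: "code \<Rightarrow> code \<Rightarrow> bool" where
  "diagrams_concordant D D' \<longleftrightarrow>
     (\<exists>m (F :: nat \<Rightarrow> code) (ev :: nat \<Rightarrow> event) (\<rho> :: nat \<Rightarrow> (nat \<times> nat) set).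
        F 0 = D \<and> F m = D' \<and>
        (\<forall>j\<le>m. virtual_link_diagram (F j)) \<and>
        (\<forall>j<m. cobordism_step (F j) (ev j) (\<rho> j) (F (Suc j))) \<and>
        card {j. j < m \<and> ev j = Birth} + card {j. j < m \<and> ev j = Death}
          = card {j. j < m \<and> ev j = Saddle} \<and>
        (let V = {(j, c). j \<le> m \<and> c < length (F j)};
             E = {((j, c), (Suc j, c')) | j c c'. j < m \<and> (c, c') \<in> \<rho> j}
         in V \<times> V \<subseteq> (E \<union> E\<inverse>)\<^sup>*))"

definition concordant :: "virtual_link \<Rightarrow> virtual_link \<Rightarrow> bool" where
  "concordant K K' \<longleftrightarrow> virtual_knot K \<and> virtual_knot K' \<and>
     (\<exists>D\<in>K. \<exists>D'\<in>K'. diagrams_concordant D D')"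

definition slice :: "virtual_link \<Rightarrow> bool" where
  "slice K \<longleftrightarrow> concordant K unknot"


section \<open>The generalized Alexander polynomial\<close>

text \<open>
  \<open>\<int>[s\<^sup>\<plusminus>\<^sup>1, t\<^sup>\<plusminus>\<^sup>1]\<close> as the group ring of \<open>\<int>\<^sup>2\<close>.
\<close>

type_synonym laurent = "(int \<times> int) \<Rightarrow>\<^sub>0 int"

definition monomial :: "int \<Rightarrow> int \<Rightarrow> laurent" where
  "monomial a b = Poly_Mapping.single (a, b) 1" \<comment> \<open>\<open>s^a t^b\<close>\<close>

definition M_plus :: "laurent mat" where
  "M_plus = mat_of_rows_list 2
     [[monomial 0 (-1), 1 - monomial (-1) (-1)],
      [0,         monomial (-1) 0]]"

definition M_minus :: "laurent mat" where
  "M_minus = mat_of_rows_list 2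
     [[monomial 1 0,     0],
      [1 - monomial 1 1, monomial 0 1]]"

definition classical_part :: "code \<Rightarrow> code" where
  "classical_part D = map (filter (\<lambda>p. level p \<noteq> Virtual)) D"

definition positive :: "code \<Rightarrow> nat \<Rightarrow> bool" where
  "positive D c \<longleftrightarrow> Passage c FromLeft Over \<in> passages D"

text \<open>
  The list \<open>cs\<close> numbers the classical crossings.  A short arc is represented by the classical
  passage at which it ends; indices start from 0, so arcs \<open>2 * i\<close> and \<open>2 * i + 1\<close> come into
  crossing \<open>cs ! i\<close>.
\<close>

definition short_arc :: "code \<Rightarrow> nat list \<Rightarrow> nat \<Rightarrow> passage" where
  "short_arc D cs j =
     (let c = cs ! (j div 2);
          po = Passage c (over_side (positive D c)) Over;
          pu = Passage c (under_side (positive D c)) Under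
      in if positive D c then (if even j then pu else po)
         else (if even j then po else pu))"

definition crossing_matrix :: "code \<Rightarrow> nat list \<Rightarrow> laurent mat" where
  "crossing_matrix D cs = diag_block_mat (map (\<lambda>c. if positive D c then M_plus else M_minus) cs)"

definition succession_matrix :: "code \<Rightarrow> nat list \<Rightarrow> laurent mat" where
  "succession_matrix D cs = mat (2 * length cs) (2 * length cs)
     (\<lambda>(i, j). if follows (classical_part D) (short_arc D cs i) (short_arc D cs j) then 1 else 0)"

text \<open>
  All representatives of the generalized Alexander polynomial; any two differ by a power of \<open>st\<close>.
\<close>

definition gen_alexander_polynomials :: "virtual_link \<Rightarrow> laurent set" where
  "gen_alexander_polynomials K =
     {det (crossing_matrix D cs - succession_matrix D cs) | D cs.
        D \<in> K \<and> cs \<noteq> [] \<and> distinct cs \<and> set cs = crossings (classical_part D)}"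

end

theory Submission
  imports Defs "HOL-Computational_Algebra.Formal_Power_Series"
begin

text \<open>
  Specialize \<open>s\<close> and \<open>t\<close> to \<open>exp X\<close> and \<open>exp (sqrt 2 X)\<close> in the discrete valuation ring of real power
  series.  This is injective on Laurent polynomials, and modulo \<open>X\<close> both units become \<open>1\<close>.  The
  polynomial vanishes iff the arcs of the diagram carry a nonzero labelling that satisfies the linear
  relations at the crossings; modulo \<open>X\<close> such a labelling is constant on each component.  An Alexander
  numbering \<open>\<nu>\<close> yields the labelling \<open>s^\<nu>\<close>, so it suffices to transport labellings along a concordance.

  Let \<open>N\<close> be the square matrix of relations of a diagram.  A Reidemeister move induces a map of the
  two-term complexes \<open>N\<close> that is compatible with the reduction modulo \<open>X\<close>, a birth or death adds or removes a
  zero summand, and a saddle adds to \<open>N\<close> a matrix \<open>u f\<close> of rank one.  Transport the given labelling and the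
  kernel vectors created by the \<open>b\<close> births upwards; the values of the forms \<open>f\<close> of the \<open>s\<close> saddles on them
  are an \<open>s \<times> (b + 1)\<close> matrix \<open>A\<close>.  Transport the left kernel vectors belonging to the \<open>d\<close> deaths
  downwards; their values on the vectors \<open>u\<close> are a \<open>d \<times> s\<close> matrix \<open>B\<close>, and \<open>B A = 0\<close>.  A relation between
  the rows of \<open>B\<close>, divided by a power of \<open>X\<close>, would reduce to a function that is constant along the
  connected surface, zero at its upper end and nonzero at some death.  Hence \<open>B\<close> has rank \<open>d\<close>, and since
  \<open>s = b + d\<close>, the matrix \<open>A\<close> has a nonzero kernel vector.  Divided by a power of \<open>X\<close>, it gives labellings
  compatible with all saddles which modulo \<open>X\<close> are a nonzero constant on the whole surface, in particular
  at the upper end.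
\<close>

section \<open>Linear algebra over a discrete valuation ring\<close>

text \<open>At \<open>s = t = 1\<close> all units are 1 and a relation only equates a label with the
  next one, so that there only the components and the connectedness of the surface matter. The
  localization of the Laurent ring at this point has dimension two: a vector such as
  \<open>(s - 1, t - 1)\<close> vanishes there but has no common factor to divide out. On the curve
  \<open>s = exp X\<close>, \<open>t = exp (sqrt 2 X)\<close> the single uniformizer
  \<open>X\<close> suffices, and the irrational slope keeps the exponents of different monomials
  apart, so no polynomial is lost.

  Mere existence of a nonzero labelling does not pass along a concordance: it might live on pieces
  that die before the end. What is transported is the stronger property of having a nonzero constant
  reduction; it also makes sense for diagrams without crossings, in particular for the unknot.

  Counting unknowns alone does not suffice, since \<open>b + d\<close> saddle conditions face
  \<open>b + 1\<close> unknowns; the \<open>d\<close> independent relations between the conditions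
  that are missing are the dual contribution of the deaths. Labellings travel from the almost
  classical end to \<open>K\<close>, that is, against the direction in which the concordance is
  given.\<close>

lemma homogeneous_system_dependent:
  fixes A :: "'k \<Rightarrow> 'i \<Rightarrow> 'a::idom"
  assumes "finite K" "finite I" "card K < card I"
  shows "\<exists>w. (\<exists>i\<in>I. w i \<noteq> 0) \<and> (\<forall>k\<in>K. (\<Sum>i\<in>I. A k i * w i) = 0)"
  using assms
proof (induction K arbitrary: I A rule: finite_induct)
  case empty
  then obtain i where "i \<in> I" by fastforce
  then show ?case by (intro exI[of _ "\<lambda>_. 1"]) auto
next
  case (insert k K)
  show ?case
  proof (cases "\<forall>i\<in>I. A k i = 0")
    case True
    then show ?thesis using insert.IH[OF insert.prems(1), of A] insert by auto
  next
    case False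
    then obtain i where i: "i \<in> I" "A k i \<noteq> 0" by auto
    define J where "J = I - {i}"
    have I: "I = insert i J" "i \<notin> J" "finite J" using i insert.prems(1) by (auto simp: J_def)
    have cJ: "card K < card J" using insert I by auto
    obtain w where w: "\<exists>j\<in>J. w j \<noteq> 0"
      "\<forall>l\<in>K. (\<Sum>j\<in>J. (A k i * A l j - A l i * A k j) * w j) = 0"
      using insert.IH[OF I(3) cJ, of "\<lambda>l j. A k i * A l j - A l i * A k j"] by blast
    \<comment> \<open>Elimination without division: \<open>w\<close> solves the equations
      cross-multiplied with the pivot \<open>A k i\<close>, and \<open>v\<close> is \<open>w\<close>
      times the pivot, with the entry at \<open>i\<close> determined by equation
      \<open>k\<close>.\<close>
    define v where "v = (\<lambda>j. if j = i then - (\<Sum>j\<in>J. A k j * w j) else A k i * w j)"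
    have s: "(\<Sum>j\<in>I. A l j * v j) = A k i * (\<Sum>j\<in>J. A l j * w j) - A l i * (\<Sum>j\<in>J. A k j * w j)" for l
    proof -
      have "(\<Sum>j\<in>J. A l j * v j) = (\<Sum>j\<in>J. A k i * (A l j * w j))"
        using I(2) by (intro sum.cong) (auto simp: v_def algebra_simps)
      then show ?thesis using I by (simp add: v_def sum_distrib_left algebra_simps)
    qed
    have "(\<Sum>j\<in>I. A l j * v j) = 0" if "l \<in> K" for l
      using w(2)[rule_format, OF that] unfolding s
      by (simp add: sum_distrib_left algebra_simps sum_subtractf)
    moreover have "(\<Sum>j\<in>I. A k j * v j) = 0" unfolding s by simp
    moreover have "\<exists>j\<in>I. v j \<noteq> 0" using w(1) i I by (auto simp: v_def)
    ultimately show ?thesis by blast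
  qed
qed

text \<open>Over the fraction field the columns of \<open>A\<close> lie in the kernel of
  \<open>B\<close>, which has dimension \<open>card K - card J < card I\<close>. The induction stays
  inside the domain and removes one row of \<open>B\<close> together with one index of
  \<open>K\<close> by elimination.\<close>

lemma kernel_of_independent_rows_dependent:
  fixes A :: "'k \<Rightarrow> 'i \<Rightarrow> 'a::idom" and B :: "'j \<Rightarrow> 'k \<Rightarrow> 'a"
  assumes "finite K" "finite I" "finite J" "card K < card I + card J"
    and "\<And>e. \<forall>k\<in>K. (\<Sum>j\<in>J. e j * B j k) = 0 \<Longrightarrow> \<forall>j\<in>J. e j = 0"
    and "\<And>j i. j \<in> J \<Longrightarrow> i \<in> I \<Longrightarrow> (\<Sum>k\<in>K. B j k * A k i) = 0"
  shows "\<exists>w. (\<exists>i\<in>I. w i \<noteq> 0) \<and> (\<forall>k\<in>K. (\<Sum>i\<in>I. A k i * w i) = 0)"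
  using assms(3,1,2,4-)
proof (induction J arbitrary: K B rule: finite_induct)
  case empty
  then show ?case using homogeneous_system_dependent[of K I A] by simp
next
  case (insert m J)
  have "\<exists>k\<in>K. B m k \<noteq> 0"
  proof (rule ccontr)
    assume z: "\<not> ?thesis"
    have "(\<Sum>j\<in>insert m J. (if j = m then 1 else 0) * B j k) = 0" if "k \<in> K" for k
      using z that insert.hyps by (simp add: sum.neutral)
    then show False using insert.prems(4)[of "\<lambda>j. if j = m then 1 else 0"] by auto
  qed
  then obtain k where k: "k \<in> K" "B m k \<noteq> 0" by blast
  define K' where "K' = K - {k}"
  have K: "K = insert k K'" "k \<notin> K'" "finite K'" using k insert.prems(1) by (auto simp: K'_def)
  define B' where "B' = (\<lambda>j l. B m k * B j l - B j k * B m l)"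
  have "\<exists>w. (\<exists>i\<in>I. w i \<noteq> 0) \<and> (\<forall>l\<in>K'. (\<Sum>i\<in>I. A l i * w i) = 0)"
  proof (rule insert.IH[of K' B'])
    show "card K' < card I + card J" using insert.prems(3) insert.hyps K by simp
    show "\<forall>j\<in>J. e j = 0" if e: "\<forall>l\<in>K'. (\<Sum>j\<in>J. e j * B' j l) = 0" for e
    proof -
      \<comment> \<open>A relation between the reduced rows \<open>B'\<close> becomes a relation
        between the original rows; in column \<open>k\<close> it holds because
        \<open>B' j k = 0\<close>.\<close>
      define e' where "e' = (\<lambda>j. if j = m then - (\<Sum>j\<in>J. e j * B j k) else e j * B m k)"
      have s: "(\<Sum>j\<in>insert m J. e' j * B j l) = (\<Sum>j\<in>J. e j * B' j l)" for l
      proof -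
        have "(\<Sum>j\<in>J. e' j * B j l) = (\<Sum>j\<in>J. e j * B m k * B j l)"
          using insert.hyps by (intro sum.cong) (auto simp: e'_def)
        then show ?thesis using insert.hyps
          by (simp add: e'_def B'_def algebra_simps sum_subtractf sum_distrib_left sum_distrib_right)
      qed
      have "(\<Sum>j\<in>J. e j * B' j k) = 0" by (simp add: B'_def)
      then have "\<forall>l\<in>K. (\<Sum>j\<in>insert m J. e' j * B j l) = 0" using e K(1) s by auto
      from insert.prems(4)[OF this] show ?thesis using k insert.hyps by (auto simp: e'_def split: if_splits)
    qed
    show "(\<Sum>l\<in>K'. B' j l * A l i) = 0" if "j \<in> J" "i \<in> I" for j i
    proof -
      have a: "(\<Sum>l\<in>K'. B j l * A l i) = - (B j k * A k i)" "(\<Sum>l\<in>K'. B m l * A l i) = - (B m k * A k i)"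
        using insert.prems(5)[of j i] insert.prems(5)[of m i] that K by (auto simp: eq_neg_iff_add_eq_0 add.commute)
      have "(\<Sum>l\<in>K'. B' j l * A l i) = B m k * (\<Sum>l\<in>K'. B j l * A l i) - B j k * (\<Sum>l\<in>K'. B m l * A l i)"
        by (simp add: B'_def algebra_simps sum_subtractf sum_distrib_left)
      then show ?thesis unfolding a by (simp add: algebra_simps)
    qed
  qed (use K insert.prems in auto)
  then obtain w where w: "\<exists>i\<in>I. w i \<noteq> 0" "\<forall>l\<in>K'. (\<Sum>i\<in>I. A l i * w i) = 0" by blast
  \<comment> \<open>Equation \<open>k\<close>, dropped from the system, is recovered from row
    \<open>m\<close> of \<open>B A = 0\<close>: all other terms vanish and \<open>B m k\<close> is
    nonzero.\<close>
  have "0 = (\<Sum>i\<in>I. (\<Sum>l\<in>K. B m l * A l i) * w i)" using insert.prems(5) by simp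
  also have "\<dots> = (\<Sum>l\<in>K. B m l * (\<Sum>i\<in>I. A l i * w i))"
    by (simp add: sum_distrib_left sum_distrib_right mult.assoc) (rule sum.swap)
  also have "\<dots> = B m k * (\<Sum>i\<in>I. A k i * w i)" using w(2) K by simp
  finally show ?case using k w K by (intro exI[of _ w]) auto
qed

text \<open>The least order among the nonzero entries is the largest power of \<open>X\<close>
  dividing all of them; the entry attaining it becomes a unit.\<close>

lemma fps_primitive_scaling:
  fixes w :: "'i \<Rightarrow> 'a::field fps"
  assumes "finite I" "\<exists>i\<in>I. w i \<noteq> 0"
  obtains n w' where "\<And>i. i \<in> I \<Longrightarrow> w i = fps_X ^ n * w' i" "\<exists>i\<in>I. fps_nth (w' i) 0 \<noteq> 0"
proof -
  define N where "N = subdegree ` w ` {i\<in>I. w i \<noteq> 0}"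
  have N: "finite N" "N \<noteq> {}" using assms by (auto simp: N_def)
  obtain i where i: "i \<in> I" "w i \<noteq> 0" "subdegree (w i) = Min N"
    using Min_in[OF N] by (auto simp: N_def)
  have "w j = fps_X ^ Min N * fps_shift (Min N) (w j)" if "j \<in> I" for j
  proof (cases "w j = 0")
    case False
    then have "Min N \<le> subdegree (w j)" using N that by (auto simp: N_def)
    then show ?thesis using fps_shift_times_fps_X_power[of "Min N" "w j"] by (simp add: mult.commute)
  qed auto
  moreover have "fps_nth (fps_shift (Min N) (w i)) 0 \<noteq> 0" using i(2,3) by (simp flip: i(3))
  ultimately show thesis using that[of "Min N" "\<lambda>j. fps_shift (Min N) (w j)"] i(1) by blast
qed

text \<open>Comparing coefficients gives vanishing moments, the sums of \<open>c a * a ^ n\<close>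
  over \<open>S\<close>, hence a vanishing sum against every polynomial. A polynomial with roots at
  all points of \<open>S\<close> except \<open>b\<close> isolates \<open>c b\<close>.\<close>

lemma fps_exp_independent:
  fixes c :: "'a::field_char_0 \<Rightarrow> 'a"
  assumes "finite S" "(\<Sum>a\<in>S. fps_const (c a) * fps_exp a) = 0" "b \<in> S"
  shows "c b = 0"
proof -
  have pw: "(\<Sum>a\<in>S. c a * a ^ n) = 0" for n
  proof -
    have "fps_nth (\<Sum>a\<in>S. fps_const (c a) * fps_exp a) n * fact n = (\<Sum>a\<in>S. c a * a ^ n)"
      by (simp add: fps_sum_nth sum_distrib_right)
    then show ?thesis by (simp add: assms(2))
  qed
  have pol: "(\<Sum>a\<in>S. c a * poly p a) = 0" for p
  proof -
    have "(\<Sum>a\<in>S. c a * poly p a) = (\<Sum>i\<le>degree p. coeff p i * (\<Sum>a\<in>S. c a * a ^ i))"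
      unfolding poly_altdef sum_distrib_left by (subst sum.swap) (simp add: mult_ac)
    then show ?thesis by (simp add: pw)
  qed
  define p where "p = (\<Prod>a\<in>S-{b}. [:-a, 1:])"
  have "poly p a = 0" if "a \<in> S - {b}" for a
    using that assms(1) by (auto simp: p_def poly_prod)
  then have "(\<Sum>a\<in>S. c a * poly p a) = c b * poly p b"
    using assms by (simp add: sum.remove)
  moreover have "poly p b \<noteq> 0" using assms(1) by (auto simp: p_def poly_prod)
  ultimately show ?thesis using pol[of p] by simp
qed

section \<open>Specialization of Laurent polynomials to power series\<close>

definition weight :: "int \<times> int \<Rightarrow> real" where
  "weight k = of_int (fst k) + of_int (snd k) * sqrt 2"

definition specialize :: "laurent \<Rightarrow> real fps" where
  "specialize f = (\<Sum>k\<in>Poly_Mapping.keys f. fps_const (of_int (Poly_Mapping.lookup f k)) * fps_exp (weight k))"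

text \<open>Infinite descent: both numbers are even and can be halved. This is the irrationality of
  \<open>sqrt 2\<close> in the form used for \<open>inj_weight\<close>.\<close>

lemma square_eq_twice_square_iff:
  fixes a b :: nat
  shows "a\<^sup>2 = 2 * b\<^sup>2 \<longleftrightarrow> a = 0 \<and> b = 0"
proof
  show "a\<^sup>2 = 2 * b\<^sup>2 \<Longrightarrow> a = 0 \<and> b = 0"
  proof (induction a arbitrary: b rule: less_induct)
    case (less a)
    then have "even a" by (metis dvd_triv_left even_power)
    then obtain c where c: "a = 2 * c" by blast
    then have b: "b\<^sup>2 = 2 * c\<^sup>2" using less.prems by (simp add: power_mult_distrib)
    then have "even b" by (metis dvd_triv_left even_power)
    then obtain d where d: "b = 2 * d" by blast
    then have "c\<^sup>2 = 2 * d\<^sup>2" using b by (simp add: power_mult_distrib)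
    then show ?case using less.IH[of c d] c d by (cases "c = 0") auto
  qed
qed simp

lemma inj_weight: "inj weight"
proof (rule injI)
  fix k l :: "int \<times> int"
  assume eq: "weight k = weight l"
  have "snd k = snd l"
  proof (rule ccontr)
    assume "snd k \<noteq> snd l"
    let ?a = "fst l - fst k" and ?b = "snd k - snd l"
    have "of_int ?b * sqrt 2 = real_of_int ?a"
      using eq by (simp add: weight_def algebra_simps)
    then have "(of_int ?b * sqrt 2)\<^sup>2 = (real_of_int ?a)\<^sup>2" by simp
    then have "real_of_int (?a\<^sup>2) = real_of_int (2 * ?b\<^sup>2)"
      by (simp only: power_mult_distrib real_sqrt_pow2 of_int_power of_int_mult)
    then have "?a\<^sup>2 = 2 * ?b\<^sup>2" by (simp only: of_int_eq_iff)
    then have "int ((nat \<bar>?a\<bar>)\<^sup>2) = int (2 * (nat \<bar>?b\<bar>)\<^sup>2)" by simp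
    then have "(nat \<bar>?a\<bar>)\<^sup>2 = 2 * (nat \<bar>?b\<bar>)\<^sup>2" by (simp only: of_nat_eq_iff)
    then show False using \<open>snd k \<noteq> snd l\<close> unfolding square_eq_twice_square_iff by simp
  qed
  then show "k = l" using eq by (simp add: weight_def prod_eq_iff)
qed

lemma specialize_sum_superset:
  assumes "finite A" "Poly_Mapping.keys f \<subseteq> A"
  shows "specialize f = (\<Sum>k\<in>A. fps_const (of_int (Poly_Mapping.lookup f k)) * fps_exp (weight k))"
  unfolding specialize_def using assms
  by (intro sum.mono_neutral_left) (auto simp: in_keys_iff)

lemma specialize_add: "specialize (f + g) = specialize f + specialize g"
proof -
  let ?A = "Poly_Mapping.keys f \<union> Poly_Mapping.keys g"
  have "Poly_Mapping.keys (f + g) \<subseteq> ?A" by (rule Poly_Mapping.keys_add)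
  then show ?thesis
    using specialize_sum_superset[of ?A f] specialize_sum_superset[of ?A g]
      specialize_sum_superset[of ?A "f + g"]
    by (simp add: lookup_add sum.distrib algebra_simps flip: fps_const_add)
qed

lemma specialize_single: "specialize (Poly_Mapping.single k c) = fps_const (of_int c) * fps_exp (weight k)"
  by (simp add: specialize_def)

lemma specialize_0 [simp]: "specialize 0 = 0"
  by (simp add: specialize_def)

text \<open>Induction on the number of monomials. With additivity it reduces the multiplicativity of
  \<open>specialize\<close> to single terms.\<close>

lemma laurent_induct [case_names zero single add]:
  assumes "P 0" "\<And>k c. P (Poly_Mapping.single k c)" "\<And>f g. P f \<Longrightarrow> P g \<Longrightarrow> P (f + g)"
  shows "P (f :: laurent)"
proof (induction "card (Poly_Mapping.keys f)" arbitrary: f)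
  case 0
  then show ?case using assms(1) by simp
next
  case (Suc n)
  then have "Poly_Mapping.keys f \<noteq> {}" by (metis card.empty nat.distinct(1))
  then obtain k where k: "k \<in> Poly_Mapping.keys f" by blast
  define g where "g = f - Poly_Mapping.single k (Poly_Mapping.lookup f k)"
  have "Poly_Mapping.keys g = Poly_Mapping.keys f - {k}"
    by (auto simp: g_def in_keys_iff lookup_minus lookup_single when_def split: if_splits)
  then have "P g" using Suc k by simp
  moreover have "f = Poly_Mapping.single k (Poly_Mapping.lookup f k) + g" by (simp add: g_def)
  ultimately show ?case using assms(2,3) by metis
qed

lemma specialize_mult: "specialize (f * g) = specialize f * specialize g"
proof (induction f rule: laurent_induct)
  case (single k c)
  show ?case
    by (induction g rule: laurent_induct)
      (simp_all add: mult_single specialize_single specialize_add distrib_left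
         fps_exp_add_mult weight_def algebra_simps flip: fps_const_mult)
qed (simp_all add: specialize_add distrib_right)

interpretation specialize: comm_ring_hom specialize
proof
  show "specialize 1 = 1"
    using specialize_single[of 0 1] by (simp add: weight_def single_one)
qed (simp_all add: specialize_add specialize_mult)

text \<open>Distinct monomials have distinct weights, so the image is a combination of independent
  exponentials with the coefficients of \<open>f\<close>.\<close>

lemma specialize_eq_0D:
  assumes "specialize f = 0"
  shows "f = 0"
proof -
  let ?c = "\<lambda>a. real_of_int (Poly_Mapping.lookup f (Hilbert_Choice.inv weight a))"
  have "(\<Sum>a\<in>weight ` Poly_Mapping.keys f. fps_const (?c a) * fps_exp a) = specialize f"
    unfolding specialize_def
    by (subst sum.reindex) (auto intro: inj_on_subset[OF inj_weight] simp: inv_f_f[OF inj_weight])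
  then have "?c a = 0" if "a \<in> weight ` Poly_Mapping.keys f" for a
    using that assms by (intro fps_exp_independent[of "weight ` Poly_Mapping.keys f"]) auto
  then have "k \<notin> Poly_Mapping.keys f" for k
    by (force simp: inv_f_f[OF inj_weight] in_keys_iff)
  then show ?thesis by (auto intro!: poly_mapping_eqI simp: in_keys_iff)
qed

section \<open>Cyclic words\<close>

text \<open>
  A list of words with distinct letters stands for the permutation \<open>succ\<close> that has these words as cycles.
  \<open>around W l\<close> is the cycle of \<open>l\<close> read off from \<open>l\<close>.
\<close>

definition around :: "'a list list \<Rightarrow> 'a \<Rightarrow> 'a list" where
  "around W l = (THE xs. \<exists>w\<in>set W. \<exists>k. xs = rotate k w \<and> w \<noteq> [] \<and> hd xs = l)"

definition succ :: "'a list list \<Rightarrow> 'a \<Rightarrow> 'a" where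
  "succ W l = hd (rotate1 (around W l))"

text \<open>For \<open>l\<close> outside \<open>B\<close> this is the successor of \<open>l\<close>
  once the letters of \<open>B\<close> are deleted. The search starts behind \<open>l\<close> and
  ends with \<open>l\<close>, so a cycle whose other letters all lie in \<open>B\<close> gives back
  \<open>l\<close> itself.\<close>

definition first_outside :: "'a list list \<Rightarrow> 'a set \<Rightarrow> 'a \<Rightarrow> 'a" where
  "first_outside W B l = hd (filter (\<lambda>a. a \<notin> B) (rotate1 (around W l)))"

definition word_index :: "'a list list \<Rightarrow> 'a \<Rightarrow> nat" where
  "word_index W l = (THE i. i < length W \<and> l \<in> set (W ! i))"

lemma filter_rotate: "\<exists>k'. filter P (rotate k w) = rotate k' (filter P w)"
proof -
  let ?m = "k mod length w"
  have "filter P (rotate k w) = filter P (drop ?m w) @ filter P (take ?m w)"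
    by (simp add: rotate_drop_take)
  also have "\<dots> = rotate (length (filter P (take ?m w))) (filter P (take ?m w) @ filter P (drop ?m w))"
    by (simp add: rotate_append)
  also have "filter P (take ?m w) @ filter P (drop ?m w) = filter P w"
    by (simp flip: filter_append)
  finally show ?thesis by blast
qed

lemma rotate_eqI_hd:
  assumes "distinct w" "w \<noteq> []" "hd (rotate k w) = hd (rotate k' w)"
  shows "rotate k w = rotate k' w"
proof -
  have "w ! (k mod length w) = w ! (k' mod length w)"
    using assms by (simp add: hd_rotate_conv_nth)
  then have "k mod length w = k' mod length w"
    using assms by (simp add: nth_eq_iff_index_eq)
  then show ?thesis by (metis rotate_conv_mod)
qed

context
  fixes W :: "'a list list"
  assumes dist: "distinct (concat W)"
begin

lemma word_eqI: "w \<in> set W \<Longrightarrow> w' \<in> set W \<Longrightarrow> l \<in> set w \<Longrightarrow> l \<in> set w' \<Longrightarrow> w = w'"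
  using dist unfolding distinct_concat_iff by blast

lemma distinct_word: "w \<in> set W \<Longrightarrow> distinct w"
  using dist unfolding distinct_concat_iff by blast

lemma around_eq:
  assumes "w \<in> set W" "w \<noteq> []" "hd (rotate k w) = l"
  shows "around W l = rotate k w"
  unfolding around_def
proof (rule the_equality)
  show "\<exists>w'\<in>set W. \<exists>k'. rotate k w = rotate k' w' \<and> w' \<noteq> [] \<and> hd (rotate k w) = l"
    using assms by blast
next
  fix xs assume "\<exists>w\<in>set W. \<exists>k. xs = rotate k w \<and> w \<noteq> [] \<and> hd xs = l"
  then obtain w' k' where w': "w' \<in> set W" "xs = rotate k' w'" "w' \<noteq> []" "hd xs = l" by blast
  have "l \<in> set w" using assms hd_in_set[of "rotate k w"] by simp
  moreover have "l \<in> set w'" using w' hd_in_set[of "rotate k' w'"] by simp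
  ultimately have "w' = w" using word_eqI assms(1) w'(1) by blast
  then show "xs = rotate k w"
    using rotate_eqI_hd[of w k' k] distinct_word assms w' by simp
qed

lemma aroundE:
  assumes "l \<in> set (concat W)"
  obtains w k v where "w \<in> set W" "w \<noteq> []" "rotate k w = l # v" "around W l = l # v"
proof -
  obtain w where w: "w \<in> set W" "l \<in> set w" using assms by auto
  then obtain k where k: "k < length w" "w ! k = l" by (auto simp: in_set_conv_nth)
  have "w \<noteq> []" using w by auto
  moreover have hd: "hd (rotate k w) = l" using k \<open>w \<noteq> []\<close> by (simp add: hd_rotate_conv_nth)
  moreover have "rotate k w = l # tl (rotate k w)" using hd \<open>w \<noteq> []\<close> by (metis list.exhaust_sel rotate_is_Nil_conv)
  ultimately show thesis using that w(1) around_eq[OF w(1)] by metis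
qed

lemma succ_eq:
  assumes "w \<in> set W" "rotate k w = l # v"
  shows "succ W l = hd (v @ [l])"
proof -
  have "w \<noteq> []" using assms(2) by auto
  then show ?thesis using around_eq[OF assms(1), of k l] assms(2) by (simp add: succ_def)
qed

lemma succ_rotate:
  assumes "w \<in> set W" "rotate k w = a # b # v"
  shows "succ W a = b"
  using succ_eq[OF assms] by simp

lemma succ_adjacent:
  assumes "u @ a # b # v \<in> set W"
  shows "succ W a = b"
  using succ_rotate[OF assms, of "length u"] by (simp add: rotate_append)

lemma succ_last:
  assumes "u @ [a] \<in> set W"
  shows "succ W a = hd (u @ [a])"
  using succ_eq[OF assms, of "length u"] by (simp add: rotate_append)

lemma around_succ:
  assumes "l \<in> set (concat W)"
  shows "around W (succ W l) = rotate1 (around W l)"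
proof -
  obtain w k v where w: "w \<in> set W" "w \<noteq> []" "rotate k w = l # v" "around W l = l # v"
    by (rule aroundE[OF assms])
  have "hd (rotate (Suc k) w) = succ W l" using succ_eq[OF w(1,3)] w by simp
  then have "around W (succ W l) = rotate (Suc k) w" using around_eq w by blast
  then show ?thesis using w by simp
qed

lemma succ_same_word:
  assumes "w \<in> set W" "l \<in> set w"
  shows "succ W l \<in> set w"
proof -
  have "l \<in> set (concat W)" using assms by auto
  then obtain w' k v where w: "w' \<in> set W" "w' \<noteq> []" "rotate k w' = l # v"
    by (rule aroundE)
  then have "set w' = set (l # v)" by (metis set_rotate)
  moreover from this have "w' = w" using word_eqI assms w by force
  ultimately show ?thesis using succ_eq[OF w(1,3)] by (cases v) auto
qed

lemma succ_in: "l \<in> set (concat W) \<Longrightarrow> succ W l \<in> set (concat W)"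
  using succ_same_word by fastforce

lemma inj_on_succ: "inj_on (succ W) (set (concat W))"
proof (rule inj_onI)
  fix a b assume ab: "a \<in> set (concat W)" "b \<in> set (concat W)" "succ W a = succ W b"
  then have "rotate1 (around W a) = rotate1 (around W b)" by (metis around_succ)
  then have "around W a = around W b" using inj_rotate1 by (metis injD)
  then show "a = b" by (metis ab(1,2) aroundE list.inject)
qed

lemma bij_succ: "bij_betw (succ W) (set (concat W)) (set (concat W))"
  unfolding bij_betw_def
  using inj_on_succ succ_in endo_inj_surj[of "set (concat W)" "succ W"] by blast

lemma first_outside_stop:
  assumes "l \<in> set (concat W)" "succ W l \<notin> B"
  shows "first_outside W B l = succ W l"
proof -
  have "around W l \<noteq> []" using assms(1) by (metis aroundE list.discI)
  then show ?thesis using assms(2)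
    by (cases "rotate1 (around W l)") (auto simp: first_outside_def succ_def)
qed

lemma first_outside_step:
  assumes "l \<in> set (concat W)" "succ W l \<in> B"
  shows "first_outside W B l = first_outside W B (succ W l)"
proof -
  have "around W l \<noteq> []" using assms(1) by (metis aroundE list.discI)
  then obtain s r where "rotate1 (around W l) = s # r" by (cases "rotate1 (around W l)") auto
  then show ?thesis using assms(2)
    by (simp add: first_outside_def around_succ[OF assms(1)]) (simp add: succ_def)
qed

lemma distinct_concat_filter: "distinct (concat (map (filter P) W))"
  using dist by (simp flip: filter_concat)

lemma set_concat_filter: "set (concat (map (filter P) W)) = {l \<in> set (concat W). P l}"
  by auto

lemma word_index_eq:
  assumes "i < length W" "l \<in> set (W ! i)"
  shows "word_index W l = i"
  unfolding word_index_def
proof (rule the_equality)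
  fix j assume j: "j < length W \<and> l \<in> set (W ! j)"
  have gen: "distinct (concat V) \<Longrightarrow> i < length V \<Longrightarrow> j < length V \<Longrightarrow> l \<in> set (V ! i) \<Longrightarrow>
    l \<in> set (V ! j) \<Longrightarrow> i = j" for V
  proof (induction V arbitrary: i j)
    case (Cons v V)
    have "l \<notin> set v \<or> l \<notin> set (V ! k)" if "k < length V" for k
      using Cons.prems(1) that nth_mem by fastforce
    then show ?case using Cons by (cases i; cases j) auto
  qed simp
  show "j = i" using gen[OF dist] assms j by blast
qed (use assms in simp)

lemma word_indexE:
  assumes "l \<in> set (concat W)"
  obtains i where "i < length W" "l \<in> set (W ! i)" "word_index W l = i"
proof -
  obtain w where "w \<in> set W" "l \<in> set w" using assms by auto
  then show thesis using that word_index_eq by (metis in_set_conv_nth)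
qed

lemma word_index_succ:
  assumes "l \<in> set (concat W)"
  shows "word_index W (succ W l) = word_index W l"
  using assms by (metis word_indexE word_index_eq nth_mem succ_same_word)

lemma word_index_less: "l \<in> set (concat W) \<Longrightarrow> word_index W l < length W"
  by (metis word_indexE)

end

lemma succ_filter:
  assumes dist: "distinct (concat W)" and l: "l \<in> set (concat W)" "l \<notin> B"
  shows "succ (map (filter (\<lambda>a. a \<notin> B)) W) l = first_outside W B l"
proof -
  obtain w k v where w: "w \<in> set W" "w \<noteq> []" "rotate k w = l # v" "around W l = l # v"
    by (rule aroundE[OF dist l(1)])
  let ?f = "filter (\<lambda>a. a \<notin> B)"
  obtain k' where k': "?f (rotate k w) = rotate k' (?f w)" using filter_rotate by blast
  then have "rotate k' (?f w) = l # ?f v" using w(3) l(2) by simp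
  then have "succ (map ?f W) l = hd (?f v @ [l])"
    by (intro succ_eq[where w = "?f w"] distinct_concat_filter[OF dist]) (use w in auto)
  then show ?thesis using w l(2) by (simp add: first_outside_def)
qed

lemma word_index_filter:
  assumes dist: "distinct (concat W)" and l: "l \<in> set (concat W)" "P l"
  shows "word_index (map (filter P) W) l = word_index W l"
proof -
  obtain i where i: "i < length W" "l \<in> set (W ! i)" "word_index W l = i" by (rule word_indexE[OF dist l(1)])
  then show ?thesis using l(2) by (simp add: word_index_eq[OF distinct_concat_filter[OF dist]])
qed

section \<open>Labellings and chain maps\<close>

text \<open>
  \<open>Inl p\<close> stands for the arc arriving at the classical passage \<open>p\<close>.  \<open>Inr b\<close> is a bead, a marked point that
  does not change labels; one bead on every component serves as base point, so that crossingless
  components carry a label, too.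
\<close>

type_synonym letter = "passage + nat"

type_synonym labelling = "letter \<Rightarrow> real fps"

fun partner :: "passage \<Rightarrow> passage" where
  "partner (Passage c a l) = Passage c (if a = FromLeft then FromRight else FromLeft)
     (case l of Over \<Rightarrow> Under | Under \<Rightarrow> Over | Virtual \<Rightarrow> Virtual)"

text \<open>Both passages of a classical crossing give its sign: at a positive crossing the strand
  from the left is over and the one from the right is under.\<close>

definition sign :: "passage \<Rightarrow> bool" where
  "sign p \<longleftrightarrow> (side p = FromLeft) = (level p = Over)"

text \<open>Together with \<open>under_unit\<close>, these are the images of the diagonal entries
  \<open>s^-1\<close>, \<open>t^-1\<close> of \<open>M_plus\<close> and \<open>s\<close>,
  \<open>t\<close> of \<open>M_minus\<close>.\<close>

definition over_unit :: "bool \<Rightarrow> real fps" where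
  "over_unit e = fps_exp (if e then - 1 else 1)"

definition under_unit :: "bool \<Rightarrow> real fps" where
  "under_unit e = fps_exp (if e then - sqrt 2 else sqrt 2)"

text \<open>
  The label of the arc leaving the letter, as prescribed by the rows of \<open>M_plus\<close> and \<open>M_minus\<close>.
\<close>

fun out :: "letter \<Rightarrow> labelling \<Rightarrow> real fps" where
  "out (Inl p) x =
     (if level p = Over then over_unit (sign p) * x (Inl p)
      else under_unit (sign p) * x (Inl p) +
        (1 - over_unit (sign p) * under_unit (sign p)) * x (Inl (partner p)))"
| "out (Inr b) x = x (Inr b)"

abbreviation aug :: "real fps \<Rightarrow> real" where
  "aug f \<equiv> fps_nth f 0"

text \<open>The matrix \<open>P - M\<close> applied to a labelling, with one further row for every
  bead. The entries outside \<open>L\<close> are set to 0, which makes the residue a vector indexed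
  by \<open>L\<close>.\<close>

definition residue :: "letter set \<Rightarrow> (letter \<Rightarrow> letter) \<Rightarrow> labelling \<Rightarrow> labelling" where
  "residue L \<sigma> x l = (if l \<in> L then x (\<sigma> l) - out l x else 0)"

definition linear_form :: "(labelling \<Rightarrow> real fps) \<Rightarrow> bool" where
  "linear_form f \<longleftrightarrow> (\<forall>a b x y. f (\<lambda>l. a * x l + b * y l) = a * f x + b * f y)"

text \<open>
  A map \<open>(Q, P)\<close> of two-term complexes that, modulo \<open>X\<close>, preserves labellings which are constant on
  components and, dually, sums of residues over components.
\<close>

definition chain :: "letter set \<Rightarrow> (letter \<Rightarrow> letter) \<Rightarrow> (letter \<Rightarrow> nat) \<Rightarrow>
    letter set \<Rightarrow> (letter \<Rightarrow> letter) \<Rightarrow> (letter \<Rightarrow> nat) \<Rightarrow> bool" where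
  "chain L \<sigma> \<kappa> L' \<sigma>' \<kappa>' \<longleftrightarrow>
     (\<exists>Q P. (\<forall>l. linear_form (\<lambda>x. Q x l)) \<and> (\<forall>l. linear_form (\<lambda>r. P r l)) \<and>
        (\<forall>x. \<forall>l\<in>L'. residue L' \<sigma>' (Q x) l = P (residue L \<sigma> x) l) \<and>
        (\<forall>c x. (\<forall>l\<in>L. aug (x l) = c (\<kappa> l)) \<longrightarrow> (\<forall>l\<in>L'. aug (Q x l) = c (\<kappa>' l))) \<and>
        (\<forall>c r. (\<Sum>l\<in>L'. c (\<kappa>' l) * aug (P r l)) = (\<Sum>l\<in>L. c (\<kappa> l) * aug (r l))))"

lemma passage_cases:
  obtains c a l where "p = Passage c a l" "a = FromLeft \<or> a = FromRight" "l = Over \<or> l = Under \<or> l = Virtual"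
  by (cases p) (metis level.exhaust side.exhaust)

lemma partner_partner [simp]: "partner (partner p) = p"
  by (rule passage_cases[of p]) auto

lemma crossing_partner [simp]: "crossing (partner p) = crossing p"
  by (rule passage_cases[of p]) auto

lemma partner_neq [simp]: "partner p \<noteq> p" "p \<noteq> partner p"
  by (rule passage_cases[of p]; auto)+

lemma sign_partner [simp]: "level p \<noteq> Virtual \<Longrightarrow> sign (partner p) = sign p"
  by (rule passage_cases[of p]) (auto simp: sign_def)

lemma level_partner [simp]:
  "level (partner p) = Over \<longleftrightarrow> level p = Under"
  "level (partner p) = Under \<longleftrightarrow> level p = Over"
  "level (partner p) = Virtual \<longleftrightarrow> level p = Virtual"
  by (rule passage_cases[of p]; auto)+

lemma unit_inverse:
  "over_unit e * over_unit (\<not> e) = 1" "over_unit (\<not> e) * over_unit e = 1"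
  "under_unit e * under_unit (\<not> e) = 1" "under_unit (\<not> e) * under_unit e = 1"
  by (auto simp: over_unit_def under_unit_def simp flip: fps_exp_add_mult)

lemma aug_unit [simp]: "aug (over_unit e) = 1" "aug (under_unit e) = 1"
  by (auto simp: over_unit_def under_unit_def)

lemma aug_out [simp]: "aug (out l x) = aug (x l)"
  by (cases l) auto

lemma linear_form_out: "linear_form (out l)"
  by (cases l) (auto simp: linear_form_def algebra_simps)

lemma linear_form_add: "linear_form f \<Longrightarrow> f (\<lambda>l. x l + y l) = f x + f y"
  unfolding linear_form_def by (drule spec[of _ 1], drule spec[of _ 1]) auto

lemma linear_form_scale: "linear_form f \<Longrightarrow> f (\<lambda>l. a * x l) = a * f x"
  unfolding linear_form_def by (drule spec[of _ a], drule spec[of _ 0]) auto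

lemma linear_form_zero: "linear_form f \<Longrightarrow> f (\<lambda>l. 0) = 0"
  using linear_form_scale[of f 0 "\<lambda>_. 0"] by simp

lemma linear_form_compose:
  assumes "linear_form f" "\<And>l. linear_form (\<lambda>x. Q x l)"
  shows "linear_form (\<lambda>x. f (Q x))"
proof -
  have "Q (\<lambda>l. a * x l + b * y l) = (\<lambda>l. a * Q x l + b * Q y l)" for a b x y
    using assms(2) by (auto simp: linear_form_def)
  then show ?thesis using assms(1) by (simp add: linear_form_def)
qed

lemma linear_form_residue: "linear_form (\<lambda>x. residue L \<sigma> x l)"
  using linear_form_out[of l] by (auto simp: linear_form_def residue_def algebra_simps)

definition deps :: "letter \<Rightarrow> letter set" where
  "deps l = (case l of Inl p \<Rightarrow> if level p = Over then {l} else {l, Inl (partner p)} | Inr b \<Rightarrow> {l})"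

lemma out_cong: "(\<And>m. m \<in> deps l \<Longrightarrow> x m = y m) \<Longrightarrow> out l x = out l y"
  by (cases l) (auto simp: deps_def)

lemma chainI:
  assumes "\<And>l. linear_form (\<lambda>x. Q x l)" "\<And>l. linear_form (\<lambda>r. P r l)"
    and "\<And>x l. l \<in> L' \<Longrightarrow> residue L' \<sigma>' (Q x) l = P (residue L \<sigma> x) l"
    and "\<And>c x l. \<forall>l\<in>L. aug (x l) = c (\<kappa> l) \<Longrightarrow> l \<in> L' \<Longrightarrow> aug (Q x l) = c (\<kappa>' l)"
    and "\<And>c r. (\<Sum>l\<in>L'. c (\<kappa>' l) * aug (P r l)) = (\<Sum>l\<in>L. c (\<kappa> l) * aug (r l))"
  shows "chain L \<sigma> \<kappa> L' \<sigma>' \<kappa>'"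
  unfolding chain_def using assms by blast

lemma chainE:
  assumes "chain L \<sigma> \<kappa> L' \<sigma>' \<kappa>'"
  obtains Q P where "\<And>l. linear_form (\<lambda>x. Q x l)" "\<And>l. linear_form (\<lambda>r. P r l)"
    "\<And>x. residue L' \<sigma>' (Q x) = P (residue L \<sigma> x)"
    "\<And>c x l. \<forall>l\<in>L. aug (x l) = c (\<kappa> l) \<Longrightarrow> l \<in> L' \<Longrightarrow> aug (Q x l) = c (\<kappa>' l)"
    "\<And>c r. (\<Sum>l\<in>L'. c (\<kappa>' l) * aug (P r l)) = (\<Sum>l\<in>L. c (\<kappa> l) * aug (r l))"
    "\<And>r l. l \<notin> L' \<Longrightarrow> P r l = 0"
proof -
  from assms obtain Q P where QP: "\<forall>l. linear_form (\<lambda>x. Q x l)" "\<forall>l. linear_form (\<lambda>r. P r l)"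
    "\<forall>x. \<forall>l\<in>L'. residue L' \<sigma>' (Q x) l = P (residue L \<sigma> x) l"
    "\<forall>c x. (\<forall>l\<in>L. aug (x l) = c (\<kappa> l)) \<longrightarrow> (\<forall>l\<in>L'. aug (Q x l) = c (\<kappa>' l))"
    "\<forall>c r. (\<Sum>l\<in>L'. c (\<kappa>' l) * aug (P r l)) = (\<Sum>l\<in>L. c (\<kappa> l) * aug (r l))"
    unfolding chain_def by (elim exE conjE)
  note 1 = QP(1,2)[rule_format] QP(3)[rule_format] QP(4)[THEN spec, THEN spec, THEN mp] QP(5)[rule_format]
  \<comment> \<open>The definition of \<open>chain\<close> constrains the map on residues only at
    letters of \<open>L'\<close>. Cutting it off elsewhere turns the identity at these letters into
    an equality of functions.\<close>
  define P' where "P' r l = (if l \<in> L' then P r l else 0)" for r l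
  have "linear_form (\<lambda>r. P' r l)" for l
    using 1(2)[of l] by (auto simp: P'_def linear_form_def)
  moreover have "residue L' \<sigma>' (Q x) = P' (residue L \<sigma> x)" for x
    using 1(3) by (auto simp: P'_def residue_def)
  moreover have "(\<Sum>l\<in>L'. c (\<kappa>' l) * aug (P' r l)) = (\<Sum>l\<in>L. c (\<kappa> l) * aug (r l))" for c r
    unfolding 1(5)[symmetric] by (intro sum.cong) (auto simp: P'_def)
  ultimately show thesis using that[of Q P', OF 1(1)] 1(4) by (simp add: P'_def)
qed

lemma chain_refl: "chain L \<sigma> \<kappa> L \<sigma> \<kappa>"
  unfolding chain_def by (intro exI[of _ "\<lambda>x. x"]) (auto simp: linear_form_def)

lemma chain_trans:
  assumes "chain L \<sigma> \<kappa> L' \<sigma>' \<kappa>'" "chain L' \<sigma>' \<kappa>' L'' \<sigma>'' \<kappa>''"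
  shows "chain L \<sigma> \<kappa> L'' \<sigma>'' \<kappa>''"
proof (rule chainE[OF assms(1)], rule chainE[OF assms(2)])
  fix Q P Q' P'
  assume Q: "\<And>l. linear_form (\<lambda>x. Q x l)" and P: "\<And>l. linear_form (\<lambda>r. P r l)"
    and QP: "\<And>x. residue L' \<sigma>' (Q x) = P (residue L \<sigma> x)"
    and augQ: "\<And>(c :: nat \<Rightarrow> real) x l. \<forall>l\<in>L. aug (x l) = c (\<kappa> l) \<Longrightarrow> l \<in> L' \<Longrightarrow> aug (Q x l) = c (\<kappa>' l)"
    and augP: "\<And>(c :: nat \<Rightarrow> real) r. (\<Sum>l\<in>L'. c (\<kappa>' l) * aug (P r l)) = (\<Sum>l\<in>L. c (\<kappa> l) * aug (r l))"
    and Q': "\<And>l. linear_form (\<lambda>x. Q' x l)" and P': "\<And>l. linear_form (\<lambda>r. P' r l)"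
    and QP': "\<And>x. residue L'' \<sigma>'' (Q' x) = P' (residue L' \<sigma>' x)"
    and augQ': "\<And>(c :: nat \<Rightarrow> real) x l. \<forall>l\<in>L'. aug (x l) = c (\<kappa>' l) \<Longrightarrow> l \<in> L'' \<Longrightarrow> aug (Q' x l) = c (\<kappa>'' l)"
    and augP': "\<And>(c :: nat \<Rightarrow> real) r. (\<Sum>l\<in>L''. c (\<kappa>'' l) * aug (P' r l)) = (\<Sum>l\<in>L'. c (\<kappa>' l) * aug (r l))"
  show ?thesis
  proof (rule chainI[of "\<lambda>x. Q' (Q x)" "\<lambda>r. P' (P r)"])
    show "linear_form (\<lambda>x. Q' (Q x) l)" "linear_form (\<lambda>r. P' (P r) l)" for l
      by (rule linear_form_compose[OF Q' Q], rule linear_form_compose[OF P' P])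
    show "aug (Q' (Q x) l) = c (\<kappa>'' l)" if "\<forall>l\<in>L. aug (x l) = c (\<kappa> l)" "l \<in> L''"
      for c :: "nat \<Rightarrow> real" and x l
      using augQ[OF that(1)] augQ' that(2) by blast
  qed (simp_all only: QP QP' augP augP')
qed

lemma chain_cong:
  assumes "chain L \<sigma> \<kappa> L' \<sigma>' \<kappa>'"
    and "\<And>l. l \<in> L \<Longrightarrow> \<sigma>1 l = \<sigma> l" "\<And>l. l \<in> L \<Longrightarrow> \<kappa>1 l = \<kappa> l"
    and "\<And>l. l \<in> L' \<Longrightarrow> \<sigma>1' l = \<sigma>' l" "\<And>l. l \<in> L' \<Longrightarrow> \<kappa>1' l = \<kappa>' l"
  shows "chain L \<sigma>1 \<kappa>1 L' \<sigma>1' \<kappa>1'"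
proof -
  have "residue L \<sigma>1 = residue L \<sigma>" "residue L' \<sigma>1' = residue L' \<sigma>'"
    using assms by (auto simp: residue_def fun_eq_iff)
  moreover have "(\<Sum>l\<in>L. c (\<kappa>1 l) * f l) = (\<Sum>l\<in>L. c (\<kappa> l) * f l)"
    "(\<Sum>l\<in>L'. c (\<kappa>1' l) * f l) = (\<Sum>l\<in>L'. c (\<kappa>' l) * f l)" for c :: "nat \<Rightarrow> real" and f
    using assms by (auto intro: sum.cong)
  ultimately show ?thesis using assms(1,3,5) unfolding chain_def by simp
qed

text \<open>
  Each \<open>(a, l)\<close> assigns to \<open>a\<close>, the successor of \<open>l\<close>, the label that makes \<open>r l\<close> the residue at \<open>l\<close>.
\<close>

fun propagate :: "(letter \<times> letter) list \<Rightarrow> labelling \<Rightarrow> labelling \<Rightarrow> labelling" where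
  "propagate [] x r = x"
| "propagate ((a, l) # es) x r = propagate es (x(a := out l x + r l)) r"

text \<open>Triangularity of the system: every label read by an assignment is final at that moment.
  Hence after the propagation all the equations hold simultaneously, and the solution is determined
  by the labels of the letters that are never assigned.\<close>

fun ordered :: "(letter \<times> letter) list \<Rightarrow> bool" where
  "ordered [] \<longleftrightarrow> True"
| "ordered ((a, l) # es) \<longleftrightarrow> a \<notin> deps l \<and> a \<notin> fst ` set es \<and> deps l \<inter> fst ` set es = {} \<and> ordered es"

lemma propagate_outside: "a \<notin> fst ` set es \<Longrightarrow> propagate es x r a = x a"
  by (induction es x r rule: propagate.induct) auto

lemma propagate_eq:
  "ordered es \<Longrightarrow> (a, l) \<in> set es \<Longrightarrow> propagate es x r a = out l (propagate es x r) + r l"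
proof (induction es x r rule: propagate.induct)
  case (2 b m es x r)
  show ?case
  proof (cases "(a, l) \<in> set es")
    case True
    then show ?thesis using 2 by (simp del: fun_upd_apply)
  next
    case False
    then have al: "a = b" "l = m" using 2 by auto
    have "out m (propagate es (x(b := out m x + r m)) r) = out m x"
    proof (rule out_cong)
      fix k assume "k \<in> deps m"
      then have "k \<notin> fst ` set es" "k \<noteq> b" using 2(2) by auto
      then show "propagate es (x(b := out m x + r m)) r k = x k" by (simp add: propagate_outside)
    qed
    then show ?thesis using 2(2) al by (simp add: propagate_outside)
  qed
qed simp

text \<open>Applied to a labelling and its own residues, this shows that propagation reconstructs
  the labelling.\<close>

lemma propagate_unique:
  assumes "ordered es" "\<forall>(a, l)\<in>set es. y a = out l y + r l" "\<forall>m. m \<notin> fst ` set es \<longrightarrow> y m = x m"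
  shows "propagate es x r = y"
  using assms
proof (induction es x r rule: propagate.induct)
  case (2 a l es x r)
  have "out l y = out l x" using 2(2,4) by (intro out_cong) auto
  then have "\<forall>m. m \<notin> fst ` set es \<longrightarrow> y m = (x(a := out l x + r l)) m" using 2(3,4) by auto
  then show ?case using 2(1,2,3) by (simp del: fun_upd_apply)
qed auto

lemma propagate_linear:
  "propagate es (\<lambda>l. a * x l + b * y l) (\<lambda>l. a * r l + b * s l) =
     (\<lambda>l. a * propagate es x r l + b * propagate es y s l)"
proof (induction es arbitrary: x y)
  case (Cons e es)
  obtain m l where e: "e = (m, l)" by fastforce
  have "out l (\<lambda>l. a * x l + b * y l) = a * out l x + b * out l y"
    using linear_form_out by (simp add: linear_form_def)
  then have "(\<lambda>l. a * x l + b * y l)(m := out l (\<lambda>l. a * x l + b * y l) + (a * r l + b * s l)) =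
    (\<lambda>k. a * (x(m := out l x + r l)) k + b * (y(m := out l y + s l)) k)"
    by (auto simp: algebra_simps)
  then show ?case using Cons by (simp add: e del: fun_upd_apply)
qed simp

text \<open>Each letter of a strand is paired with its predecessor, in the form expected by
  \<open>propagate\<close>; first letters are never assigned. The strands are treated in the order
  of the list, so a strand passing over has to precede the strands whose labels it
  influences.\<close>

definition links :: "'a list list \<Rightarrow> ('a \<times> 'a) list" where
  "links ss = concat (map (\<lambda>ws. zip (tl ws) ws) ss)"

lemma fst_links: "fst ` set (links ss) = set (concat (map tl ss))"
proof -
  have "fst ` set (zip (tl ws) ws) = set (tl ws)" for ws :: "'a list"
    by (cases ws) (simp_all add: map_fst_zip_take flip: set_map)
  then show ?thesis by (auto simp: links_def image_UN)
qed

text \<open>Modulo \<open>X\<close> the map \<open>out\<close> does not change a label, so the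
  residues telescope along the strand.\<close>

lemma aug_along_strand:
  assumes "\<forall>(a, l)\<in>set (zip (tl ws) ws). x a = out l x + r l" "ws \<noteq> []"
  shows "aug (x (last ws)) + aug (r (last ws)) = aug (x (hd ws)) + sum_list (map (\<lambda>l. aug (r l)) ws)"
  using assms
proof (induction ws)
  case (Cons h ws)
  then show ?case by (cases ws) auto
qed simp

lemma sum_concat_distinct:
  assumes "distinct (concat ss)"
  shows "(\<Sum>l\<in>set (concat ss). f l) = (\<Sum>i<length ss. sum_list (map f (ss ! i)))"
  using assms
proof (induction ss)
  case (Cons w ss)
  then show ?case
    by (simp add: sum.union_disjoint sum_list_distinct_conv_sum_set lessThan_Suc_eq_insert_0
        sum.reindex)
qed simp

lemma constant_along_strand:
  assumes "\<forall>(a, l)\<in>set (zip (tl ws) ws). f a = f l" "l \<in> set ws"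
  shows "f l = f (hd ws)"
  using assms
proof (induction ws)
  case (Cons h ws)
  then show ?case by (cases ws) auto
qed simp

lemma set_strand: "ws \<noteq> [] \<Longrightarrow> set ws = insert (hd ws) (set (tl ws))"
  by (cases ws) auto

lemma links_member: "ws \<in> set ss \<Longrightarrow> set (zip (tl ws) ws) \<subseteq> set (links ss)"
  by (auto simp: links_def)

lemma link_into: "l \<in> set ws \<Longrightarrow> l \<noteq> last ws \<Longrightarrow> \<exists>a. (a, l) \<in> set (zip (tl ws) ws)"
proof (induction ws)
  case (Cons h ws)
  then show ?case by (cases ws) auto
qed simp

text \<open>
  The strands \<open>ss\<close> of a tangle are replaced by strands \<open>ss'\<close> with the same first letters.  Labels of the
  new arcs are propagated from the first letters; the residues of an old strand are propagated to its
  end and become the residue at the end of the new strand.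
\<close>

lemma chain_strands:
  assumes fin: "finite L" "finite L'"
    and len: "length ss = length ss'"
    and ne: "\<And>i. i < length ss \<Longrightarrow> ss ! i \<noteq> [] \<and> ss' ! i \<noteq> [] \<and> hd (ss ! i) = hd (ss' ! i)"
    and dist: "distinct (concat ss)" "distinct (concat ss')"
    and sub: "set (concat ss) \<subseteq> L" "set (concat ss') \<subseteq> L'"
    and base: "L - set (concat (map tl ss)) = L' - set (concat (map tl ss'))"
    and ord: "ordered (links ss)" "ordered (links ss')"
    and deps: "\<And>l. l \<in> L - set (concat (map tl ss)) \<Longrightarrow> deps l \<inter> set (concat (map tl ss')) = {}"
    and step: "\<And>a l. (a, l) \<in> set (links ss) \<Longrightarrow> \<sigma> l = a"
      "\<And>a l. (a, l) \<in> set (links ss') \<Longrightarrow> \<sigma>' l = a"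
    and last_step: "\<And>i. i < length ss \<Longrightarrow> \<sigma>' (last (ss' ! i)) = \<sigma> (last (ss ! i)) \<and>
        \<sigma> (last (ss ! i)) \<notin> set (concat (map tl ss'))"
    and rest: "\<And>l. l \<in> L - set (concat ss) \<Longrightarrow> \<sigma>' l = \<sigma> l \<and> \<sigma> l \<notin> set (concat (map tl ss'))"
    and \<kappa>: "\<And>l. l \<in> L - set (concat (map tl ss)) \<Longrightarrow> \<kappa>' l = \<kappa> l"
      "\<And>a l. (a, l) \<in> set (links ss) \<Longrightarrow> \<kappa> a = \<kappa> l"
      "\<And>a l. (a, l) \<in> set (links ss') \<Longrightarrow> \<kappa>' a = \<kappa>' l"
    and invariant: "\<And>i x. i < length ss \<Longrightarrow>
      out (last (ss ! i)) (propagate (links ss) x (\<lambda>_. 0)) =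
      out (last (ss' ! i)) (propagate (links ss') x (\<lambda>_. 0))"
  shows "chain L \<sigma> \<kappa> L' \<sigma>' \<kappa>'"
proof -
  let ?n = "length ss"
  let ?es = "links ss" and ?es' = "links ss'"
  have strand_links: "set (zip (tl (ss ! i)) (ss ! i)) \<subseteq> set ?es"
    "set (zip (tl (ss' ! i)) (ss' ! i)) \<subseteq> set ?es'" if "i < ?n" for i
    using that len by (intro links_member nth_mem; simp)+
  have mem: "l \<in> set (concat ss) \<longleftrightarrow> (\<exists>i<?n. l \<in> set (ss ! i))"
    "l \<in> set (concat ss') \<longleftrightarrow> (\<exists>i<?n. l \<in> set (ss' ! i))" for l
    using len by (auto simp: in_set_conv_nth; metis in_set_conv_nth nth_mem)+
  have strand_const: "f l = f (hd (ss ! i))" if "\<And>a l. (a, l) \<in> set ?es \<Longrightarrow> f a = f l" "i < ?n" "l \<in> set (ss ! i)"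
    for f :: "letter \<Rightarrow> 'b" and i l
  proof (rule constant_along_strand[OF _ that(3)], clarify)
    fix a m assume "(a, m) \<in> set (zip (tl (ss ! i)) (ss ! i))"
    then show "f a = f m" using that(1) strand_links(1)[OF that(2)] by (meson subsetD)
  qed
  have strand_const': "f l = f (hd (ss' ! i))" if "\<And>a l. (a, l) \<in> set ?es' \<Longrightarrow> f a = f l" "i < ?n" "l \<in> set (ss' ! i)"
    for f :: "letter \<Rightarrow> 'b" and i l
  proof (rule constant_along_strand[OF _ that(3)], clarify)
    fix a m assume "(a, m) \<in> set (zip (tl (ss' ! i)) (ss' ! i))"
    then show "f a = f m" using that(1) strand_links(2)[OF that(2)] by (meson subsetD)
  qed
  have split: "set (concat ss) = (\<lambda>i. hd (ss ! i)) ` {..<?n} \<union> set (concat (map tl ss))"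
    "set (concat ss') = (\<lambda>i. hd (ss ! i)) ` {..<?n} \<union> set (concat (map tl ss'))"
  proof -
    have "set (concat rs) = (\<lambda>i. hd (rs ! i)) ` {..<length rs} \<union> set (concat (map tl rs))"
      if "\<forall>i<length rs. rs ! i \<noteq> []" for rs :: "letter list list"
    proof -
      have "\<forall>w\<in>set rs. w \<noteq> []" using that by (metis in_set_conv_nth)
      then have "set (concat rs) = hd ` set rs \<union> set (concat (map tl rs))"
        by (auto simp: set_strand dest: list.set_sel(2))
      moreover have "hd ` set rs = (\<lambda>i. hd (rs ! i)) ` {..<length rs}"
        by (auto simp: set_conv_nth image_iff)
      ultimately show ?thesis by simp
    qed
    from this[of ss] this[of ss'] show "set (concat ss) = (\<lambda>i. hd (ss ! i)) ` {..<?n} \<union> set (concat (map tl ss))"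
    "set (concat ss') = (\<lambda>i. hd (ss ! i)) ` {..<?n} \<union> set (concat (map tl ss'))"
      using ne len by auto
  qed
  have heads: "hd (rs ! i) \<notin> set (concat (map tl rs))"
    if "distinct (concat rs)" "i < length rs" "rs ! i \<noteq> []" for rs :: "letter list list" and i
    using that
  proof (induction rs arbitrary: i)
    case (Cons w rs)
    have tl_subset: "set (tl v) \<subseteq> set v" for v :: "letter list" by (cases v) auto
    have tls: "set (concat (map tl rs)) \<subseteq> set (concat rs)" using tl_subset by fastforce
    have disj: "set w \<inter> set (concat rs) = {}" "distinct w" "distinct (concat rs)"
      using Cons.prems(1) by auto
    show ?case
    proof (cases i)
      case 0
      then obtain h v where "w = h # v" using Cons.prems(3) by (cases w) auto
      then show ?thesis using 0 disj tls by auto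
    next
      case (Suc j)
      then have j: "j < length rs" "rs ! j \<noteq> []" using Cons.prems by auto
      then have "hd (rs ! j) \<in> set (concat rs)"
        using nth_mem[OF j(1)] hd_in_set[OF j(2)] unfolding set_concat by blast
      then have "hd (rs ! j) \<notin> set (tl w)" using disj(1) tl_subset[of w] by blast
      then show ?thesis using Suc Cons.IH[OF disj(3) j] by simp
    qed
  qed simp
  have outside: "L - set (concat ss) = L' - set (concat ss')"
    using base unfolding split by blast
  \<comment> \<open>All residues of an old strand are collected at its end: the inner ones are
    propagated from zero labels, and their effect on the outgoing label is added to the residue at
    the last letter.\<close>
  define V where "V i r = r (last (ss ! i)) + out (last (ss ! i)) (propagate ?es (\<lambda>_. 0) r)" for i r
  define P where "P r l = (if l \<in> L - set (concat ss) then r l else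
      (\<Sum>i<?n. if l = last (ss' ! i) then V i r else 0))" for r l
  \<comment> \<open>Within the new strands the relations are satisfied exactly, so residues occur
    there only at the last letters, in accordance with \<open>P\<close>.\<close>
  define Q where "Q x = propagate ?es' x (\<lambda>_. 0)" for x
  have Q_outside: "Q x l = x l" if "l \<notin> set (concat (map tl ss'))" for x l
    unfolding Q_def by (rule propagate_outside) (use that fst_links in metis)
  have Q_step: "Q x a = out l (Q x)" if "(a, l) \<in> set ?es'" for x a l
    using propagate_eq[OF ord(2) that, of x "\<lambda>_. 0"] by (simp add: Q_def)
  have last_inj: "i = j" if "i < ?n" "j < ?n" "last (ss' ! i) = last (ss' ! j)" for i j
  proof -
    have "last (ss' ! i) \<in> set (ss' ! i)" "last (ss' ! i) \<in> set (ss' ! j)"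
      using that ne by (metis last_in_set)+
    then show ?thesis using word_index_eq[OF dist(2)] that len by metis
  qed
  have P_last: "P r (last (ss' ! i)) = V i r" if "i < ?n" for i r
  proof -
    have "last (ss' ! i) \<in> set (concat ss')" unfolding mem using that ne last_in_set by blast
    then have "last (ss' ! i) \<notin> L - set (concat ss)" using outside by blast
    moreover have "(\<Sum>j<?n. if last (ss' ! i) = last (ss' ! j) then V j r else 0) = (\<Sum>j<?n. if i = j then V j r else 0)"
      using last_inj that by (intro sum.cong) auto
    ultimately show ?thesis using that by (auto simp add: P_def simp del: set_concat)
  qed
  have linV: "linear_form (V i)" for i
    using linear_form_out[of "last (ss ! i)"] propagate_linear[of ?es _ "\<lambda>_. 0" _ "\<lambda>_. 0"]
    by (auto simp: linear_form_def V_def algebra_simps)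
  show ?thesis
  proof (rule chainI[of Q P])
    fix l
    show "linear_form (\<lambda>x. Q x l)"
      using propagate_linear[of ?es' _ _ _ _ "\<lambda>_. 0" "\<lambda>_. 0"] by (simp add: linear_form_def Q_def)
    have "(\<Sum>i<?n. if l = last (ss' ! i) then V i (\<lambda>l. a * x l + b * y l) else 0) =
        a * (\<Sum>i<?n. if l = last (ss' ! i) then V i x else 0) + b * (\<Sum>i<?n. if l = last (ss' ! i) then V i y else 0)"
      for a b x y
      using linV by (auto simp: sum_distrib_left linear_form_def simp flip: sum.distrib intro!: sum.cong)
    then show "linear_form (\<lambda>r. P r l)"
      by (cases "l \<in> L - set (concat ss)") (auto simp: linear_form_def P_def simp del: set_concat)
  next
    fix x l assume l: "l \<in> L'"
    let ?r = "residue L \<sigma> x"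
    have cases: "l \<in> L - set (concat ss) \<or> (\<exists>i<?n. l = last (ss' ! i)) \<or>
        ((\<exists>a. (a, l) \<in> set ?es') \<and> (\<forall>i<?n. l \<noteq> last (ss' ! i)))"
    proof (rule disjCI)
      assume not_last: "\<not> ((\<exists>i<?n. l = last (ss' ! i)) \<or> (\<exists>a. (a, l) \<in> set ?es') \<and> (\<forall>i<?n. l \<noteq> last (ss' ! i)))"
      show "l \<in> L - set (concat ss)"
      proof (rule ccontr)
        assume "l \<notin> L - set (concat ss)"
        then have "l \<in> set (concat ss')" using l unfolding outside by (simp del: set_concat)
        then obtain i where i: "i < ?n" "l \<in> set (ss' ! i)" unfolding mem by (elim exE conjE)
        then have "l \<noteq> last (ss' ! i)" using not_last by blast
        then obtain a where "(a, l) \<in> set (zip (tl (ss' ! i)) (ss' ! i))"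
          using link_into[OF i(2)] by blast
        then have "(a, l) \<in> set ?es'" by (rule subsetD[OF strand_links(2)[OF i(1)]])
        then show False using not_last by blast
      qed
    qed
    from cases show "residue L' \<sigma>' (Q x) l = P ?r l"
    proof (elim disjE exE conjE)
      assume outside: "l \<in> L - set (concat ss)"
      then have l0: "l \<in> L - set (concat (map tl ss))" using split(1) by blast
      have "out l (Q x) = out l x"
        using deps[OF l0] by (intro out_cong Q_outside) auto
      moreover have "Q x (\<sigma>' l) = x (\<sigma> l)" using rest[OF outside] by (simp add: Q_outside)
      ultimately show ?thesis using outside l by (simp add: residue_def P_def)
    next
      fix i assume last: "i < ?n" "l = last (ss' ! i)"
      have li: "last (ss ! i) \<in> L" using sub(1) mem(1) ne last last_in_set by blast
      have "\<forall>(a, m)\<in>set ?es. x a = out m x + ?r m"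
      proof clarify
        fix a m assume am: "(a, m) \<in> set ?es"
        then have "m \<in> L" using sub(1) by (auto simp: links_def dest!: set_zip_rightD)
        then show "x a = out m x + ?r m" using step(1)[OF am] by (simp add: residue_def)
      qed
      then have "propagate ?es x ?r = x" by (intro propagate_unique ord) auto
      \<comment> \<open>Linearity splits \<open>x\<close> into the part spread from the letters that
        are not assigned and the part caused by the residues. The second part enters
        \<open>V\<close>; the first is the same for both tangles by
        \<open>invariant\<close>.\<close>
      then have "x = (\<lambda>l. propagate ?es x (\<lambda>_. 0) l + propagate ?es (\<lambda>_. 0) ?r l)"
        using propagate_linear[of ?es 1 x 1 "\<lambda>_. 0" "\<lambda>_. 0" ?r] by simp
      then have "out (last (ss ! i)) x = out (last (ss ! i)) (propagate ?es x (\<lambda>_. 0)) +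
          out (last (ss ! i)) (propagate ?es (\<lambda>_. 0) ?r)"
        using linear_form_add[OF linear_form_out, of "last (ss ! i)" "propagate ?es x (\<lambda>_. 0)" "propagate ?es (\<lambda>_. 0) ?r"]
        by simp
      then have "V i ?r = x (\<sigma> (last (ss ! i))) - out (last (ss ! i)) (propagate ?es x (\<lambda>_. 0))"
        using li by (simp add: V_def residue_def)
      moreover have "Q x (\<sigma>' l) = x (\<sigma> (last (ss ! i)))"
        using last_step[OF last(1)] last by (simp add: Q_outside)
      ultimately show ?thesis
        using l last P_last[OF last(1)] invariant[OF last(1), of x] by (simp add: residue_def Q_def)
    next
      fix a assume inner: "(a, l) \<in> set ?es'" "\<forall>i<?n. l \<noteq> last (ss' ! i)"
      have "l \<in> set (concat ss')" using inner(1) by (auto simp: links_def dest!: set_zip_rightD)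
      then have "l \<notin> L - set (concat ss)" using outside by blast
      then have "P ?r l = 0" using inner(2) by (auto simp add: P_def simp del: set_concat)
      then show ?thesis using step(2)[OF inner(1)] Q_step[OF inner(1)] by (simp add: residue_def)
    qed
  next
    fix c :: "nat \<Rightarrow> real" and x l assume x: "\<forall>l\<in>L. aug (x l) = c (\<kappa> l)" and l: "l \<in> L'"
    have 0: "aug (Q x m) = c (\<kappa>' m)" if "m \<in> L'" "m \<notin> set (concat (map tl ss'))" for m
      using that base \<kappa>(1) x Q_outside by (metis DiffD1 DiffI)
    show "aug (Q x l) = c (\<kappa>' l)"
    proof (cases "l \<in> set (concat (map tl ss'))")
      case True
      then have "l \<in> set (concat ss')" unfolding split(2) by (rule UnI2)
      then obtain i where i: "i < ?n" "l \<in> set (ss' ! i)" unfolding mem(2) by (elim exE conjE)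
      have h: "hd (ss' ! i) \<notin> set (concat (map tl ss'))" "hd (ss' ! i) \<in> L'"
      proof -
        show "hd (ss' ! i) \<notin> set (concat (map tl ss'))"
          using heads[OF dist(2), of i] i len ne[OF i(1)] by simp
        have "hd (ss' ! i) \<in> set (concat ss')"
          using ne[OF i(1)] i hd_in_set[of "ss' ! i"] unfolding mem(2) by (intro exI[of _ i]) simp
        then show "hd (ss' ! i) \<in> L'" by (rule subsetD[OF sub(2)])
      qed
      have "aug (Q x l) - c (\<kappa>' l) = aug (Q x (hd (ss' ! i))) - c (\<kappa>' (hd (ss' ! i)))"
        by (rule strand_const'[OF _ i]) (simp add: Q_step \<kappa>(3))
      then show ?thesis using 0 h by simp
    qed (use 0 l in blast)
  next
    fix c :: "nat \<Rightarrow> real" and r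
    \<comment> \<open>The first letter of the strand has label 0 in this propagation, so modulo
      \<open>X\<close> only the sum of the residues remains.\<close>
    have V: "aug (V i r) = sum_list (map (\<lambda>l. aug (r l)) (ss ! i))" if i: "i < ?n" for i
    proof -
      have "\<forall>(a, l)\<in>set (zip (tl (ss ! i)) (ss ! i)).
          propagate ?es (\<lambda>_. 0) r a = out l (propagate ?es (\<lambda>_. 0) r) + r l"
      proof clarify
        fix a m assume "(a, m) \<in> set (zip (tl (ss ! i)) (ss ! i))"
        then have "(a, m) \<in> set ?es" by (rule subsetD[OF strand_links(1)[OF i]])
        then show "propagate ?es (\<lambda>_. 0) r a = out m (propagate ?es (\<lambda>_. 0) r) + r m"
          by (rule propagate_eq[OF ord(1)])
      qed
      moreover have "propagate ?es (\<lambda>_. 0) r (hd (ss ! i)) = 0"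
        using heads[OF dist(1) i] ne[OF i] by (subst propagate_outside) (auto simp: fst_links simp del: set_concat)
      ultimately show ?thesis
        using aug_along_strand[of "ss ! i" "propagate ?es (\<lambda>_. 0) r" r] ne[OF i] by (simp add: V_def)
    qed
    have \<kappa>_strand: "\<kappa> l = \<kappa> (hd (ss ! i))" if "i < ?n" "l \<in> set (ss ! i)" for i l
      by (rule strand_const[OF \<kappa>(2) that])
    have \<kappa>_strand': "\<kappa>' l = \<kappa>' (hd (ss' ! i))" if "i < ?n" "l \<in> set (ss' ! i)" for i l
      by (rule strand_const'[OF \<kappa>(3) that])
    have \<kappa>_last: "\<kappa>' (last (ss' ! i)) = \<kappa> (hd (ss ! i))" if i: "i < ?n" for i
    proof -
      have "hd (ss ! i) \<in> L - set (concat (map tl ss))"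
      proof
        have "hd (ss ! i) \<in> set (concat ss)"
          using ne[OF i] i hd_in_set[of "ss ! i"] unfolding mem(1) by (intro exI[of _ i]) simp
        then show "hd (ss ! i) \<in> L" by (rule subsetD[OF sub(1)])
        show "hd (ss ! i) \<notin> set (concat (map tl ss))" using heads[OF dist(1) i] ne[OF i] by simp
      qed
      then show ?thesis using \<kappa>_strand'[OF i, of "last (ss' ! i)"] ne[OF i] \<kappa>(1) by simp
    qed
    have "(\<Sum>l\<in>set (concat ss). c (\<kappa> l) * aug (r l)) = (\<Sum>i<?n. c (\<kappa> (hd (ss ! i))) * aug (V i r))"
      unfolding sum_concat_distinct[OF dist(1)]
    proof (intro sum.cong refl)
      fix i assume "i \<in> {..<?n}"
      then show "sum_list (map (\<lambda>l. c (\<kappa> l) * aug (r l)) (ss ! i)) = c (\<kappa> (hd (ss ! i))) * aug (V i r)"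
        using \<kappa>_strand[of i] V[of i] by (simp add: sum_list_const_mult[symmetric] cong: map_cong)
    qed
    moreover have "(\<Sum>l\<in>set (concat ss'). c (\<kappa>' l) * aug (P r l)) = (\<Sum>i<?n. c (\<kappa> (hd (ss ! i))) * aug (V i r))"
    proof -
      have "(\<Sum>l\<in>set (concat ss'). c (\<kappa>' l) * aug (P r l)) =
          (\<Sum>l\<in>(\<lambda>i. last (ss' ! i)) ` {..<?n}. c (\<kappa>' l) * aug (P r l))"
      proof (rule sum.mono_neutral_right)
        show "(\<lambda>i. last (ss' ! i)) ` {..<?n} \<subseteq> set (concat ss')"
        proof (rule image_subsetI)
          fix i assume "i \<in> {..<?n}"
          then show "last (ss' ! i) \<in> set (concat ss')"
            using ne[of i] unfolding mem(2) by (intro exI[of _ i]) simp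
        qed
        show "\<forall>l\<in>set (concat ss') - (\<lambda>i. last (ss' ! i)) ` {..<?n}. c (\<kappa>' l) * aug (P r l) = 0"
        proof
          fix l assume l: "l \<in> set (concat ss') - (\<lambda>i. last (ss' ! i)) ` {..<?n}"
          then have "l \<notin> L - set (concat ss)" unfolding outside by simp
          moreover have "\<forall>i<?n. l \<noteq> last (ss' ! i)" using l by (auto simp del: set_concat)
          ultimately have "P r l = 0" by (auto simp add: P_def simp del: set_concat)
          then show "c (\<kappa>' l) * aug (P r l) = 0" by simp
        qed
      qed simp
      also have "\<dots> = (\<Sum>i<?n. c (\<kappa>' (last (ss' ! i))) * aug (P r (last (ss' ! i))))"
        using last_inj by (subst sum.reindex) (auto intro: inj_onI)
      also have "\<dots> = (\<Sum>i<?n. c (\<kappa> (hd (ss ! i))) * aug (V i r))"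
        by (intro sum.cong) (simp_all add: \<kappa>_last P_last)
      finally show ?thesis .
    qed
    moreover have "(\<Sum>l\<in>L' - set (concat ss'). c (\<kappa>' l) * aug (P r l)) = (\<Sum>l\<in>L - set (concat ss). c (\<kappa> l) * aug (r l))"
      unfolding outside[symmetric] 
    proof (intro sum.cong refl)
      fix l assume l: "l \<in> L - set (concat ss)"
      then have "l \<in> L - set (concat (map tl ss))" unfolding split(1) by (simp del: set_concat)
      then show "c (\<kappa>' l) * aug (P r l) = c (\<kappa> l) * aug (r l)" using l \<kappa>(1) by (simp add: P_def del: set_concat)
    qed
    ultimately show "(\<Sum>l\<in>L'. c (\<kappa>' l) * aug (P r l)) = (\<Sum>l\<in>L. c (\<kappa> l) * aug (r l))"
      using sum.subset_diff[OF sub(1) fin(1), of "\<lambda>l. c (\<kappa> l) * aug (r l)"]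
        sum.subset_diff[OF sub(2) fin(2), of "\<lambda>l. c (\<kappa>' l) * aug (P r l)"] by simp
  qed
qed

section \<open>Exchanging strands\<close>

text \<open>Chain maps in both directions, since moves are applied both ways; no relation between
  the two maps is asked for.\<close>

definition homotopic :: "letter list list \<Rightarrow> letter list list \<Rightarrow> bool" where
  "homotopic W W' \<longleftrightarrow>
     chain (set (concat W)) (succ W) (word_index W) (set (concat W')) (succ W') (word_index W') \<and>
     chain (set (concat W')) (succ W') (word_index W') (set (concat W)) (succ W) (word_index W)"

lemma homotopic_refl: "homotopic W W"
  by (simp add: homotopic_def chain_refl)

lemma homotopic_sym: "homotopic W W' \<Longrightarrow> homotopic W' W"
  by (simp add: homotopic_def)

lemma homotopic_trans: "homotopic W W' \<Longrightarrow> homotopic W' W'' \<Longrightarrow> homotopic W W''"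
  unfolding homotopic_def by (blast intro: chain_trans)

lemma in_set_concatI: "ws \<in> set ss \<Longrightarrow> l \<in> set ws \<Longrightarrow> l \<in> set (concat ss)"
  by auto

lemma zip_tl_distinct:
  "distinct ws \<Longrightarrow> (a, l) \<in> set (zip (tl ws) ws) \<Longrightarrow> l \<noteq> last ws"
proof (induction ws)
  case (Cons h ws)
  then show ?case by (cases ws) (auto dest: set_zip_rightD)
qed simp

context
  fixes W :: "letter list list" and ss :: "letter list list"
  assumes dist: "distinct (concat W)"
    and ss: "distinct (concat ss)" "set (concat ss) \<subseteq> set (concat W)"
    and step: "\<And>a l. (a, l) \<in> set (links ss) \<Longrightarrow> succ W l = a"
begin

abbreviation (input) "tails \<equiv> set (concat (map tl ss))"

lemma in_tails:
  assumes "a \<in> tails"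
  shows "\<exists>ws l. ws \<in> set ss \<and> (a, l) \<in> set (zip (tl ws) ws) \<and> (a, l) \<in> set (links ss)"
proof -
  have "a \<in> fst ` set (links ss)" using assms by (simp only: fst_links)
  then obtain l where l: "(a, l) \<in> set (links ss)" unfolding image_iff by (metis prod.collapse)
  then have "\<exists>ws\<in>set ss. (a, l) \<in> set (zip (tl ws) ws)" by (simp add: links_def)
  then show ?thesis using l by blast
qed

text \<open>Every letter of a tail is already the successor of its predecessor on the strand, and
  \<open>succ W\<close> is injective; so no other letter leads into a tail.\<close>

lemma succ_not_in_tails:
  assumes "l \<in> set (concat W)" "\<And>ws. ws \<in> set ss \<Longrightarrow> l \<in> set ws \<Longrightarrow> l = last ws"
  shows "succ W l \<notin> tails"
proof
  assume "succ W l \<in> tails"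
  then obtain ws m where m: "ws \<in> set ss" "(succ W l, m) \<in> set (zip (tl ws) ws)" "(succ W l, m) \<in> set (links ss)"
    using in_tails by blast
  then have "m \<in> set ws" by (auto dest: set_zip_rightD)
  then have "m \<in> set (concat W)" using ss(2) m(1) by auto
  moreover have "succ W m = succ W l" using step m(3) by blast
  ultimately have "m = l" using inj_on_succ[OF dist] assms(1) by (auto dest: inj_onD)
  moreover have "m \<noteq> last ws"
    by (rule zip_tl_distinct[OF distinct_word[OF ss(1) m(1)] m(2)])
  ultimately show False using assms(2) m(1) \<open>m \<in> set ws\<close> by blast
qed

lemma last_not_in_tails:
  assumes "ws \<in> set ss" "ws \<noteq> []"
  shows "succ W (last ws) \<notin> tails"
proof (rule succ_not_in_tails)
  show "last ws \<in> set (concat W)"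
    using in_set_concatI[OF assms(1) last_in_set[OF assms(2)]] ss(2) by (rule subsetD[rotated])
  fix vs assume "vs \<in> set ss" "last ws \<in> set vs"
  then show "last ws = last vs" using word_eqI[OF ss(1)] assms last_in_set by blast
qed

text \<open>From the head of a strand the successor runs through the tail and leaves it behind the
  last letter. So after deletion of the tails the head takes over the exit of the last
  letter.\<close>

lemma first_outside_last:
  assumes "ws \<in> set ss" "ws \<noteq> []"
  shows "first_outside W tails (hd ws) = succ W (last ws)"
proof -
  have "first_outside W tails (hd vs) = succ W (last vs)"
    if "vs \<noteq> []" "set vs \<subseteq> set (concat W)" "set (tl vs) \<subseteq> tails"
      "\<forall>(a, l)\<in>set (zip (tl vs) vs). succ W l = a" "succ W (last vs) \<notin> tails" for vs
    using that
  proof (induction vs)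
    case (Cons h vs)
    show ?case
    proof (cases vs)
      case Nil
      then show ?thesis using Cons.prems by (simp add: first_outside_stop[OF dist] del: set_concat)
    next
      case (Cons a v)
      have "h \<in> set (concat W)" using Cons.prems(2) by (auto simp del: set_concat)
      moreover have "succ W h = a" "a \<in> tails" using Cons.prems Cons by (auto simp del: set_concat)
      ultimately have "first_outside W tails h = first_outside W tails a"
        using first_outside_step[OF dist] by metis
      then show ?thesis using Cons.IH Cons.prems Cons by (auto simp del: set_concat)
    qed
  qed simp
  moreover have "set (tl ws) \<subseteq> tails" using assms(1) by auto
  moreover have "\<forall>(a, l)\<in>set (zip (tl ws) ws). succ W l = a"
    using step links_member[OF assms(1)] by blast
  moreover have "set ws \<subseteq> set (concat W)" using assms(1) ss(2) by auto
  ultimately show ?thesis using assms last_not_in_tails by blast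
qed

lemma hd_not_in_tails:
  assumes "ws \<in> set ss" "ws \<noteq> []"
  shows "hd ws \<notin> tails"
proof
  assume "hd ws \<in> tails"
  then obtain vs where vs: "vs \<in> set ss" "hd ws \<in> set (tl vs)" by auto
  then have "hd ws \<in> set vs" by (metis list.sel(2) list.set_sel(2))
  then have "vs = ws" using word_eqI[OF ss(1) vs(1) assms(1)] assms(2) by simp
  moreover have "distinct ws" using distinct_word[OF ss(1) assms(1)] .
  ultimately show False using vs(2) by (cases ws) auto
qed

end

text \<open>Condition \<open>base\<close> says that the two tangles sit in the same exterior; from
  it follow the agreement of exits and of components required by \<open>chain_strands\<close>. The
  hypotheses are symmetric, so one chain map, constructed for arbitrary data, provides both
  directions.\<close>

theorem homotopic_strands:
  assumes W: "distinct (concat W)" "distinct (concat W')"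
    and len: "length ss = length ss'"
    and ne: "\<And>i. i < length ss \<Longrightarrow> ss ! i \<noteq> [] \<and> ss' ! i \<noteq> [] \<and> hd (ss ! i) = hd (ss' ! i)"
    and dist: "distinct (concat ss)" "distinct (concat ss')"
    and sub: "set (concat ss) \<subseteq> set (concat W)" "set (concat ss') \<subseteq> set (concat W')"
    and base: "map (filter (\<lambda>a. a \<notin> set (concat (map tl ss)))) W =
       map (filter (\<lambda>a. a \<notin> set (concat (map tl ss')))) W'"
    and ord: "ordered (links ss)" "ordered (links ss')"
    and closed: "\<And>l. l \<notin> set (concat (map tl ss)) \<Longrightarrow> deps l \<inter> set (concat (map tl ss)) = {}"
      "\<And>l. l \<notin> set (concat (map tl ss')) \<Longrightarrow> deps l \<inter> set (concat (map tl ss')) = {}"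
    and step: "\<And>a l. (a, l) \<in> set (links ss) \<Longrightarrow> succ W l = a"
      "\<And>a l. (a, l) \<in> set (links ss') \<Longrightarrow> succ W' l = a"
    and invariant: "\<And>i x. i < length ss \<Longrightarrow>
      out (last (ss ! i)) (propagate (links ss) x (\<lambda>_. 0)) =
      out (last (ss' ! i)) (propagate (links ss') x (\<lambda>_. 0))"
  shows "homotopic W W'"
proof -
  have one: "chain (set (concat W)) (succ W) (word_index W) (set (concat W')) (succ W') (word_index W')"
    if W: "distinct (concat W)" "distinct (concat W')"
      and len: "length ss = length ss'"
      and ne: "\<And>i. i < length ss \<Longrightarrow> ss ! i \<noteq> [] \<and> ss' ! i \<noteq> [] \<and> hd (ss ! i) = hd (ss' ! i)"
      and dist: "distinct (concat ss)" "distinct (concat ss')"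
      and sub: "set (concat ss) \<subseteq> set (concat W)" "set (concat ss') \<subseteq> set (concat W')"
      and base: "map (filter (\<lambda>a. a \<notin> set (concat (map tl ss)))) W =
         map (filter (\<lambda>a. a \<notin> set (concat (map tl ss')))) W'"
      and ord: "ordered (links ss)" "ordered (links ss')"
      and closed: "\<And>l. l \<notin> set (concat (map tl ss')) \<Longrightarrow> deps l \<inter> set (concat (map tl ss')) = {}"
      and step: "\<And>a l. (a, l) \<in> set (links ss) \<Longrightarrow> succ W l = a"
        "\<And>a l. (a, l) \<in> set (links ss') \<Longrightarrow> succ W' l = a"
      and invariant: "\<And>i x. i < length ss \<Longrightarrow>
        out (last (ss ! i)) (propagate (links ss) x (\<lambda>_. 0)) =
        out (last (ss' ! i)) (propagate (links ss') x (\<lambda>_. 0))"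
    for W W' ss ss'
  proof -
    let ?B = "set (concat (map tl ss))" and ?B' = "set (concat (map tl ss'))"
    \<comment> \<open>The common exterior: the successors and components of the two sides are
      compared through it.\<close>
    let ?W0 = "map (filter (\<lambda>a. a \<notin> ?B)) W"
    have L0: "set (concat W) - ?B = set (concat W') - ?B'"
    proof -
      have "set (concat ?W0) = set (concat (map (filter (\<lambda>a. a \<notin> ?B')) W'))" using base by simp
      then show ?thesis
        unfolding set_concat_filter[OF W(1)] set_concat_filter[OF W(2)] by (simp only: set_diff_eq)
    qed
    have both: "succ ?W0 l = first_outside W ?B l" "succ ?W0 l = first_outside W' ?B' l"
      "word_index W' l = word_index W l" if "l \<in> set (concat W) - ?B" for l
    proof -
      have l: "l \<in> set (concat W)" "l \<notin> ?B" "l \<in> set (concat W')" "l \<notin> ?B'" using that L0 by blast+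
      show "succ ?W0 l = first_outside W ?B l" by (rule succ_filter[OF W(1) l(1,2)])
      show "succ ?W0 l = first_outside W' ?B' l" unfolding base by (rule succ_filter[OF W(2) l(3,4)])
      show "word_index W' l = word_index W l"
        using word_index_filter[OF W(1) l(1), of "\<lambda>a. a \<notin> ?B"] word_index_filter[OF W(2) l(3), of "\<lambda>a. a \<notin> ?B'"] l base
        by simp
    qed
    have succ_W0: "succ ?W0 l \<notin> ?B'" if "l \<in> set (concat W) - ?B" for l
    proof -
      have "l \<in> set (concat ?W0)" using that unfolding set_concat_filter[OF W(1)] by blast
      then have "succ ?W0 l \<in> set (concat ?W0)" by (rule succ_in[OF distinct_concat_filter[OF W(1)]])
      then show ?thesis using L0 unfolding set_concat_filter[OF W(1)] by blast
    qed
    have in_ss: "ss ! i \<in> set ss" "ss' ! i \<in> set ss'" if "i < length ss" for i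
      using that len by simp_all
    have hd_L0: "hd (ss ! i) \<in> set (concat W) - ?B" if i: "i < length ss" for i
    proof
      have "hd (ss ! i) \<in> set (concat ss)"
        using in_set_concatI[OF in_ss(1)[OF i] hd_in_set] ne[OF i] by simp
      then show "hd (ss ! i) \<in> set (concat W)" using sub(1) by blast
      show "hd (ss ! i) \<notin> ?B"
        using hd_not_in_tails[OF W(1) dist(1) sub(1) step(1)] in_ss[OF i] ne[OF i] by blast
    qed
    show ?thesis
    proof (rule chain_strands[OF _ _ len ne dist sub L0 ord _ step])
      show "deps l \<inter> ?B' = {}" if "l \<in> set (concat W) - ?B" for l
        using closed that L0 by blast
      show "succ W' (last (ss' ! i)) = succ W (last (ss ! i)) \<and> succ W (last (ss ! i)) \<notin> ?B'"
        if i: "i < length ss" for i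
      proof -
        have "succ W (last (ss ! i)) = succ ?W0 (hd (ss ! i))"
          using first_outside_last[OF W(1) dist(1) sub(1) step(1) in_ss(1)[OF i]] ne[OF i] both(1)[OF hd_L0[OF i]] by simp
        moreover have "succ W' (last (ss' ! i)) = succ ?W0 (hd (ss ! i))"
          using first_outside_last[OF W(2) dist(2) sub(2) step(2) in_ss(2)[OF i]] ne[OF i] both(2)[OF hd_L0[OF i]] by simp
        ultimately show ?thesis using succ_W0[OF hd_L0[OF i]] by simp
      qed
      show "succ W' l = succ W l \<and> succ W l \<notin> ?B'" if l: "l \<in> set (concat W) - set (concat ss)" for l
      proof -
        have tl_sub: "set (tl v) \<subseteq> set v" for v :: "letter list" by (cases v) auto
        have "?B \<subseteq> set (concat ss)" using tl_sub by fastforce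
        then have l0: "l \<in> set (concat W) - ?B" using l by blast
        have l': "l \<notin> set (concat ss')"
        proof
          assume "l \<in> set (concat ss')"
          then obtain v where v: "v \<in> set ss'" "l \<in> set v" by auto
          have "l \<notin> set (tl v)" using l0 L0 v(1) by auto
          then have hd: "l = hd v" using v(2) by (cases v) auto
          obtain i where i: "i < length ss'" "v = ss' ! i" using v(1) by (metis in_set_conv_nth)
          then have "l = hd (ss ! i)" using ne[of i] len hd by simp
          then have "l \<in> set (concat ss)"
            using in_set_concatI[OF in_ss(1)[of i] hd_in_set] ne[of i] i len by simp
          then show False using l by blast
        qed
        have lW': "l \<in> set (concat W')" using l0 L0 by blast
        have "succ W l \<notin> ?B" using l by (intro succ_not_in_tails[OF W(1) dist(1) sub(1) step(1)]) auto
        then have 1: "succ ?W0 l = succ W l"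
          using both(1)[OF l0] first_outside_stop[OF W(1)] l0 by (simp del: set_concat)
        have "succ W' l \<notin> ?B'" using l' lW' by (intro succ_not_in_tails[OF W(2) dist(2) sub(2) step(2)]) auto
        then have "succ ?W0 l = succ W' l"
          using both(2)[OF l0] first_outside_stop[OF W(2)] lW' by (simp del: set_concat)
        then show ?thesis using 1 succ_W0[OF l0] by simp
      qed
      show "word_index W a = word_index W l" if "(a, l) \<in> set (links ss)" for a l
      proof -
        have "l \<in> set (concat W)" using that sub(1) by (auto simp: links_def dest!: set_zip_rightD)
        then show ?thesis using step(1)[OF that] word_index_succ[OF W(1)] by blast
      qed
      show "word_index W' a = word_index W' l" if "(a, l) \<in> set (links ss')" for a l
      proof -
        have "l \<in> set (concat W')" using that sub(2) by (auto simp: links_def dest!: set_zip_rightD)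
        then show ?thesis using step(2)[OF that] word_index_succ[OF W(2)] by blast
      qed
    qed (use both(3) invariant in simp_all)
  qed
  have "\<And>i. i < length ss' \<Longrightarrow> ss' ! i \<noteq> [] \<and> ss ! i \<noteq> [] \<and> hd (ss' ! i) = hd (ss ! i)"
    using ne len by metis
  then show ?thesis unfolding homotopic_def
    using one[OF W len ne dist sub base ord closed(2) step invariant]
      one[OF W(2,1) len[symmetric] _ dist(2,1) sub(2,1) base[symmetric] ord(2,1) closed(1) step(2,1)]
      invariant len by simp
qed

section \<open>Elementary moves\<close>

lemma singleton_word:
  assumes "distinct (concat W)" "w \<in> set W" "l \<in> set w" "succ W l = l"
  shows "w = [l]"
proof -
  obtain k where k: "k < length w" "w ! k = l" using assms(3) by (auto simp: in_set_conv_nth)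
  then have "rotate k w = l # tl (rotate k w)"
    by (metis hd_rotate_conv_nth length_greater_0_conv gr_implies_not0 list.collapse neq0_conv rotate_is_Nil_conv mod_less)
  then obtain v where v: "rotate k w = l # v" by blast
  have "distinct (l # v)" using distinct_word[OF assms(1,2)] v by (metis distinct_rotate)
  moreover have "hd (v @ [l]) = l" using succ_eq[OF assms(1,2) v] assms(4) by simp
  ultimately have "v = []" by (cases v) auto
  then have "length w = 1" using v by (metis length_rotate length_Cons list.size(3) One_nat_def)
  then show ?thesis using assms(3) by (cases w) auto
qed

text \<open>The bead and its predecessor form a strand, which is replaced by the predecessor alone.
  A bead that is its own successor is the only letter of its component and has to stay, because it
  carries the label of that component.\<close>

lemma homotopic_delete_bead:
  assumes "distinct (concat W)" "succ W (Inr b) \<noteq> Inr b"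
  shows "homotopic W (map (filter (\<lambda>a. a \<noteq> Inr b)) W)"
proof (cases "Inr b \<in> set (concat W)")
  case False
  then have "map (filter (\<lambda>a. a \<noteq> Inr b)) W = W"
    by (intro map_idI filter_True) auto
  then show ?thesis by (simp add: homotopic_refl)
next
  case True
  then obtain l where l: "l \<in> set (concat W)" "succ W l = Inr b"
    using bij_succ[OF assms(1)] unfolding bij_betw_def by (metis imageE)
  then have "l \<noteq> Inr b" using assms(2) by auto
  let ?W' = "map (filter (\<lambda>a. a \<noteq> Inr b)) W"
  show ?thesis
  proof (rule homotopic_strands[where ss = "[[l, Inr b]]" and ss' = "[[l]]"])
    show "distinct (concat ?W')" by (rule distinct_concat_filter[OF assms(1)])
    have "l \<in> set (concat ?W')" using l(1) \<open>l \<noteq> Inr b\<close> by auto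
    then show "set (concat [[l]]) \<subseteq> set (concat ?W')" by simp
    show "set (concat [[l, Inr b]]) \<subseteq> set (concat W)" using l(1) True by simp
    show "ordered (links [[l, Inr b]])" using \<open>l \<noteq> Inr b\<close>
      by (cases l) (auto simp: links_def deps_def)
    show "deps m \<inter> set (concat (map tl [[l, Inr b]])) = {}"
      if "m \<notin> set (concat (map tl [[l, Inr b]]))" for m
      using that by (cases m) (auto simp: deps_def)
  qed (use assms l \<open>l \<noteq> Inr b\<close> in \<open>auto simp: links_def\<close>)
qed

lemma homotopic_delete_beads:
  assumes "finite B" "distinct (concat W)"
    and "\<And>w. w \<in> set W \<Longrightarrow> w \<noteq> [] \<Longrightarrow> \<exists>l\<in>set w. l \<notin> Inr ` B"
  shows "homotopic W (map (filter (\<lambda>a. a \<notin> Inr ` B)) W)"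
  using assms(1,3)
proof (induction B rule: finite_induct)
  case empty
  then show ?case by (simp add: homotopic_refl)
next
  case (insert b B)
  let ?W = "map (filter (\<lambda>a. a \<notin> Inr ` B)) W"
  have dist: "distinct (concat ?W)" by (rule distinct_concat_filter[OF assms(2)])
  have eq: "map (filter (\<lambda>a. a \<notin> Inr ` insert b B)) W = map (filter (\<lambda>a. a \<noteq> Inr b)) ?W"
    by (auto intro!: filter_cong)
  have "homotopic W ?W" using insert.IH insert.prems by blast
  moreover have "homotopic ?W (map (filter (\<lambda>a. a \<noteq> Inr b)) ?W)"
  proof (cases "Inr b \<in> set (concat ?W)")
    case False
    then have "map (filter (\<lambda>a. a \<noteq> Inr b)) ?W = ?W"
      by (intro map_idI filter_True) auto
    then show ?thesis by (simp only: homotopic_refl)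
  next
    case True
    show ?thesis
    proof (rule homotopic_delete_bead[OF dist], rule notI)
      assume fixed: "succ ?W (Inr b) = Inr b"
      obtain w where w: "w \<in> set W" "Inr b \<in> set (filter (\<lambda>a. a \<notin> Inr ` B) w)" using True by auto
      then have "filter (\<lambda>a. a \<notin> Inr ` B) w = [Inr b]"
        using singleton_word[OF dist _ w(2) fixed] by auto
      moreover obtain l where "l \<in> set w" "l \<notin> Inr ` insert b B" using insert.prems w by fastforce
      then have "l \<in> set (filter (\<lambda>a. a \<notin> Inr ` B) w)" "l \<noteq> Inr b" by auto
      ultimately show False by simp
    qed
  qed
  ultimately show ?case unfolding eq by (rule homotopic_trans)
qed

lemma partner_eq_iff [simp]: "partner p = partner q \<longleftrightarrow> p = q"
  by (metis partner_partner)

lemma deps_disjoint: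
  assumes "\<And>p. Inl p \<in> B \<Longrightarrow> Inl (partner p) \<in> B" "l \<notin> B"
  shows "deps l \<inter> B = {}"
proof (cases l)
  case (Inl p)
  have "Inl (partner p) \<notin> B" using assms(1)[of "partner p"] assms(2) Inl by auto
  then show ?thesis using assms(2) Inl by (simp add: deps_def)
qed (use assms(2) in \<open>simp add: deps_def\<close>)

text \<open>The case of \<open>homotopic_strands\<close> in which every strand shrinks to its first
  letter: it suffices that labels leave the tangle as they entered it.\<close>

lemma homotopic_erase_strands:
  assumes W: "distinct (concat W)"
    and ss: "\<And>ws. ws \<in> set ss \<Longrightarrow> ws \<noteq> []" "distinct (concat ss)" "set (concat ss) \<subseteq> set (concat W)"
      "ordered (links ss)"
    and closed: "\<And>p. Inl p \<in> set (concat (map tl ss)) \<Longrightarrow> Inl (partner p) \<in> set (concat (map tl ss))"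
      "\<And>b. Inr b \<notin> set (concat (map tl ss))"
    and step: "\<And>a l. (a, l) \<in> set (links ss) \<Longrightarrow> succ W l = a"
    and invariant: "\<And>ws x. ws \<in> set ss \<Longrightarrow>
      out (last ws) (propagate (links ss) x (\<lambda>_. 0)) = out (hd ws) x"
  shows "homotopic W (map (filter (\<lambda>a. a \<notin> set (concat (map tl ss)))) W)"
proof -
  let ?B = "set (concat (map tl ss))" and ?ss' = "map (\<lambda>ws. [hd ws]) ss"
  have tls: "map tl ?ss' = replicate (length ss) []" "links ?ss' = []"
    by (auto simp: links_def map_replicate_const o_def concat_eq_Nil_conv)
  have heads: "concat ?ss' = map hd ss" by (induction ss) auto
  have dist': "distinct (map hd ss)" using ss(1,2)
  proof (induction ss)
    case (Cons w ss)
    have "hd w \<in> set w" using Cons.prems(1)[of w] by simp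
    moreover have "hd ` set ss \<subseteq> set (concat ss)" using Cons.prems(1) by force
    moreover have "set w \<inter> set (concat ss) = {}" "distinct (concat ss)" using Cons.prems(2) by auto
    ultimately have "hd w \<notin> hd ` set ss" by blast
    then show ?case using Cons \<open>distinct (concat ss)\<close> by simp
  qed simp
  have hd_in: "hd ws \<in> set (concat W) \<and> hd ws \<notin> ?B" if "ws \<in> set ss" for ws
  proof
    have "hd ws \<in> set (concat ss)" using in_set_concatI[OF that hd_in_set] ss(1)[OF that] by simp
    then show "hd ws \<in> set (concat W)" using ss(3) by blast
    show "hd ws \<notin> ?B" using hd_not_in_tails[OF W ss(2,3) step that] ss(1)[OF that] by blast
  qed
  show ?thesis
  proof (rule homotopic_strands[where ss = ss and ss' = ?ss'])
    show "distinct (concat (map (filter (\<lambda>a. a \<notin> ?B)) W))" by (rule distinct_concat_filter[OF W])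
    show "set (concat ?ss') \<subseteq> set (concat (map (filter (\<lambda>a. a \<notin> ?B)) W))"
      unfolding heads set_concat_filter[OF W] using hd_in by (auto simp del: set_concat)
    show "distinct (concat ?ss')" unfolding heads by (rule dist')
    show "deps l \<inter> ?B = {}" if "l \<notin> ?B" for l
      using closed(1) that by (rule deps_disjoint)
    show "map (filter (\<lambda>a. a \<notin> ?B)) W =
      map (filter (\<lambda>a. a \<notin> set (concat (map tl ?ss')))) (map (filter (\<lambda>a. a \<notin> ?B)) W)"
      unfolding tls by simp
    fix i x assume "i < length ss"
    then show "out (last (ss ! i)) (propagate (links ss) x (\<lambda>_. 0)) =
        out (last (?ss' ! i)) (propagate (links ?ss') x (\<lambda>_. 0))"
      using invariant[of "ss ! i" x] by (simp add: tls)
  qed (use W ss step in \<open>simp_all add: tls\<close>)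
qed

text \<open>With \<open>o\<close> and \<open>u\<close> the units of the crossing, a label
  \<open>a\<close> arrives at the undercrossing as \<open>o a\<close> and leaves it as
  \<open>u o a + (1 - o u) a = a\<close>.\<close>

lemma homotopic_R1_over:
  assumes W: "distinct (concat W)" "Inr b \<in> set (concat W)"
    and step: "succ W (Inr b) = Inl p" "succ W (Inl p) = Inl (partner p)" and p: "level p = Over"
  shows "homotopic W (map (filter (\<lambda>a. a \<notin> {Inl p, Inl (partner p)})) W)"
proof -
  have p': "level (partner p) = Under" "sign (partner p) = sign p" using p by auto
  have mem: "Inl p \<in> set (concat W)" "Inl (partner p) \<in> set (concat W)"
    using succ_in[OF W] succ_in[OF W(1), of "Inl p"] step by metis+
  have "homotopic W (map (filter (\<lambda>a. a \<notin> set (concat (map tl [[Inr b, Inl p, Inl (partner p)]])))) W)"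
    using W mem step p p'
    by (intro homotopic_erase_strands)
      (auto simp: links_def deps_def algebra_simps simp del: set_concat distinct_concat)
  then show ?thesis by simp
qed

text \<open>The crossings have opposite signs, so their units are mutually inverse. The label of the
  over strand is multiplied by a unit and its inverse, and the two multiples of it that are added to
  the label of the under strand cancel, whichever crossing is met first.\<close>

lemma homotopic_R2:
  assumes W: "distinct (concat W)" "Inr b \<in> set (concat W)" "Inr b' \<in> set (concat W)" "b \<noteq> b'"
    and step: "succ W (Inr b) = Inl p" "succ W (Inl p) = Inl q"
      "succ W (Inr b') = Inl p'" "succ W (Inl p') = Inl q'"
    and p: "level p = Over" "level q = Over" "sign q \<longleftrightarrow> \<not> sign p" "p \<noteq> q"
    and p': "(p', q') = (partner p, partner q) \<or> (p', q') = (partner q, partner p)"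
  shows "homotopic W (map (filter (\<lambda>a. a \<notin> {Inl p, Inl q, Inl p', Inl q'})) W)"
proof -
  have sl: "level (partner p) = Under" "level (partner q) = Under"
    "sign (partner p) = sign p" "sign (partner q) = sign q" using p by auto
  have mem: "Inl p \<in> set (concat W)" "Inl q \<in> set (concat W)" "Inl p' \<in> set (concat W)" "Inl q' \<in> set (concat W)"
    using succ_in[OF W(1)] W(2,3) step by metis+
  have neq: "p \<noteq> partner q" "q \<noteq> partner p" using p sl by auto
  define o1 where "o1 = over_unit (sign p)"
  define o2 where "o2 = over_unit (\<not> sign p)"
  define u1 where "u1 = under_unit (sign p)"
  define u2 where "u2 = under_unit (\<not> sign p)"
  have units: "o1 * o2 = 1" "u1 * u2 = 1" by (simp_all add: o1_def o2_def u1_def u2_def unit_inverse)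
  \<comment> \<open>The additional rules, with a trailing factor \<open>f\<close>, let
    simplification cancel inverse units inside longer products.\<close>
  note units' = units arg_cong[OF units(1), of "\<lambda>z. z * f" for f, simplified mult.assoc mult_1]
    arg_cong[OF units(2), of "\<lambda>z. z * f" for f, simplified mult.assoc mult_1]
  note unfolded = o1_def[symmetric] o2_def[symmetric] u1_def[symmetric] u2_def[symmetric]
  show ?thesis using p'
  proof
    assume p': "(p', q') = (partner p, partner q)"
    let ?ss = "[[Inr b, Inl p, Inl q], [Inr b', Inl p', Inl q']]"
    have inv: "out (Inl q) (propagate (links ?ss) x (\<lambda>_. 0)) = x (Inr b)"
      "out (Inl q') (propagate (links ?ss) x (\<lambda>_. 0)) = x (Inr b')" for x
      using p' neq W(4) by (simp_all add: p(1,2,4) sl p(3) links_def unfolded) (simp_all add: algebra_simps units')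
    have "homotopic W (map (filter (\<lambda>a. a \<notin> set (concat (map tl ?ss)))) W)"
    proof (rule homotopic_erase_strands)
      show "out (last ws) (propagate (links ?ss) x (\<lambda>_. 0)) = out (hd ws) x" if "ws \<in> set ?ss" for ws x
        using that inv by auto
    qed (use W mem step p p' sl neq in \<open>auto simp: links_def deps_def simp del: set_concat distinct_concat\<close>)
    then show ?thesis by simp
  next
    assume p': "(p', q') = (partner q, partner p)"
    let ?ss = "[[Inr b, Inl p, Inl q], [Inr b', Inl p', Inl q']]"
    have inv: "out (Inl q) (propagate (links ?ss) x (\<lambda>_. 0)) = x (Inr b)"
      "out (Inl q') (propagate (links ?ss) x (\<lambda>_. 0)) = x (Inr b')" for x
      using p' neq W(4) by (simp_all add: p(1,2,4) sl p(3) links_def unfolded) (simp_all add: algebra_simps units')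
    have "homotopic W (map (filter (\<lambda>a. a \<notin> set (concat (map tl ?ss)))) W)"
    proof (rule homotopic_erase_strands)
      show "out (last ws) (propagate (links ?ss) x (\<lambda>_. 0)) = out (hd ws) x" if "ws \<in> set ?ss" for ws x
        using that inv by auto
    qed (use W mem step p p' sl neq in \<open>auto simp: links_def deps_def simp del: set_concat distinct_concat\<close>)
    then show ?thesis by simp
  qed
qed

text \<open>
  At a kink that is entered below, the undercrossing relation involves the label behind the crossing,
  which has to be solved for; so this move is not covered by propagation along strands.
\<close>

lemma chain_R1_under:
  assumes p: "level p = Under" and q: "q = partner p"
    and L: "L = insert (Inl p) (insert (Inl q) M)" "Inl p \<notin> M" "Inl q \<notin> M" "finite M" "Inr b \<in> M"
    and step: "\<sigma> (Inr b) = Inl p" "\<sigma> (Inl p) = Inl q" "\<sigma> (Inl q) \<in> M" "\<sigma>0 (Inr b) = \<sigma> (Inl q)"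
    and rest: "\<And>l. l \<in> M \<Longrightarrow> l \<noteq> Inr b \<Longrightarrow> \<sigma>0 l = \<sigma> l \<and> \<sigma> l \<in> M"
    and \<kappa>: "\<kappa> (Inl p) = \<kappa> (Inr b)" "\<kappa> (Inl q) = \<kappa> (Inr b)"
  shows "chain L \<sigma> \<kappa> M \<sigma>0 \<kappa>" "chain M \<sigma>0 \<kappa> L \<sigma> \<kappa>"
proof -
  define e where "e = sign p"
  have out_p: "out (Inl p) x = under_unit e * x (Inl p) + (1 - over_unit e * under_unit e) * x (Inl q)"
    and out_q: "out (Inl q) x = over_unit e * x (Inl q)" for x
    using p by (simp_all add: q e_def)
  have pq: "p \<noteq> q" by (simp add: q)
  have units: "over_unit e * (over_unit (\<not> e) * f) = f" "under_unit (\<not> e) * (under_unit e * f) = f"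
    "under_unit e * (under_unit (\<not> e) * f) = f" for f
    by (simp_all add: mult.assoc[symmetric] unit_inverse)
  have sum_L: "(\<Sum>l\<in>L. f l) = f (Inl p) + f (Inl q) + f (Inr b) + (\<Sum>l\<in>M - {Inr b}. f l)"
    and sum_M: "(\<Sum>l\<in>M. f l) = f (Inr b) + (\<Sum>l\<in>M - {Inr b}. f l)" for f :: "letter \<Rightarrow> real"
    using L pq by (simp_all add: sum.remove[of M "Inr b" f] ac_simps)
  have deps: "deps l \<inter> {Inl p, Inl q} = {}" if "l \<in> M" for l
    using that L by (intro deps_disjoint) (auto simp: q)
  have neq: "l \<noteq> Inl p" "l \<noteq> Inl q" if "l \<in> M" for l using that L by auto
  \<comment> \<open>The combination of the relations at the bead, \<open>p\<close> and
    \<open>q\<close> that eliminates the labels of both deleted letters. The relation at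
    \<open>p\<close> is divided by \<open>under_unit e\<close>, whose inverse is
    \<open>under_unit (\<not> e)\<close>.\<close>
  define P where "P r = r(Inr b := r (Inr b) + under_unit (\<not> e) * r (Inl p) + r (Inl q))" for r :: labelling
  show "chain L \<sigma> \<kappa> M \<sigma>0 \<kappa>"
  proof (rule chainI[of "\<lambda>x. x" P])
    show "linear_form (\<lambda>r. P r l)" for l by (auto simp: linear_form_def P_def algebra_simps)
    show "residue M \<sigma>0 x l = P (residue L \<sigma> x) l" if l: "l \<in> M" for x l
    proof (cases "l = Inr b")
      case True
      have "x (Inl p) - x (Inr b) + under_unit (\<not> e) * (x (Inl q) -
          (under_unit e * x (Inl p) + (1 - over_unit e * under_unit e) * x (Inl q))) +
          (x (\<sigma> (Inl q)) - over_unit e * x (Inl q)) = x (\<sigma> (Inl q)) - x (Inr b)"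
        by (simp add: algebra_simps units)
      then show ?thesis using True L
        by (simp add: residue_def P_def step(1,2,4) out_p out_q del: out.simps(1))
    next
      case False
      then show ?thesis using l rest L by (simp add: residue_def P_def)
    qed
    show "(\<Sum>l\<in>M. c (\<kappa> l) * aug (P r l)) = (\<Sum>l\<in>L. c (\<kappa> l) * aug (r l))" for c :: "nat \<Rightarrow> real" and r
      unfolding sum_L sum_M by (simp add: P_def \<kappa> algebra_simps)
  qed (use L in \<open>auto simp: linear_form_def\<close>)
  \<comment> \<open>The label of \<open>q\<close> solves the relation at \<open>p\<close>, which
    reads \<open>x q = u x p + (1 - o u) x q\<close>, that is, \<open>o x q = x p\<close>.\<close>
  define Q where "Q x = x(Inl p := x (Inr b), Inl q := over_unit (\<not> e) * x (Inr b))" for x :: labelling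
  \<comment> \<open>After insertion of the kink the letter in front of the exit is \<open>q\<close>,
    so it inherits the residue of the bead.\<close>
  define P' where "P' r = r(Inr b := 0, Inl p := 0, Inl q := r (Inr b))" for r :: labelling
  have Q_same: "Q x l = x l" if "l \<in> M" for x l using neq[OF that] by (simp add: Q_def)
  show "chain M \<sigma>0 \<kappa> L \<sigma> \<kappa>"
  proof (rule chainI[of Q P'])
    show "linear_form (\<lambda>x. Q x l)" "linear_form (\<lambda>r. P' r l)" for l
      by (auto simp: linear_form_def Q_def P'_def algebra_simps)
    show "residue L \<sigma> (Q x) l = P' (residue M \<sigma>0 x) l" if l: "l \<in> L" for x l
    proof -
      consider "l = Inl p" | "l = Inl q" | "l = Inr b" | "l \<in> M" "l \<noteq> Inr b" using l L(1) by blast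
      then show ?thesis
      proof cases
        case 1
        have "under_unit e * x (Inr b) + (1 - over_unit e * under_unit e) * (over_unit (\<not> e) * x (Inr b)) =
            over_unit (\<not> e) * x (Inr b)"
          using units(1)[of "under_unit e * x (Inr b)"] by (simp add: algebra_simps)
        then show ?thesis using 1 L pq
          by (simp add: residue_def Q_def P'_def step out_p del: out.simps(1))
      next
        case 2
        have "Q x (\<sigma> (Inl q)) = x (\<sigma> (Inl q))" using Q_same step(3) by blast
        then show ?thesis using 2 L pq
          by (simp add: residue_def P'_def step(4) out_q del: out.simps(1)) (simp add: Q_def units)
      next
        case 3
        then show ?thesis using L pq by (simp add: residue_def Q_def P'_def step)
      next
        case 4
        have "out l (Q x) = out l x"
          using deps[OF 4(1)] by (intro out_cong) (auto simp: Q_def)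
        then show ?thesis using 4 rest[OF 4] neq[OF 4(1)] L(1)
          by (simp add: residue_def Q_same P'_def)
      qed
    qed
    show "aug (Q x l) = c (\<kappa> l)" if "\<forall>l\<in>M. aug (x l) = c (\<kappa> l)" "l \<in> L"
      for c :: "nat \<Rightarrow> real" and x l
      using that L by (auto simp: Q_def \<kappa>)
    show "(\<Sum>l\<in>L. c (\<kappa> l) * aug (P' r l)) = (\<Sum>l\<in>M. c (\<kappa> l) * aug (r l))" for c :: "nat \<Rightarrow> real" and r
    proof -
      have "(\<Sum>l\<in>M - {Inr b}. c (\<kappa> l) * aug (P' r l)) = (\<Sum>l\<in>M - {Inr b}. c (\<kappa> l) * aug (r l))"
        using neq by (intro sum.cong) (auto simp: P'_def)
      then show ?thesis unfolding sum_L sum_M using pq by (simp add: P'_def \<kappa>)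
    qed
  qed
qed

lemma homotopic_R1_under:
  assumes W: "distinct (concat W)" "Inr b \<in> set (concat W)"
    and step: "succ W (Inr b) = Inl p" "succ W (Inl p) = Inl (partner p)" and p: "level p = Under"
  shows "homotopic W (map (filter (\<lambda>a. a \<notin> {Inl p, Inl (partner p)})) W)"
proof -
  define q where "q = partner p"
  define L where "L = set (concat W)"
  define B where "B = {Inl p, Inl q :: letter}"
  define V where "V = map (filter (\<lambda>a. a \<notin> B)) W"
  \<comment> \<open>The strand is used only to determine the successors after deletion of the kink;
    the labels are taken care of by \<open>chain_R1_under\<close>.\<close>
  define ss where "ss = [[Inr b, Inl p, Inl q :: letter]]"
  have pq: "p \<noteq> q" by (simp add: q_def)
  have step': "succ W (Inr b) = Inl p" "succ W (Inl p) = Inl q" using step by (simp_all add: q_def)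
  have bL: "Inr b \<in> L" using W by (simp add: L_def)
  have pL: "Inl p \<in> L" using succ_in[OF W(1)] bL step'(1) unfolding L_def by metis
  have qL: "Inl q \<in> L" using succ_in[OF W(1)] pL step'(2) unfolding L_def by metis
  have ss: "distinct (concat ss)" "set (concat ss) \<subseteq> set (concat W)" "set (concat (map tl ss)) = B"
    using pq bL pL qL unfolding L_def[symmetric] by (auto simp: ss_def B_def)
  have steps: "succ W l = a" if "(a, l) \<in> set (links ss)" for a l
    using that step' by (auto simp: links_def ss_def)
  have in_ss: "[Inr b, Inl p, Inl q] \<in> set ss" by (simp add: ss_def)
  have M: "set (concat V) = L - B" unfolding V_def set_concat_filter[OF W(1)] L_def by blast
  have last: "succ W (Inl q) \<in> L - B"
    using last_not_in_tails[OF W(1) ss(1,2) steps in_ss] succ_in[OF W(1)] qL unfolding ss(3) L_def by simp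
  have hd: "succ V (Inr b) = succ W (Inl q)"
    using first_outside_last[OF W(1) ss(1,2) steps in_ss] succ_filter[OF W, of B] unfolding ss(3) V_def by (simp add: B_def)
  have rest: "succ V l = succ W l \<and> succ W l \<in> L - B" if l: "l \<in> L - B" "l \<noteq> Inr b" for l
  proof -
    have lL: "l \<in> set (concat W)" "l \<notin> B" using l(1) unfolding L_def by blast+
    have "succ W l \<notin> B"
      using succ_not_in_tails[OF W(1) ss(1,2) steps lL(1)] lL(2) l(2) unfolding ss(3) by (simp add: ss_def B_def)
    then show ?thesis
      using succ_filter[OF W(1) lL] first_outside_stop[OF W(1) lL(1)] succ_in[OF W(1) lL(1)]
      unfolding L_def V_def by (simp del: set_concat)
  qed
  have \<kappa>: "word_index W (Inl p) = word_index W (Inr b)" "word_index W (Inl q) = word_index W (Inr b)"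
    using word_index_succ[OF W] word_index_succ[OF W(1), of "Inl p"] pL step' unfolding L_def by simp_all
  have \<kappa>0: "word_index V l = word_index W l" if "l \<in> L - B" for l
    unfolding V_def by (rule word_index_filter[OF W(1)]) (use that in \<open>simp_all add: L_def del: set_concat\<close>)
  have "L = insert (Inl p) (insert (Inl q) (L - B))" "Inl p \<notin> L - B" "Inl q \<notin> L - B" "Inr b \<in> L - B" "finite (L - B)"
    using pL qL bL by (auto simp: B_def) (simp add: L_def)
  note chains = chain_R1_under[OF p q_def this(1-3,5,4) step' last hd rest \<kappa>]
  have "chain L (succ W) (word_index W) (L - B) (succ V) (word_index V)"
    by (rule chain_cong[OF chains(1)]) (simp_all add: \<kappa>0)
  moreover have "chain (L - B) (succ V) (word_index V) L (succ W) (word_index W)"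
    by (rule chain_cong[OF chains(2)]) (simp_all add: \<kappa>0)
  ultimately have "homotopic W V" unfolding homotopic_def M L_def[symmetric] by (rule conjI)
  then show ?thesis unfolding V_def B_def q_def .
qed

definition triangle_strands ::
    "nat list \<Rightarrow> nat \<Rightarrow> nat \<Rightarrow> nat \<Rightarrow> bool \<Rightarrow> bool \<Rightarrow> bool \<Rightarrow> bool \<Rightarrow> letter list list" where
  "triangle_strands bs x y z e12 e13 e23 h =
     map2 (\<lambda>b ws. Inr b # map Inl ws) bs (triangle_arcs x y z e12 e13 e23 h)"

definition triangle_letters :: "nat \<Rightarrow> nat \<Rightarrow> nat \<Rightarrow> bool \<Rightarrow> bool \<Rightarrow> bool \<Rightarrow> letter set" where
  "triangle_letters x y z e12 e13 e23 = Inl `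
     {Passage x (over_side e12) Over, Passage x (under_side e12) Under,
      Passage y (over_side e13) Over, Passage y (under_side e13) Under,
      Passage z (over_side e23) Over, Passage z (under_side e23) Under}"

text \<open>For each of the 16 choices of signs and of \<open>h\<close>, and for each strand, the
  outgoing labels on both sides are expressed in the labels of the three beads; they agree after
  cancellation of inverse units.\<close>

lemma triangle_invariant:
  assumes "x \<noteq> y" "x \<noteq> z" "y \<noteq> z" "b1 \<noteq> b2" "b1 \<noteq> b3" "b2 \<noteq> b3" "i < 3"
  shows "out (last (triangle_strands [b1, b2, b3] x y z e12 e13 e23 h ! i))
      (propagate (links (triangle_strands [b1, b2, b3] x y z e12 e13 e23 h)) f (\<lambda>_. 0)) =
    out (last (triangle_strands [b1, b2, b3] x y z e12 e13 e23 (\<not> h) ! i))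
      (propagate (links (triangle_strands [b1, b2, b3] x y z e12 e13 e23 (\<not> h))) f (\<lambda>_. 0))"
proof -
  define o1 where "o1 = over_unit True"
  define o2 where "o2 = over_unit False"
  define u1 where "u1 = under_unit True"
  define u2 where "u2 = under_unit False"
  have units: "o1 * o2 = 1" "u1 * u2 = 1"
    using unit_inverse[of True] by (simp_all add: o1_def o2_def u1_def u2_def)
  note units' = units arg_cong[OF units(1), of "\<lambda>z. z * f" for f, simplified mult.assoc mult_1]
    arg_cong[OF units(2), of "\<lambda>z. z * f" for f, simplified mult.assoc mult_1]
  note unfolded = o1_def[symmetric] o2_def[symmetric] u1_def[symmetric] u2_def[symmetric]
  note defs = triangle_strands_def triangle_arcs_def arrange_def over_side_def under_side_def
    links_def sign_def unfolded
  have "i = 0 \<or> i = 1 \<or> i = 2" using assms(7) by auto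
  then show ?thesis
  proof (elim disjE)
    assume i: "i = 0"
    show ?thesis unfolding i using assms(1-6)
      by (cases e12; cases e13; cases e23; cases h; simp add: defs mult_ac units')
  next
    assume i: "i = 1"
    show ?thesis unfolding i using assms(1-6)
      by (cases e12; cases e13; cases e23; cases h; simp add: defs; simp add: algebra_simps units')
  next
    assume i: "i = 2"
    show ?thesis unfolding i using assms(1-6)
      by (cases e12; cases e13; cases e23; cases h; simp add: defs; simp add: algebra_simps units')
  qed
qed

lemma triangle_tails:
  "set (concat (map tl (triangle_strands [b1, b2, b3] x y z e12 e13 e23 h))) = triangle_letters x y z e12 e13 e23"
  by (cases e12; cases e13; cases e23; cases h)
    (auto simp: triangle_strands_def triangle_arcs_def triangle_letters_def arrange_def)

lemma homotopic_R3:
  assumes W: "distinct (concat W)" "distinct (concat W')"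
    and xyz: "x \<noteq> y" "x \<noteq> z" "y \<noteq> z" and b: "b1 \<noteq> b2" "b1 \<noteq> b3" "b2 \<noteq> b3"
    and sub: "set (concat (triangle_strands [b1, b2, b3] x y z e12 e13 e23 h)) \<subseteq> set (concat W)"
      "set (concat (triangle_strands [b1, b2, b3] x y z e12 e13 e23 (\<not> h))) \<subseteq> set (concat W')"
    and step: "\<And>a l. (a, l) \<in> set (links (triangle_strands [b1, b2, b3] x y z e12 e13 e23 h)) \<Longrightarrow> succ W l = a"
      "\<And>a l. (a, l) \<in> set (links (triangle_strands [b1, b2, b3] x y z e12 e13 e23 (\<not> h))) \<Longrightarrow> succ W' l = a"
    and base: "map (filter (\<lambda>a. a \<notin> triangle_letters x y z e12 e13 e23)) W =
      map (filter (\<lambda>a. a \<notin> triangle_letters x y z e12 e13 e23)) W'"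
  shows "homotopic W W'"
proof -
  let ?S = "triangle_strands [b1, b2, b3] x y z e12 e13 e23"
  have len: "length (?S h) = 3" for h by (simp add: triangle_strands_def triangle_arcs_def)
  have ne: "?S h ! i \<noteq> [] \<and> hd (?S h ! i) = Inr ([b1, b2, b3] ! i)" if "i < 3" for h i
  proof -
    have "i = 0 \<or> i = 1 \<or> i = 2" using that by auto
    then show ?thesis by (auto simp: triangle_strands_def triangle_arcs_def)
  qed
  have dist: "distinct (concat (?S h))" for h
    using xyz b by (cases e12; cases e13; cases e23; cases h)
      (simp_all add: triangle_strands_def triangle_arcs_def arrange_def)
  \<comment> \<open>The strands are listed from top to bottom, so an undercrossing reads the label
    of a higher strand, which is known by then.\<close>
  have ord: "ordered (links (?S h))" for h
    using xyz b by (cases e12; cases e13; cases e23; cases h)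
      (simp_all add: triangle_strands_def triangle_arcs_def arrange_def links_def deps_def over_side_def under_side_def)
  have closed: "deps l \<inter> triangle_letters x y z e12 e13 e23 = {}" if "l \<notin> triangle_letters x y z e12 e13 e23" for l
    using that by (intro deps_disjoint) (auto simp: triangle_letters_def over_side_def under_side_def)
  show ?thesis
  proof (rule homotopic_strands[where ss = "?S h" and ss' = "?S (\<not> h)", OF W _ _ dist dist sub _ ord ord _ _ step])
    show "?S h ! i \<noteq> [] \<and> ?S (\<not> h) ! i \<noteq> [] \<and> hd (?S h ! i) = hd (?S (\<not> h) ! i)"
      if "i < length (?S h)" for i
      using that ne[of i] by (simp add: len)
    show "out (last (?S h ! i)) (propagate (links (?S h)) f (\<lambda>_. 0)) =
        out (last (?S (\<not> h) ! i)) (propagate (links (?S (\<not> h))) f (\<lambda>_. 0))"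
      if "i < length (?S h)" for i f
      using that by (intro triangle_invariant xyz b) (simp add: len)
  qed (use closed base in \<open>simp_all only: len triangle_tails\<close>)
qed

section \<open>Beaded words of codes with holes\<close>

lemma zip_tl_split: "(a, l) \<in> set (zip (tl s) s) \<Longrightarrow> \<exists>u v. s = u @ l # a # v"
proof (induction s)
  case (Cons h s)
  show ?case
  proof (cases s)
    case (Cons h' s')
    then have "a = h' \<and> l = h \<or> (a, l) \<in> set (zip (tl s) s)" using Cons.prems by simp
    then show ?thesis
    proof
      assume "a = h' \<and> l = h"
      then show ?thesis using Cons by (metis append_Nil)
    next
      assume "(a, l) \<in> set (zip (tl s) s)"
      then obtain u v where "s = u @ l # a # v" using Cons.IH by blast
      then show ?thesis by (metis append_Cons)
    qed
  qed (use Cons.prems in simp)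
qed simp

definition beaded :: "code \<Rightarrow> letter list list" where
  "beaded C = map (\<lambda>i. Inr i # map Inl (C ! i)) [0..<length C]"

text \<open>The bead \<open>n + k\<close> in front of hole \<open>k\<close> is the first letter of
  the strand inserted there. The offset \<open>n\<close>, the number of components, keeps it apart
  from the beads of the components.\<close>

definition hole_letters :: "nat \<Rightarrow> passage list list \<Rightarrow> passage + nat \<Rightarrow> letter list" where
  "hole_letters n xs a = (case a of Inl p \<Rightarrow> [Inl p] | Inr k \<Rightarrow> Inr (n + k) # map Inl (xs ! k))"

text \<open>
  The beads in front of the holes keep adjacent holes apart.
\<close>

definition beaded_fill :: "passage list list \<Rightarrow> holed_code \<Rightarrow> letter list list" where
  "beaded_fill xs E =
     map (\<lambda>i. Inr i # concat (map (hole_letters (length E) xs) (E ! i))) [0..<length E]"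

definition filled_hole :: "passage list list \<Rightarrow> passage + nat \<Rightarrow> passage list" where
  "filled_hole xs a = (case a of Inl p \<Rightarrow> [p] | Inr k \<Rightarrow> xs ! k)"

lemma fill_eq: "fill xs E = map (\<lambda>w. concat (map (filled_hole xs) w)) E"
proof -
  have "filled_hole xs = case_sum (\<lambda>p. [p]) ((!) xs)" by (auto simp: fun_eq_iff filled_hole_def)
  then show ?thesis by (simp add: fill_def)
qed

lemma concat_fill: "concat (fill xs E) = concat (map (filled_hole xs) (concat E))"
  by (induction E) (auto simp: fill_eq)

lemma filter_concat_map: "filter P (concat (map f w)) = concat (map (\<lambda>a. filter P (f a)) w)"
  by (induction w) auto

lemma length_beaded [simp]: "length (beaded C) = length C"
  by (simp add: beaded_def)

lemma filter_holes_beaded_fill: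
  assumes "has_holes k E"
  shows "map (filter (\<lambda>a. a \<notin> Inr ` {length E..<length E + k})) (beaded_fill xs E) = beaded (fill xs E)"
proof -
  let ?P = "\<lambda>a :: letter. a \<notin> Inr ` {length E..<length E + k}"
  have "filter ?P (hole_letters (length E) xs a) = map Inl (filled_hole xs a)" if "a \<in> set (concat E)" for a
  proof (cases a)
    case (Inr j)
    then have "j \<in> set (holes E)" using that by (auto simp: holes_def)
    then have "j < k" using assms by (simp add: has_holes_def)
    moreover have "filter ?P (map Inl (xs ! j)) = map Inl (xs ! j)" by (rule filter_True) auto
    ultimately show ?thesis using Inr by (simp add: hole_letters_def filled_hole_def)
  qed (auto simp: hole_letters_def filled_hole_def)
  then have "concat (map (\<lambda>a. filter ?P (hole_letters (length E) xs a)) w) = map Inl (concat (map (filled_hole xs) w))"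
    if "w \<in> set E" for w
    using that by (simp add: map_concat o_def cong: map_cong) (intro arg_cong[of _ _ concat] map_cong; auto)
  then show ?thesis
    by (auto simp: beaded_fill_def beaded_def fill_eq filter_concat_map)
qed

lemma distinct_filterI:
  "distinct (filter P xs) \<Longrightarrow> distinct (filter (\<lambda>a. \<not> P a) xs) \<Longrightarrow> distinct xs"
  by (induction xs) (auto split: if_splits)

lemma holes_eq: "holes E = concat (map (case_sum (\<lambda>_. []) (\<lambda>i. [i])) (concat E))"
proof -
  have "(\<lambda>a :: passage + nat. case a of Inl x \<Rightarrow> [] | Inr i \<Rightarrow> [i]) = case_sum (\<lambda>_. []) (\<lambda>i. [i])"
    by (auto simp: fun_eq_iff)
  then show ?thesis by (simp add: holes_def)
qed

lemma hole_in_code: "has_holes k E \<Longrightarrow> j < k \<longleftrightarrow> Inr j \<in> set (concat E)"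
  by (auto simp: has_holes_def holes_def split: sum.splits)

lemma length_fill [simp]: "length (fill xs E) = length E"
  by (simp add: fill_def)

lemma distinct_concat_map_disjoint:
  assumes "distinct (concat (map f w))" "a \<in> set w" "b \<in> set w" "a \<noteq> b"
  shows "set (f a) \<inter> set (f b) = {}"
  using assms
proof (induction w)
  case (Cons c w)
  have "set (f d) \<subseteq> set (concat (map f w))" if "d \<in> set w" for d
    using that by auto
  moreover have "set (f c) \<inter> set (concat (map f w)) = {}" "distinct (concat (map f w))"
    using Cons.prems(1) by auto
  moreover have "(a = c \<and> b \<in> set w) \<or> (b = c \<and> a \<in> set w) \<or> (a \<in> set w \<and> b \<in> set w)"
    using Cons.prems by auto
  ultimately show ?case using Cons.IH Cons.prems(4) by blast
qed simp

lemma fresh_fill: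
  assumes "distinct (concat (fill xs E))" "Inl p \<in> set (concat E)" "Inr k \<in> set (concat E)"
  shows "p \<notin> set (xs ! k)"
  using distinct_concat_map_disjoint[OF assms(1)[unfolded concat_fill] assms(2,3)]
  by (simp add: filled_hole_def)

lemma disjoint_holes:
  assumes "distinct (concat (fill xs E))" "has_holes (length xs) E" "j < length xs" "k < length xs" "j \<noteq> k"
  shows "set (xs ! j) \<inter> set (xs ! k) = {}"
  using distinct_concat_map_disjoint[OF assms(1)[unfolded concat_fill], of "Inr j" "Inr k"]
    hole_in_code[OF assms(2)] assms(3-5) by (simp add: filled_hole_def del: set_concat)

lemma distinct_hole:
  assumes "distinct (concat (fill xs E))" "has_holes (length xs) E" "k < length xs"
  shows "distinct (xs ! k)"
proof -
  have "distinct (concat (map f w)) \<Longrightarrow> a \<in> set w \<Longrightarrow> distinct (f a)" for f :: "passage + nat \<Rightarrow> passage list" and w a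
    by (induction w) auto
  from this[OF assms(1)[unfolded concat_fill], of "Inr k"] show ?thesis
    using hole_in_code[OF assms(2)] assms(3) by (simp add: filled_hole_def del: set_concat)
qed

lemma passages_fill:
  assumes "has_holes (length xs) E" "k < length xs" "p \<in> set (xs ! k)"
  shows "p \<in> passages (fill xs E)"
proof -
  have "Inr k \<in> set (concat E)" using hole_in_code[OF assms(1)] assms(2) by blast
  moreover have "p \<in> set (filled_hole xs (Inr k))" using assms(3) by (simp add: filled_hole_def)
  ultimately show ?thesis
    unfolding passages_def concat_fill by (intro in_set_concatI[of "filled_hole xs (Inr k)"]) simp_all
qed

lemma concat_beaded_fill:
  "concat (beaded_fill xs E) =
     concat (map (\<lambda>i. Inr i # concat (map (hole_letters (length E) xs) (E ! i))) [0..<length E])"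
  by (simp add: beaded_fill_def)

lemma concat_map_nth: "concat (map (\<lambda>i. f (E ! i)) [0..<length E]) = concat (map f E)"
proof -
  have "map (\<lambda>i. f (E ! i)) [0..<length E] = map f E" by (rule nth_equalityI) auto
  then show ?thesis by (rule arg_cong)
qed

lemma concat_map_concat: "concat (map f (concat E)) = concat (map (\<lambda>w. concat (map f w)) E)"
  by (induction E) auto

text \<open>Three kinds of letters are examined separately: passages, which are distinct by
  assumption, beads of components, and beads of holes, which are distinct because every hole occurs
  once.\<close>

lemma distinct_beaded_fill:
  assumes "distinct (concat (fill xs E))" "has_holes (length xs) E"
  shows "distinct (concat (beaded_fill xs E))"
proof (rule distinct_filterI[of isl])
  let ?n = "length E"
  let ?H = "hole_letters ?n xs"
  have "filter isl (?H a) = map Inl (filled_hole xs a)" for a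
    by (auto simp: hole_letters_def filled_hole_def filter_empty_conv split: sum.split)
  then have "filter isl (concat (beaded_fill xs E)) = concat (map (\<lambda>i. concat (map (\<lambda>a. map Inl (filled_hole xs a)) (E ! i))) [0..<?n])"
    unfolding concat_beaded_fill filter_concat_map by (simp add: filter_concat_map)
  also have "\<dots> = map Inl (concat (fill xs E))"
    unfolding concat_map_nth[of "\<lambda>w. concat (map (\<lambda>a. map Inl (filled_hole xs a)) w)"] concat_fill
      concat_map_concat[symmetric] by (simp add: map_concat o_def)
  finally show "distinct (filter isl (concat (beaded_fill xs E)))"
    using assms(1) by (simp add: distinct_map del: set_concat distinct_concat)
  show "distinct (filter (\<lambda>a. \<not> isl a) (concat (beaded_fill xs E)))"
  proof (rule distinct_filterI[of "\<lambda>a. a \<in> Inr ` {..<?n}"])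
    have "filter (\<lambda>a. a \<in> Inr ` {..<?n}) (?H a) = []" for a
      by (auto simp: hole_letters_def filter_empty_conv split: sum.split)
    then have "filter (\<lambda>a. a \<in> Inr ` {..<?n}) (filter (\<lambda>a. \<not> isl a) (concat (beaded_fill xs E))) =
      concat (map (\<lambda>i. [Inr i]) [0..<?n])"
      unfolding concat_beaded_fill filter_concat_map filter_filter
      by (intro arg_cong[of _ _ concat] map_cong)
        (auto simp: filter_concat_map filter_empty_conv)
    also have "\<dots> = map Inr [0..<?n]" by (simp add: concat_map_singleton)
    finally show "distinct (filter (\<lambda>a. a \<in> Inr ` {..<?n}) (filter (\<lambda>a. \<not> isl a) (concat (beaded_fill xs E))))"
      by (simp add: distinct_map)
    have H: "filter (\<lambda>a. \<not> isl a \<and> a \<notin> Inr ` {..<?n}) (?H a) =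
        map (\<lambda>k. Inr (?n + k)) (case_sum (\<lambda>_. []) (\<lambda>i. [i]) a)" for a
      by (auto simp: hole_letters_def filter_empty_conv split: sum.split)
    have "filter (\<lambda>a. a \<notin> Inr ` {..<?n}) (filter (\<lambda>a. \<not> isl a) (concat (beaded_fill xs E))) =
      concat (map (\<lambda>i. concat (map (\<lambda>a. map (\<lambda>k. Inr (?n + k)) (case_sum (\<lambda>_. []) (\<lambda>i. [i]) a)) (E ! i))) [0..<?n])"
      unfolding concat_beaded_fill filter_concat_map
      by (intro arg_cong[of _ _ concat] map_cong) (auto simp: filter_concat_map H)
    also have "\<dots> = map (\<lambda>k. Inr (?n + k)) (holes E)"
      unfolding concat_map_nth[of "\<lambda>w. concat (map (\<lambda>a. map (\<lambda>k. Inr (?n + k)) (case_sum (\<lambda>_. []) (\<lambda>i. [i]) a)) w)"] holes_eq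
        concat_map_concat[symmetric] by (simp add: map_concat o_def)
    finally show "distinct (filter (\<lambda>a. a \<notin> Inr ` {..<?n}) (filter (\<lambda>a. \<not> isl a) (concat (beaded_fill xs E))))"
      using assms(2) by (simp add: distinct_map has_holes_def inj_on_def)
  qed
qed

definition strand :: "nat \<Rightarrow> passage list list \<Rightarrow> nat \<Rightarrow> letter list" where
  "strand n xs k = Inr (n + k) # map Inl (xs ! k)"

lemma strand_in_beaded_fill:
  assumes "has_holes (length xs) E" "k < length xs"
  shows "\<exists>u v. u @ strand (length E) xs k @ v \<in> set (beaded_fill xs E)"
proof -
  have "Inr k \<in> set (concat E)" using hole_in_code[OF assms(1)] assms(2) by blast
  then obtain i where i: "i < length E" "Inr k \<in> set (E ! i)" by (auto simp: in_set_conv_nth) (metis in_set_conv_nth)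
  then obtain u v where "E ! i = u @ Inr k # v" by (meson split_list)
  then have "(Inr i # concat (map (hole_letters (length E) xs) u)) @ strand (length E) xs k @
      concat (map (hole_letters (length E) xs) v) = beaded_fill xs E ! i"
    using i(1) by (simp add: beaded_fill_def strand_def hole_letters_def)
  moreover have "beaded_fill xs E ! i \<in> set (beaded_fill xs E)" using i(1) by (simp add: beaded_fill_def)
  ultimately show ?thesis by metis
qed

lemma strand_subset:
  assumes "has_holes (length xs) E" "k < length xs"
  shows "set (strand (length E) xs k) \<subseteq> set (concat (beaded_fill xs E))"
proof
  fix a assume a: "a \<in> set (strand (length E) xs k)"
  obtain u v where "u @ strand (length E) xs k @ v \<in> set (beaded_fill xs E)"
    using strand_in_beaded_fill[OF assms] by blast
  from in_set_concatI[OF this] show "a \<in> set (concat (beaded_fill xs E))" using a by simp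
qed

lemma succ_strand:
  assumes "distinct (concat (fill xs E))" "has_holes (length xs) E" "k < length xs"
    and "(a, l) \<in> set (zip (tl (strand (length E) xs k)) (strand (length E) xs k))"
  shows "succ (beaded_fill xs E) l = a"
proof -
  obtain u v where "u @ strand (length E) xs k @ v \<in> set (beaded_fill xs E)"
    using strand_in_beaded_fill[OF assms(2,3)] by blast
  moreover obtain u' v' where "strand (length E) xs k = u' @ l # a # v'"
    using zip_tl_split[OF assms(4)] by blast
  ultimately have "(u @ u') @ l # a # (v' @ v) \<in> set (beaded_fill xs E)" by simp
  then show ?thesis by (rule succ_adjacent[OF distinct_beaded_fill[OF assms(1,2)]])
qed

text \<open>What remains depends only on the number of the inserted arcs and not on the arcs
  themselves. It is the common exterior of the two sides of a move.\<close>

lemma filter_passages_beaded_fill: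
  assumes "distinct (concat (fill xs E))" "has_holes (length xs) E"
  shows "map (filter (\<lambda>a. a \<notin> Inl ` set (concat xs))) (beaded_fill xs E) =
    beaded_fill (replicate (length xs) []) E"
proof -
  have H: "filter (\<lambda>a. a \<notin> Inl ` set (concat xs)) (hole_letters (length E) xs a) =
      hole_letters (length E) (replicate (length xs) []) a" if a: "a \<in> set (concat E)" for a
  proof (cases a)
    case (Inl p)
    have "p \<notin> set (concat xs)"
    proof
      assume "p \<in> set (concat xs)"
      then obtain k where "k < length xs" "p \<in> set (xs ! k)" by (auto simp: in_set_conv_nth) (metis in_set_conv_nth)
      moreover from this have "Inr k \<in> set (concat E)" using hole_in_code[OF assms(2)] by blast
      ultimately show False using fresh_fill[OF assms(1)] a Inl by blast
    qed
    then show ?thesis using Inl by (auto simp: hole_letters_def)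
  next
    case (Inr k)
    then have k: "k < length xs" using hole_in_code[OF assms(2)] a by blast
    have "set (xs ! k) \<subseteq> set (concat xs)" using in_set_concatI[OF nth_mem[OF k]] by blast
    then have "filter (\<lambda>a. a \<notin> Inl ` set (concat xs)) (map Inl (xs ! k) :: letter list) = []"
      by (intro filter_False) auto
    moreover have "filter (\<lambda>a. a \<notin> Inl ` B) (Inr m # ws) = Inr m # filter (\<lambda>a. a \<notin> Inl ` B) ws"
      for B :: "passage set" and m :: nat and ws by auto
    moreover have "replicate (length xs) [] ! k = ([] :: passage list)" using k by simp
    ultimately show ?thesis by (simp only: Inr hole_letters_def sum.case list.map)
  qed
  have "concat (map (\<lambda>a. filter (\<lambda>a. a \<notin> Inl ` set (concat xs)) (hole_letters (length E) xs a)) w) =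
      concat (map (hole_letters (length E) (replicate (length xs) [])) w)" if "w \<in> set E" for w
    using that H by (intro arg_cong[of _ _ concat] map_cong) auto
  then show ?thesis by (auto simp: beaded_fill_def filter_concat_map simp del: set_concat)
qed

lemma homotopic_beaded_fill:
  assumes "distinct (concat (fill xs E))" "has_holes (length xs) E"
  shows "homotopic (beaded_fill xs E) (beaded (fill xs E))"
proof -
  have "\<exists>l\<in>set w. l \<notin> Inr ` {length E..<length E + length xs}" if "w \<in> set (beaded_fill xs E)" for w
  proof -
    obtain i where "i < length E" "w = Inr i # concat (map (hole_letters (length E) xs) (E ! i))"
      using \<open>w \<in> set (beaded_fill xs E)\<close> by (auto simp: beaded_fill_def)
    then show ?thesis by (intro bexI[of _ "Inr i"]) auto
  qed
  then have "homotopic (beaded_fill xs E)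
      (map (filter (\<lambda>a. a \<notin> Inr ` {length E..<length E + length xs})) (beaded_fill xs E))"
    by (intro homotopic_delete_beads distinct_beaded_fill assms) auto
  then show ?thesis unfolding filter_holes_beaded_fill[OF assms(2)] .
qed

text \<open>The bead of the hole serves as the letter in front of the kink even if the hole is the
  whole component; afterwards it is removed on both sides.\<close>

lemma homotopic_insert_R1:
  assumes "distinct (concat (fill [[]] E))" "distinct (concat (fill [[p, partner p]] E))" "has_holes 1 E"
    and "level p \<noteq> Virtual"
  shows "homotopic (beaded (fill [[]] E)) (beaded (fill [[p, partner p]] E))"
proof -
  let ?ys = "[[p, partner p]]"
  have h: "has_holes (length ?ys) E" "has_holes (length [[] :: passage list]) E" using assms(3) by simp_all
  let ?W = "beaded_fill ?ys E"
  note W = distinct_beaded_fill[OF assms(2) h(1)]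
  have st: "strand (length E) ?ys 0 = [Inr (length E), Inl p, Inl (partner p)]" by (simp add: strand_def)
  have b: "Inr (length E) \<in> set (concat ?W)" using strand_subset[OF h(1), of 0] unfolding st by simp
  have step: "succ ?W (Inr (length E)) = Inl p" "succ ?W (Inl p) = Inl (partner p)"
    using succ_strand[OF assms(2) h(1), of 0] unfolding st by simp_all
  have B: "Inl ` set (concat ?ys) = {Inl p, Inl (partner p)}" by simp
  have "homotopic ?W (map (filter (\<lambda>a. a \<notin> Inl ` set (concat ?ys))) ?W)"
    unfolding B using assms(4) homotopic_R1_over[OF W b step] homotopic_R1_under[OF W b step]
    by (cases "level p") auto
  then have "homotopic ?W (beaded_fill [[]] E)"
    unfolding filter_passages_beaded_fill[OF assms(2) h(1)] by simp
  then show ?thesis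
    using homotopic_beaded_fill[OF assms(1) h(2)] homotopic_beaded_fill[OF assms(2) h(1)]
    by (meson homotopic_sym homotopic_trans)
qed

lemma homotopic_insert_R2:
  assumes "distinct (concat (fill [[], []] E))" "distinct (concat (fill [[p, q], us] E))" "has_holes 2 E"
    and p: "level p = Over" "level q = Over" "sign q \<longleftrightarrow> \<not> sign p" "p \<noteq> q"
    and us: "us = [partner p, partner q] \<or> us = [partner q, partner p]"
  shows "homotopic (beaded (fill [[], []] E)) (beaded (fill [[p, q], us] E))"
proof -
  obtain p' q' where us': "us = [p', q']" "(p', q') = (partner p, partner q) \<or> (p', q') = (partner q, partner p)"
    using us by auto
  let ?ys = "[[p, q], us]"
  have h: "has_holes (length ?ys) E" "has_holes (length [[], [] :: passage list]) E"
    using assms(3) by (simp_all add: numeral_2_eq_2)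
  let ?W = "beaded_fill ?ys E" and ?b = "length E" and ?c = "length E + 1"
  note W = distinct_beaded_fill[OF assms(2) h(1)]
  have st: "strand (length E) ?ys 0 = [Inr ?b, Inl p, Inl q]" "strand (length E) ?ys 1 = [Inr ?c, Inl p', Inl q']"
    by (simp_all add: strand_def us'(1))
  have b: "Inr ?b \<in> set (concat ?W)" "Inr ?c \<in> set (concat ?W)" "?b \<noteq> ?c"
    using strand_subset[OF h(1), of 0] strand_subset[OF h(1), of 1] unfolding st by (simp_all del: set_concat)
  have step: "succ ?W (Inr ?b) = Inl p" "succ ?W (Inl p) = Inl q"
    "succ ?W (Inr ?c) = Inl p'" "succ ?W (Inl p') = Inl q'"
    using succ_strand[OF assms(2) h(1), of 0] succ_strand[OF assms(2) h(1), of 1] unfolding st by simp_all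
  have B: "Inl ` set (concat ?ys) = {Inl p, Inl q, Inl p', Inl q'}" by (auto simp: us'(1))
  have "homotopic ?W (map (filter (\<lambda>a. a \<notin> Inl ` set (concat ?ys))) ?W)"
    unfolding B by (rule homotopic_R2[OF W b step p us'(2)])
  then have "homotopic ?W (beaded_fill [[], []] E)"
    unfolding filter_passages_beaded_fill[OF assms(2) h(1)] by (simp add: numeral_2_eq_2)
  then show ?thesis
    using homotopic_beaded_fill[OF assms(1) h(2)] homotopic_beaded_fill[OF assms(2) h(1)]
    by (meson homotopic_sym homotopic_trans)
qed

lemma homotopic_triangle:
  fixes x y z e12 e13 e23
  defines "tri \<equiv> triangle_arcs x y z e12 e13 e23"
  assumes "distinct (concat (fill (tri h) E))" "distinct (concat (fill (tri (\<not> h)) E))" "has_holes 3 E"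
    and xyz: "x \<noteq> y" "x \<noteq> z" "y \<noteq> z"
  shows "homotopic (beaded (fill (tri h) E)) (beaded (fill (tri (\<not> h)) E))"
proof -
  let ?n = "length E"
  have len: "length (tri h) = 3" for h by (simp add: tri_def triangle_arcs_def)
  have h: "has_holes (length (tri h)) E" for h using assms(4) by (simp add: len)
  have strands: "triangle_strands [?n, ?n + 1, ?n + 2] x y z e12 e13 e23 h = map (strand ?n (tri h)) [0, 1, 2]" for h
    by (simp add: tri_def triangle_strands_def triangle_arcs_def strand_def)
  have links: "succ (beaded_fill (tri h) E) l = a"
    if dist: "distinct (concat (fill (tri h) E))"
      and al: "(a, l) \<in> set (links (map (strand ?n (tri h)) [0, 1, 2]))" for h a l
  proof -
    have "(a, l) \<in> (\<Union>k\<in>{0, 1, 2}. set (zip (tl (strand ?n (tri h) k)) (strand ?n (tri h) k)))"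
      using al by (simp add: links_def)
    then obtain k where "k \<in> {0, 1, 2}" "(a, l) \<in> set (zip (tl (strand ?n (tri h) k)) (strand ?n (tri h) k))"
      by (rule UN_E)
    then show ?thesis using succ_strand[OF dist h, of k a l] by (auto simp: len)
  qed
  have sub: "set (concat (map (strand ?n (tri h)) [0, 1, 2])) \<subseteq> set (concat (beaded_fill (tri h) E))" for h
  proof -
    have "set (strand ?n (tri h) k) \<subseteq> set (concat (beaded_fill (tri h) E))" if "k < 3" for k
      by (rule strand_subset[OF h]) (use that in \<open>simp add: len\<close>)
    from this[of 0] this[of 1] this[of 2] show ?thesis by (simp del: set_concat)
  qed
  have letters: "Inl ` set (concat (tri h)) = triangle_letters x y z e12 e13 e23" for h
    by (cases e12; cases e13; cases e23; cases h)
      (auto simp: tri_def triangle_arcs_def triangle_letters_def arrange_def)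
  have base: "map (filter (\<lambda>a. a \<notin> triangle_letters x y z e12 e13 e23)) (beaded_fill (tri h) E) =
      beaded_fill (replicate 3 []) E" if "distinct (concat (fill (tri h) E))" for h
    using filter_passages_beaded_fill[OF that h] unfolding letters len .
  have "homotopic (beaded_fill (tri h) E) (beaded_fill (tri (\<not> h)) E)"
    using base[OF assms(2)] base[OF assms(3)] xyz links sub assms(2,3)
    by (intro homotopic_R3[where ?b1.0 = ?n and ?b2.0 = "?n + 1" and ?b3.0 = "?n + 2" and h = h
          and x = x and y = y and z = z and ?e12.0 = e12 and ?e13.0 = e13 and ?e23.0 = e23]
        distinct_beaded_fill h) (simp_all only: strands, simp_all)
  then show ?thesis
    using homotopic_beaded_fill[OF assms(2) h] homotopic_beaded_fill[OF assms(3) h]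
    by (meson homotopic_sym homotopic_trans)
qed

section \<open>Reidemeister moves\<close>

lemma level_partner_neq: "level p \<noteq> Virtual \<Longrightarrow> level (partner p) \<noteq> level p"
  by (cases "level p") auto

lemma wf_code_same_crossing:
  assumes "wf_code D" "p \<in> passages D"
  shows "{q \<in> passages D. crossing q = crossing p} = {p, partner p}"
proof -
  have "crossing p \<in> crossings D" using assms(2) by (simp add: crossings_def)
  then obtain l r where lr: "(l, r) \<in> {(Over, Under), (Under, Over), (Virtual, Virtual)}"
    "{q \<in> passages D. crossing q = crossing p} = {Passage (crossing p) FromLeft l, Passage (crossing p) FromRight r}"
    using assms(1) unfolding wf_code_def by blast
  have "p \<in> {q \<in> passages D. crossing q = crossing p}" using assms(2) by simp
  then have "p = Passage (crossing p) FromLeft l \<or> p = Passage (crossing p) FromRight r" unfolding lr(2) by simp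
  then have "{Passage (crossing p) FromLeft l, Passage (crossing p) FromRight r} = {p, partner p}"
    using lr(1) by (cases p) auto
  then show ?thesis using lr(2) by simp
qed

lemma wf_code_partner: "wf_code D \<Longrightarrow> p \<in> passages D \<Longrightarrow> partner p \<in> passages D"
  using wf_code_same_crossing by blast

lemma wf_code_unique:
  "wf_code D \<Longrightarrow> p \<in> passages D \<Longrightarrow> q \<in> passages D \<Longrightarrow> crossing q = crossing p \<Longrightarrow> q = p \<or> q = partner p"
  using wf_code_same_crossing by blast

lemma concat_classical_part: "concat (classical_part D) = filter (\<lambda>p. level p \<noteq> Virtual) (concat D)"
  by (simp add: classical_part_def filter_concat)

lemma passages_classical_part: "passages (classical_part D) = {p \<in> passages D. level p \<noteq> Virtual}"
  by (auto simp: passages_def concat_classical_part simp del: set_concat)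

lemma length_classical_part [simp]: "length (classical_part D) = length D"
  by (simp add: classical_part_def)

lemma distinct_classical_part: "wf_code D \<Longrightarrow> distinct (concat (classical_part D))"
  by (simp add: wf_code_def concat_classical_part)

definition classical_holed :: "holed_code \<Rightarrow> holed_code" where
  "classical_holed E = map (filter (\<lambda>a. case a of Inl p \<Rightarrow> level p \<noteq> Virtual | Inr _ \<Rightarrow> True)) E"

lemma has_holes_classical: "has_holes k E \<Longrightarrow> has_holes k (classical_holed E)"
proof -
  have "concat (map f (filter P w)) = concat (map f w)" if "\<And>a. \<not> P a \<Longrightarrow> f a = []"
    for f :: "passage + nat \<Rightarrow> nat list" and P w
    using that by (induction w) auto
  note drop = this
  have "holes (classical_holed E) = holes E"
    unfolding holes_eq classical_holed_def filter_concat[symmetric]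
    by (rule drop) (simp split: sum.splits)
  then show "has_holes k E \<Longrightarrow> has_holes k (classical_holed E)" by (simp add: has_holes_def)
qed

lemma classical_part_fill:
  assumes "has_holes (length xs) E" "\<And>p. p \<in> set (concat xs) \<Longrightarrow> level p \<noteq> Virtual"
  shows "classical_part (fill xs E) = fill xs (classical_holed E)"
proof -
  let ?P = "\<lambda>a :: passage + nat. case a of Inl p \<Rightarrow> level p \<noteq> Virtual | Inr _ \<Rightarrow> True"
  have word: "filter (\<lambda>p. level p \<noteq> Virtual) (concat (map (filled_hole xs) w)) = concat (map (filled_hole xs) (filter ?P w))"
    if "set w \<subseteq> set (concat E)" for w
    using that
  proof (induction w)
    case (Cons a w)
    have "filter (\<lambda>p. level p \<noteq> Virtual) (filled_hole xs a) = (if ?P a then filled_hole xs a else [])"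
    proof (cases a)
      case (Inr k)
      then have "k < length xs" using hole_in_code[OF assms(1)] Cons.prems by (simp del: set_concat)
      then have "level p \<noteq> Virtual" if "p \<in> set (xs ! k)" for p
        using that by (intro assms(2) in_set_concatI[of "xs ! k"] nth_mem)
      then show ?thesis using Inr by (simp add: filled_hole_def)
    qed (simp add: filled_hole_def)
    then show ?case using Cons by (simp del: set_concat)
  qed simp
  then show ?thesis unfolding classical_part_def fill_eq classical_holed_def map_map o_def
    by (intro map_cong refl word) auto
qed

text \<open>Virtual passages do not change labels and the replaced arcs contain none, so such a move
  restricts to the classical parts, where only classical passages of the exterior are left.\<close>

lemma local_move_classical:
  assumes "local_move xs ys D D'" "wf_code D" "wf_code D'"
    and "\<And>p. p \<in> set (concat xs) \<union> set (concat ys) \<Longrightarrow> level p \<noteq> Virtual"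
  obtains E where "has_holes (length xs) E" "length ys = length xs"
    "classical_part D = fill xs E" "classical_part D' = fill ys E"
    "distinct (concat (fill xs E))" "distinct (concat (fill ys E))"
proof -
  obtain E where E: "length xs = length ys" "has_holes (length xs) E" "D = fill xs E" "D' = fill ys E"
    using assms(1) unfolding local_move_def by blast
  have "classical_part D = fill xs (classical_holed E)"
    unfolding E(3) by (rule classical_part_fill[OF E(2)]) (use assms(4) in blast)
  moreover have "classical_part D' = fill ys (classical_holed E)"
    unfolding E(4) by (rule classical_part_fill) (use assms(4) E(1,2) in \<open>simp, blast\<close>)
  ultimately show thesis
    using that[OF has_holes_classical[OF E(2)]] E(1) distinct_classical_part[OF assms(2)]
      distinct_classical_part[OF assms(3)] by simp
qed

text \<open>If one passage of a crossing lies on a virtual arc, its other passage is virtual as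
  well. So erasing the crossings of the arc removes nothing classical, and the classical part is a
  function of the erased diagram, which the move does not change.\<close>

lemma classical_part_detour:
  assumes "has_holes 1 E" "wf_code (fill [w] E)" "\<forall>p\<in>set w. level p = Virtual"
  shows "classical_part (fill [w] E) =
    map (\<lambda>v. concat (map (case_sum (\<lambda>p. if level p = Virtual then [] else [p]) (\<lambda>_. [])) v)) (erase (crossing ` set w) E)"
proof -
  let ?g = "case_sum (\<lambda>p. if level p = Virtual then [] else [p]) (\<lambda>_ :: nat. [])"
  have hole: "Inr k \<in> set (concat E) \<longleftrightarrow> k = 0" for k using hole_in_code[OF assms(1), of k] by auto
  have virt: "level p = Virtual" if p: "Inl p \<in> set (concat E)" "crossing p \<in> crossing ` set w" for p
  proof -
    obtain q where q: "q \<in> set w" "crossing q = crossing p" using p(2) by auto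
    have "q \<in> passages (fill [w] E)" using passages_fill[of "[w]" E 0 q] assms(1) q(1) by simp
    moreover have "p \<in> passages (fill [w] E)"
      unfolding passages_def concat_fill
    proof (rule in_set_concatI)
      show "filled_hole [w] (Inl p) \<in> set (map (filled_hole [w]) (concat E))"
        using p(1) by (simp only: set_map imageI)
    qed (simp add: filled_hole_def)
    ultimately have "p = q \<or> p = partner q" using wf_code_unique[OF assms(2)] q(2) by simp
    then show ?thesis using assms(3) q(1) by auto
  qed
  have word: "filter (\<lambda>p. level p \<noteq> Virtual) (concat (map (filled_hole [w]) v)) =
      concat (map ?g (filter (\<lambda>x. case x of Inl p \<Rightarrow> crossing p \<notin> crossing ` set w | Inr i \<Rightarrow> True) v))"
    if "set v \<subseteq> set (concat E)" for v
    using that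
  proof (induction v)
    case (Cons a v)
    have fl: "filter (\<lambda>p. level p \<noteq> Virtual) w = []" using assms(3) by (simp add: filter_empty_conv)
    have a: "a \<in> set (concat E)" using Cons.prems by (simp del: set_concat)
    show ?case
    proof (cases a)
      case (Inl p)
      then show ?thesis using Cons virt[of p] a by (auto simp: filled_hole_def simp del: set_concat)
    next
      case (Inr k)
      then have "k = 0" using hole a by simp
      then show ?thesis using Cons Inr fl by (simp add: filled_hole_def del: set_concat)
    qed
  qed simp
  show ?thesis unfolding classical_part_def fill_eq erase_def map_map o_def
    by (intro map_cong refl word) auto
qed

lemma homotopic_reidemeister:
  assumes "reidemeister_move D D'" "wf_code D" "wf_code D'"
  shows "homotopic (beaded (classical_part D)) (beaded (classical_part D')) \<and> length D = length D'"
  using assms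
proof (cases rule: reidemeister_move.cases)
  case (R1 a b l m c)
  have cl: "level p \<noteq> Virtual"
    if "p \<in> set (concat [[]]) \<union> set (concat [[Passage c a l, Passage c b m]])" for p
    using that R1(2) by (auto simp: doubleton_eq_iff)
  obtain E where E: "has_holes 1 E" "classical_part D = fill [[]] E"
    "classical_part D' = fill [[Passage c a l, Passage c b m]] E"
    "distinct (concat (fill [[]] E))" "distinct (concat (fill [[Passage c a l, Passage c b m]] E))"
    using local_move_classical[OF R1(3) assms(2,3) cl] by (metis One_nat_def length_Cons list.size(3))
  have ab: "Passage c b m = partner (Passage c a l)" "level (Passage c a l) \<noteq> Virtual"
    using R1(1,2) by (cases a; cases b; auto simp: doubleton_eq_iff)+
  have "length D = length D'" using E by (metis length_classical_part length_fill)
  then show ?thesis unfolding E(2,3) using homotopic_insert_R1[OF E(4) _ E(1) ab(2)] E(5) unfolding ab(1) by blast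
next
  case (R2 a b us c d)
  have cl: "level p \<noteq> Virtual"
    if "p \<in> set (concat [[], []]) \<union> set (concat [[Passage c a Over, Passage d b Over], us])" for p
    using that R2(2) by auto
  obtain E where E: "has_holes 2 E" "classical_part D = fill [[], []] E"
    "classical_part D' = fill [[Passage c a Over, Passage d b Over], us] E"
    "distinct (concat (fill [[], []] E))" "distinct (concat (fill [[Passage c a Over, Passage d b Over], us] E))"
    using local_move_classical[OF R2(3) assms(2,3) cl] by (metis numeral_2_eq_2 length_Cons list.size(3))
  have ab: "Passage c b Under = partner (Passage c a Over)" "Passage d a Under = partner (Passage d b Over)"
    "sign (Passage d b Over) \<longleftrightarrow> \<not> sign (Passage c a Over)"
    using R2(1) by (cases a; cases b; auto simp: sign_def)+
  have "length D = length D'" using E by (metis length_classical_part length_fill)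
  moreover have "homotopic (beaded (fill [[], []] E)) (beaded (fill [[Passage c a Over, Passage d b Over], us] E))"
    using R2(1,2) ab by (intro homotopic_insert_R2 E(1,4,5)) auto
  ultimately show ?thesis unfolding E(2,3) by blast
next
  case (R3 x y z e12 e13 e23 h)
  let ?tri = "triangle_arcs x y z e12 e13 e23"
  have classical: "level p \<noteq> Virtual" if "p \<in> set (concat (?tri h)) \<union> set (concat (?tri (\<not> h)))" for p
    using that by (auto simp: triangle_arcs_def arrange_def split: if_splits)
  have len: "length (?tri h) = 3" for h by (simp add: triangle_arcs_def)
  obtain E where E: "has_holes 3 E" "classical_part D = fill (?tri h) E" "classical_part D' = fill (?tri (\<not> h)) E"
    "distinct (concat (fill (?tri h) E))" "distinct (concat (fill (?tri (\<not> h)) E))"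
    using local_move_classical[OF R3 assms(2,3) classical] len by metis
  have E': "has_holes (length (?tri h)) E" using E(1) len by simp
  have pass: "p \<in> passages D" if "p \<in> set (?tri h ! k)" "k < 3" for p k
    using passages_fill[OF E', of k p] that len E(2) passages_classical_part[of D] by simp
  have set_arrange: "set (arrange b p q) = {p, q}" "distinct (arrange b p q) \<longleftrightarrow> p \<noteq> q" for b p q
    by (auto simp: arrange_def)
  have tri_nth: "?tri h ! 0 = arrange (h = e13) (Passage x (over_side e12) Over) (Passage y (over_side e13) Over)"
    "?tri h ! 1 = arrange (h = e23) (Passage x (under_side e12) Under) (Passage z (over_side e23) Over)"
    "?tri h ! 2 = arrange (h = (e12 = (e13 = e23))) (Passage y (under_side e13) Under) (Passage z (under_side e23) Under)"
    by (simp_all add: triangle_arcs_def)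
  \<comment> \<open>The names \<open>x\<close>, \<open>y\<close>, \<open>z\<close> are not assumed
    distinct in the move. They are, because a classical crossing has only one passage on each level,
    whereas the passages compared here are different entries of the code.\<close>
  have same: "p = q" if "p \<in> passages D" "q \<in> passages D" "crossing p = crossing q" "level p = level q" "level p \<noteq> Virtual" for p q
    using wf_code_unique[OF assms(2) that(1,2)] that(3-5) level_partner_neq by metis
  have 0: "Passage x (over_side e12) Over \<in> passages D" "Passage y (over_side e13) Over \<in> passages D"
    "Passage z (over_side e23) Over \<in> passages D" "Passage y (under_side e13) Under \<in> passages D"
    "Passage z (under_side e23) Under \<in> passages D"
    using pass[of _ 0] pass[of _ 1] pass[of _ 2] unfolding tri_nth set_arrange by auto
  have "x \<noteq> y"
    using same[OF 0(1,2)] distinct_hole[OF E(4) E', of 0] len unfolding tri_nth set_arrange by auto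
  moreover have "y \<noteq> z"
    using same[OF 0(4,5)] distinct_hole[OF E(4) E', of 2] len unfolding tri_nth set_arrange by auto
  moreover have "x \<noteq> z"
    using same[OF 0(1,3)] disjoint_holes[OF E(4) E', of 0 1] len unfolding tri_nth set_arrange by auto
  moreover have "length D = length D'" using E by (metis length_classical_part length_fill)
  ultimately show ?thesis unfolding E(2,3) using homotopic_triangle[OF E(4,5,1)] by blast
next
  case (detour E E' w w')
  have "length (erase C E) = length E" for C E by (simp add: erase_def)
  then have len: "length E = length E'" using detour(6) by metis
  have "classical_part D = classical_part D'"
    using classical_part_detour[OF detour(3), of w] classical_part_detour[OF detour(4), of w']
      detour assms(2,3) by simp
  then show ?thesis using homotopic_refl len detour(1,2) by simp
qed

section \<open>Elementary cobordisms\<close>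

definition letters :: "code \<Rightarrow> letter set" where
  "letters D = set (concat (beaded (classical_part D)))"

definition next_letter :: "code \<Rightarrow> letter \<Rightarrow> letter" where
  "next_letter D = succ (beaded (classical_part D))"

definition component :: "code \<Rightarrow> letter \<Rightarrow> nat" where
  "component D = word_index (beaded (classical_part D))"

abbreviation defect :: "code \<Rightarrow> labelling \<Rightarrow> labelling" where
  "defect D \<equiv> residue (letters D) (next_letter D)"

text \<open>
  The effect of a step on relations: \<open>f\<close> and \<open>u\<close> describe the rank one change at a saddle, \<open>g\<close> is the kernel
  vector created by a birth, \<open>h\<close> the left kernel vector lost at a death.  The last two clauses express
  that reductions modulo \<open>X\<close> of labellings, and of forms on residues, are constant along the traced surface.
\<close>

definition flow :: "code \<Rightarrow> event \<Rightarrow> (nat \<times> nat) set \<Rightarrow> code \<Rightarrow>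
    (labelling \<Rightarrow> labelling) \<Rightarrow> (labelling \<Rightarrow> labelling) \<Rightarrow> (labelling \<Rightarrow> real fps) \<Rightarrow> labelling \<Rightarrow>
    labelling \<Rightarrow> (labelling \<Rightarrow> real fps) \<Rightarrow> bool" where
  "flow D ev \<rho> D' Q P f u g h \<longleftrightarrow>
     (\<forall>l. linear_form (\<lambda>x. Q x l)) \<and> (\<forall>l. linear_form (\<lambda>r. P r l)) \<and> linear_form f \<and> linear_form h \<and>
     (\<forall>x. defect D' (Q x) = (\<lambda>l. P (defect D x) l + f x * u l)) \<and>
     defect D' g = (\<lambda>_. 0) \<and> (\<forall>x. h (defect D x) = 0) \<and>
     (ev \<noteq> Birth \<longrightarrow> g = (\<lambda>_. 0)) \<and> (ev \<noteq> Death \<longrightarrow> h = (\<lambda>_. 0)) \<and> (ev \<noteq> Saddle \<longrightarrow> f = (\<lambda>_. 0) \<and> u = (\<lambda>_. 0)) \<and>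
     (\<forall>x c a. (\<forall>l\<in>letters D. aug (x l) = c (component D l)) \<longrightarrow> f x = 0 \<longrightarrow>
        (\<exists>c'. (\<forall>l\<in>letters D'. aug (Q x l + a * g l) = c' (component D' l)) \<and>
           (\<forall>(i, i')\<in>\<rho>. c i = c' i') \<and> (ev = Birth \<longrightarrow> (\<exists>i<length D'. c' i = aug a)))) \<and>
     (\<forall>y c' e. linear_form y \<longrightarrow>
        (\<forall>r. aug (y r) = (\<Sum>l\<in>letters D'. c' (component D' l) * aug (r l))) \<longrightarrow> y u = 0 \<longrightarrow>
        (\<exists>c. (\<forall>r. aug (y (P r) + e * h r) = (\<Sum>l\<in>letters D. c (component D l) * aug (r l))) \<and>
           (\<forall>(i, i')\<in>\<rho>. c i = c' i') \<and> (ev = Death \<longrightarrow> (\<exists>i<length D. c i = aug e))))"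

text \<open>The components may be named by \<open>\<kappa>\<close> and \<open>\<kappa>'\<close> in
  the chain map, as is convenient for isotopies, which permute them. The function \<open>d\<close>
  on these names mediates between functions on the components of the two diagrams.\<close>

lemma flow_of_chain:
  assumes "chain (letters D) (next_letter D) \<kappa> (letters D') (next_letter D') \<kappa>'"
    and "\<And>c :: nat \<Rightarrow> real. \<exists>(d :: nat \<Rightarrow> real) (c' :: nat \<Rightarrow> real). (\<forall>l\<in>letters D. c (component D l) = d (\<kappa> l)) \<and>
      (\<forall>l\<in>letters D'. d (\<kappa>' l) = c' (component D' l)) \<and> (\<forall>(i, i')\<in>\<rho>. c i = c' i')"
    and "\<And>c' :: nat \<Rightarrow> real. \<exists>(d :: nat \<Rightarrow> real) (c :: nat \<Rightarrow> real). (\<forall>l\<in>letters D. c (component D l) = d (\<kappa> l)) \<and>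
      (\<forall>l\<in>letters D'. d (\<kappa>' l) = c' (component D' l)) \<and> (\<forall>(i, i')\<in>\<rho>. c i = c' i')"
  shows "\<exists>Q P f u g h. flow D Equivalence \<rho> D' Q P f u g h"
proof -
  obtain Q P where Q: "\<And>l. linear_form (\<lambda>x. Q x l)" and P: "\<And>l. linear_form (\<lambda>r. P r l)"
    and QP: "\<And>x. defect D' (Q x) = P (defect D x)"
    and augQ: "\<And>c x l. \<forall>l\<in>letters D. aug (x l) = c (\<kappa> l) \<Longrightarrow> l \<in> letters D' \<Longrightarrow> aug (Q x l) = c (\<kappa>' l)"
    and augP: "\<And>c r. (\<Sum>l\<in>letters D'. c (\<kappa>' l) * aug (P r l)) = (\<Sum>l\<in>letters D. c (\<kappa> l) * aug (r l))"
    using assms(1) by (rule chainE) blast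
  have zero: "linear_form (\<lambda>_. 0)" by (simp add: linear_form_def)
  have dz: "defect D' (\<lambda>_. 0) = (\<lambda>_. 0)"
    using linear_form_zero[OF linear_form_residue] by auto
  have X: "\<exists>c'. (\<forall>l\<in>letters D'. aug (Q x l) = c' (component D' l)) \<and> (\<forall>(i, i')\<in>\<rho>. c i = c' i')"
    if x: "\<forall>l\<in>letters D. aug (x l) = c (component D l)" for x c
  proof -
    obtain d c' where d: "\<forall>l\<in>letters D. c (component D l) = d (\<kappa> l)"
      "\<forall>l\<in>letters D'. d (\<kappa>' l) = c' (component D' l)" "\<forall>(i, i')\<in>\<rho>. c i = c' i'"
      using assms(2)[of c] by blast
    have "aug (Q x l) = d (\<kappa>' l)" if "l \<in> letters D'" for l using augQ[of x d l] x d(1) that by simp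
    then show ?thesis using d(2,3) by auto
  qed
  have Y: "\<exists>c. (\<forall>r. aug (y (P r)) = (\<Sum>l\<in>letters D. c (component D l) * aug (r l))) \<and> (\<forall>(i, i')\<in>\<rho>. c i = c' i')"
    if y: "\<forall>r. aug (y r) = (\<Sum>l\<in>letters D'. c' (component D' l) * aug (r l))" for y c'
  proof -
    obtain d c where d: "\<forall>l\<in>letters D. c (component D l) = d (\<kappa> l)"
      "\<forall>l\<in>letters D'. d (\<kappa>' l) = c' (component D' l)" "\<forall>(i, i')\<in>\<rho>. c i = c' i'"
      using assms(3)[of c'] by blast
    have "aug (y (P r)) = (\<Sum>l\<in>letters D. c (component D l) * aug (r l))" for r
    proof -
      have "aug (y (P r)) = (\<Sum>l\<in>letters D'. d (\<kappa>' l) * aug (P r l))" using y d(2) by simp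
      also have "\<dots> = (\<Sum>l\<in>letters D. d (\<kappa> l) * aug (r l))" by (rule augP)
      finally show ?thesis using d(1) by simp
    qed
    then show ?thesis using d(3) by blast
  qed
  have "flow D Equivalence \<rho> D' Q P (\<lambda>_. 0) (\<lambda>_. 0) (\<lambda>_. 0) (\<lambda>_. 0)"
    unfolding flow_def using Q P zero dz QP X Y by simp
  then show ?thesis by (intro exI)
qed

lemma chain_compose_label:
  assumes "chain L \<sigma> \<kappa> L' \<sigma>' \<kappa>'"
  shows "chain L \<sigma> (\<lambda>l. \<pi> (\<kappa> l)) L' \<sigma>' (\<lambda>l. \<pi> (\<kappa>' l))"
proof (rule chainE[OF assms], goal_cases)
  case (1 Q P)
  show ?case
  proof (rule chainI[of Q P])
    show "aug (Q x l) = c (\<pi> (\<kappa>' l))" if "\<forall>l\<in>L. aug (x l) = c (\<pi> (\<kappa> l))" "l \<in> L'"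
      for c :: "nat \<Rightarrow> real" and x l
      using 1(4)[of x "\<lambda>i. c (\<pi> i)"] that by simp
    show "(\<Sum>l\<in>L'. c (\<pi> (\<kappa>' l)) * aug (P r l)) = (\<Sum>l\<in>L. c (\<pi> (\<kappa> l)) * aug (r l))"
      for c :: "nat \<Rightarrow> real" and r
      using 1(5)[of "\<lambda>i. c (\<pi> i)"] by simp
  qed (use 1 in simp_all)
qed

lemma chain_relabel_inverse:
  assumes "bij_betw \<phi> L L'" "\<And>l. l \<in> L \<Longrightarrow> \<sigma> l \<in> L"
    and "\<And>l. l \<in> L \<Longrightarrow> \<sigma>' (\<phi> l) = \<phi> (\<sigma> l)" "\<And>l. l \<in> L \<Longrightarrow> \<kappa>' (\<phi> l) = \<kappa> l"
    and "\<And>l x. l \<in> L \<Longrightarrow> out (\<phi> l) x = out l (\<lambda>m. x (\<phi> m))"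
  shows "chain L' \<sigma>' \<kappa>' L \<sigma> \<kappa>"
proof (rule chainI[of "\<lambda>x l. x (\<phi> l)" "\<lambda>r l. r (\<phi> l)"])
  have img: "\<phi> ` L = L'" and inj: "inj_on \<phi> L" using assms(1) by (auto simp: bij_betw_def)
  show "residue L \<sigma> (\<lambda>l. x (\<phi> l)) l = residue L' \<sigma>' x (\<phi> l)" if "l \<in> L" for x l
    using that assms img by (auto simp: residue_def)
  show "aug (x (\<phi> l)) = c (\<kappa> l)" if "\<forall>l\<in>L'. aug (x l) = c (\<kappa>' l)" "l \<in> L"
    for c :: "nat \<Rightarrow> real" and x l
    using that assms(4) img by auto
  show "(\<Sum>l\<in>L. c (\<kappa> l) * aug (r (\<phi> l))) = (\<Sum>l\<in>L'. c (\<kappa>' l) * aug (r l))"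
    for c :: "nat \<Rightarrow> real" and r
    unfolding img[symmetric] sum.reindex[OF inj] using assms(4) by simp
qed (simp_all add: linear_form_def)

text \<open>Labels are carried forward along the inverse of \<open>\<phi>\<close>, which is under
  control only on \<open>L\<close>; hence the labels read at letters of \<open>L\<close> have to
  belong to \<open>L\<close>.\<close>

lemma chain_relabel:
  assumes "bij_betw \<phi> L L'" "\<And>l. l \<in> L \<Longrightarrow> \<sigma> l \<in> L"
    and "\<And>l. l \<in> L \<Longrightarrow> \<sigma>' (\<phi> l) = \<phi> (\<sigma> l)" "\<And>l. l \<in> L \<Longrightarrow> \<kappa>' (\<phi> l) = \<kappa> l"
    and "\<And>l x. l \<in> L \<Longrightarrow> out (\<phi> l) x = out l (\<lambda>m. x (\<phi> m))"
    and "\<And>l. l \<in> L \<Longrightarrow> deps l \<subseteq> L"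
  shows "chain L \<sigma> \<kappa> L' \<sigma>' \<kappa>'"
proof (rule chainI[of "\<lambda>x l. x (inv_into L \<phi> l)" "\<lambda>r l. r (inv_into L \<phi> l)"])
  have img: "\<phi> ` L = L'" and inj: "inj_on \<phi> L" using assms(1) by (auto simp: bij_betw_def)
  show "residue L' \<sigma>' (\<lambda>l. x (inv_into L \<phi> l)) l = residue L \<sigma> x (inv_into L \<phi> l)" if "l \<in> L'" for x l
  proof -
    obtain m where m: "m \<in> L" "l = \<phi> m" using \<open>l \<in> L'\<close> img by blast
    have "out m (\<lambda>k. x (inv_into L \<phi> (\<phi> k))) = out m x"
      using assms(6)[OF m(1)] inj by (intro out_cong) (auto simp: inv_into_f_f)
    then show ?thesis using m \<open>l \<in> L'\<close> assms(2,3,5) inj by (simp add: residue_def inv_into_f_f)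
  qed
  show "aug (x (inv_into L \<phi> l)) = c (\<kappa>' l)" if "\<forall>l\<in>L. aug (x l) = c (\<kappa> l)" "l \<in> L'"
    for c :: "nat \<Rightarrow> real" and x l
    using that assms(4) img inj by (auto simp: inv_into_f_f)
  show "(\<Sum>l\<in>L'. c (\<kappa>' l) * aug (r (inv_into L \<phi> l))) = (\<Sum>l\<in>L. c (\<kappa> l) * aug (r l))"
    for c :: "nat \<Rightarrow> real" and r
    unfolding img[symmetric] sum.reindex[OF inj] using assms(4) inj by (simp add: inv_into_f_f)
qed (simp_all add: linear_form_def)

lemma set_concat_nth: "set (concat W) = (\<Union>i<length W. set (W ! i))"
proof -
  have "set ` set W = (\<lambda>i. set (W ! i)) ` {..<length W}"
    unfolding set_conv_nth[of W] by blast
  then show ?thesis by simp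
qed

lemma passages_nth: "(\<Union>i<length C. set (C ! i)) = passages C"
  unfolding passages_def by (rule set_concat_nth[symmetric])

lemma letters_eq: "letters D = Inr ` {..<length D} \<union> Inl ` passages (classical_part D)"
proof -
  have "set (concat (beaded C)) = Inr ` {..<length C} \<union> Inl ` passages C" for C
  proof -
    have "set (concat (beaded C)) = (\<Union>i<length C. insert (Inr i) (Inl ` set (C ! i)))"
      by (simp add: beaded_def atLeast0LessThan)
    also have "\<dots> = Inr ` {..<length C} \<union> Inl ` (\<Union>i<length C. set (C ! i))" by blast
    also have "(\<Union>i<length C. set (C ! i)) = passages C" by (rule passages_nth)
    finally show ?thesis .
  qed
  then show ?thesis by (simp add: letters_def)
qed

lemma distinct_beaded:
  assumes "distinct (concat C)"
  shows "distinct (concat (beaded C))"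
proof (rule distinct_filterI[of isl])
  have "filter isl (concat (beaded C)) = concat (map (\<lambda>i. map Inl (C ! i)) [0..<length C])"
    by (simp add: beaded_def filter_concat_map o_def)
  also have "\<dots> = map Inl (concat C)"
    unfolding concat_map_nth[of "map Inl"] by (simp add: map_concat)
  finally show "distinct (filter isl (concat (beaded C)))"
    using assms by (simp add: distinct_map del: set_concat distinct_concat)
  have "filter (\<lambda>a. \<not> isl a) (concat (beaded C)) = concat (map (\<lambda>i. [Inr i]) [0..<length C])"
    by (simp add: beaded_def filter_concat_map o_def)
  then show "distinct (filter (\<lambda>a. \<not> isl a) (concat (beaded C)))"
    by (simp add: concat_map_singleton distinct_map)
qed

lemma finite_letters [simp]: "finite (letters D)"
  by (simp add: letters_def)

lemma
  assumes "wf_code D"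
  shows next_letter_in: "l \<in> letters D \<Longrightarrow> next_letter D l \<in> letters D"
    and component_less: "l \<in> letters D \<Longrightarrow> component D l < length D"
    and component_bead: "i < length D \<Longrightarrow> component D (Inr i) = i"
    and deps_letters: "l \<in> letters D \<Longrightarrow> deps l \<subseteq> letters D"
proof -
  note dist = distinct_beaded[OF distinct_classical_part[OF assms]]
  show "l \<in> letters D \<Longrightarrow> next_letter D l \<in> letters D"
    unfolding letters_def next_letter_def by (rule succ_in[OF dist])
  show "l \<in> letters D \<Longrightarrow> component D l < length D"
    using word_index_less[OF dist] unfolding letters_def component_def by simp
  show "i < length D \<Longrightarrow> component D (Inr i) = i"
    unfolding component_def by (rule word_index_eq[OF dist]) (simp_all add: beaded_def)
  show "l \<in> letters D \<Longrightarrow> deps l \<subseteq> letters D"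
    using wf_code_partner[OF assms] by (auto simp: letters_eq deps_def passages_classical_part split: if_splits)
qed

text \<open>Adding a sufficiently large multiple of the length to \<open>m\<close> makes it at least
  \<open>j\<close> without changing the rotation.\<close>

lemma rotate_rotate_back: "\<exists>m'. rotate m' (rotate j w) = rotate m w"
proof (cases "w = []")
  case False
  then have "1 \<le> length w" by (cases w) auto
  from mult_le_mono1[OF this, of j] have "j \<le> length w * j" by (simp only: mult_1)
  then have "j \<le> length w * j + m" by (rule trans_le_add1)
  then have "rotate (length w * j + m - j) (rotate j w) = rotate (length w * j + m) w"
    by (simp add: rotate_rotate)
  also have "\<dots> = rotate m w" by (metis mod_mult_self4 rotate_conv_mod)
  finally show ?thesis by blast
qed simp

lemma chain_relabel_words:
  assumes V: "distinct (concat V)" and W: "distinct (concat W)"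
    and \<pi>: "bij_betw \<pi> {..<length V} {..<length W}"
    and word: "\<And>i. i < length V \<Longrightarrow> \<exists>j. rotate j (map \<phi> (V ! i)) = W ! \<pi> i"
    and inj: "inj_on \<phi> (set (concat V))"
    and out: "\<And>l x. l \<in> set (concat V) \<Longrightarrow> out (\<phi> l) x = out l (\<lambda>m. x (\<phi> m))"
    and deps: "\<And>l. l \<in> set (concat V) \<Longrightarrow> deps l \<subseteq> set (concat V)"
  shows "chain (set (concat V)) (succ V) (\<lambda>l. \<pi> (word_index V l)) (set (concat W)) (succ W) (word_index W)"
    and "chain (set (concat W)) (succ W) (word_index W) (set (concat V)) (succ V) (\<lambda>l. \<pi> (word_index V l))"
proof -
  have in_word: "\<exists>i<length V. l \<in> set (V ! i)" if "l \<in> set (concat V)" for l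
    using that unfolding set_concat_nth by blast
  have \<pi>_len: "\<pi> i < length W" if "i < length V" for i using \<pi> that by (auto simp: bij_betw_def)
  have set_word: "set (W ! \<pi> i) = \<phi> ` set (V ! i)" if i: "i < length V" for i
  proof -
    obtain j where "rotate j (map \<phi> (V ! i)) = W ! \<pi> i" using word[OF i] by blast
    then show ?thesis by (metis set_rotate set_map)
  qed
  have "set (concat W) = (\<Union>j\<in>\<pi> ` {..<length V}. set (W ! j))"
    using \<pi> unfolding set_concat_nth by (simp add: bij_betw_def)
  also have "\<dots> = (\<Union>i<length V. \<phi> ` set (V ! i))" using set_word by simp
  also have "\<dots> = \<phi> ` set (concat V)" unfolding set_concat_nth by blast
  finally have bij: "bij_betw \<phi> (set (concat V)) (set (concat W))" using inj by (simp add: bij_betw_def)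
  have succ: "succ W (\<phi> l) = \<phi> (succ V l)" if l: "l \<in> set (concat V)" for l
  proof -
    obtain i where i: "i < length V" "l \<in> set (V ! i)" using in_word[OF l] by blast
    obtain w m v where w: "w \<in> set V" "w \<noteq> []" "rotate m w = l # v" by (rule aroundE[OF V l])
    have "l \<in> set w" using w(3) by (metis set_rotate list.set_intros(1))
    then have "w = V ! i" using word_eqI[OF V w(1) nth_mem[OF i(1)]] i(2) by blast
    then obtain j where j: "rotate j (map \<phi> w) = W ! \<pi> i" using word[OF i(1)] by blast
    obtain m' where "rotate m' (rotate j (map \<phi> w)) = rotate m (map \<phi> w)" using rotate_rotate_back by blast
    then have "rotate m' (W ! \<pi> i) = \<phi> l # map \<phi> v" unfolding j by (simp add: rotate_map w(3))
    then have "succ W (\<phi> l) = hd (map \<phi> v @ [\<phi> l])"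
      by (rule succ_eq[OF W nth_mem[OF \<pi>_len[OF i(1)]]])
    also have "\<dots> = \<phi> (succ V l)" using succ_eq[OF V w(1,3)] by (cases v) auto
    finally show ?thesis .
  qed
  have \<kappa>: "word_index W (\<phi> l) = \<pi> (word_index V l)" if l: "l \<in> set (concat V)" for l
  proof -
    obtain i where i: "i < length V" "l \<in> set (V ! i)" using in_word[OF l] by blast
    then have "\<phi> l \<in> set (W ! \<pi> i)" using set_word by simp
    then show ?thesis using word_index_eq[OF W \<pi>_len[OF i(1)]] word_index_eq[OF V i] by simp
  qed
  show "chain (set (concat V)) (succ V) (\<lambda>l. \<pi> (word_index V l)) (set (concat W)) (succ W) (word_index W)"
    by (rule chain_relabel[where \<phi> = \<phi>]) (use bij succ_in[OF V] succ \<kappa> out deps in blast)+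
  show "chain (set (concat W)) (succ W) (word_index W) (set (concat V)) (succ V) (\<lambda>l. \<pi> (word_index V l))"
    by (rule chain_relabel_inverse[where \<phi> = \<phi>]) (use bij succ_in[OF V] succ \<kappa> out in blast)+
qed

text \<open>The bead marks the base point, so a change of base point is no mere renaming. In the
  auxiliary words \<open>W\<close> every component has a second bead at the base point of
  \<open>D'\<close>. Deleting the second beads gives the words of \<open>D\<close>; deleting the
  first ones gives words \<open>V\<close> that agree with those of \<open>D'\<close> up to renaming
  and rotation.\<close>

lemma isotopy_chain:
  assumes "plane_isotopy \<pi> D D'" "wf_code D" "wf_code D'"
  shows "chain (letters D) (next_letter D) (\<lambda>l. \<pi> (component D l)) (letters D') (next_letter D') (component D')"
    and "chain (letters D') (next_letter D') (component D') (letters D) (next_letter D) (\<lambda>l. \<pi> (component D l))"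
proof -
  let ?C = "classical_part D" and ?C' = "classical_part D'" and ?n = "length D"
  have \<pi>: "bij_betw \<pi> {..<?n} {..<length D'}" using assms(1) by (simp add: plane_isotopy_def)
  obtain f where f: "inj_on f (crossings D)"
    "\<And>i. i < ?n \<Longrightarrow> \<exists>k. D' ! \<pi> i = rotate k (map (\<lambda>p. Passage (f (crossing p)) (side p) (level p)) (D ! i))"
    using assms(1) unfolding plane_isotopy_def by blast
  define \<psi> where "\<psi> p = Passage (f (crossing p)) (side p) (level p)" for p
  have "\<exists>k. ?C' ! \<pi> i = map \<psi> (drop k (?C ! i) @ take k (?C ! i))" if i: "i < ?n" for i
  proof -
    obtain k where k: "D' ! \<pi> i = rotate k (map \<psi> (D ! i))" using f(2)[OF i] unfolding \<psi>_def by blast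
    have "\<pi> i < length D'" using \<pi> i by (auto simp: bij_betw_def)
    then have "?C' ! \<pi> i = filter (\<lambda>p. level p \<noteq> Virtual) (rotate k (map \<psi> (D ! i)))"
      by (simp add: classical_part_def k)
    also obtain k' where "\<dots> = rotate k' (filter (\<lambda>p. level p \<noteq> Virtual) (map \<psi> (D ! i)))"
      using filter_rotate by blast
    also have "filter (\<lambda>p. level p \<noteq> Virtual) (map \<psi> (D ! i)) = map \<psi> (?C ! i)"
      using i by (simp add: classical_part_def filter_map o_def \<psi>_def)
    finally have "?C' ! \<pi> i = map \<psi> (drop (k' mod length (?C ! i)) (?C ! i) @ take (k' mod length (?C ! i)) (?C ! i))"
      by (simp add: rotate_drop_take drop_map take_map)
    then show ?thesis by blast
  qed
  then obtain k where k: "\<And>i. i < ?n \<Longrightarrow> ?C' ! \<pi> i = map \<psi> (drop (k i) (?C ! i) @ take (k i) (?C ! i))"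
    by metis
  define W where "W = map (\<lambda>i. Inr i # map Inl (take (k i) (?C ! i)) @ Inr (?n + i) # map Inl (drop (k i) (?C ! i))) [0..<?n]"
  define V where "V = map (\<lambda>i. map Inl (take (k i) (?C ! i)) @ Inr (?n + i) # map Inl (drop (k i) (?C ! i))) [0..<?n]"
  have sep: "filter (\<lambda>a. a \<notin> Inr ` B) (map Inl w :: letter list) = map Inl w" for B :: "nat set" and w
    by (rule filter_True) auto
  have WD: "map (filter (\<lambda>a. a \<notin> Inr ` {?n..<?n + ?n})) W = beaded ?C"
    by (auto simp: W_def beaded_def sep simp flip: map_append)
  have WV: "map (filter (\<lambda>a. a \<notin> Inr ` {..<?n})) W = V"
    by (auto simp: W_def V_def sep)
  have distW: "distinct (concat W)"
  proof (rule distinct_filterI[of "\<lambda>a. a \<notin> Inr ` {?n..<?n + ?n}"])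
    show "distinct (filter (\<lambda>a. a \<notin> Inr ` {?n..<?n + ?n}) (concat W))"
      unfolding filter_concat WD by (rule distinct_beaded[OF distinct_classical_part[OF assms(2)]])
    have "filter (\<lambda>a. a \<in> Inr ` {?n..<?n + ?n}) (map Inl w :: letter list) = []" for w
      by (rule filter_False) auto
    then have "filter (\<lambda>a. \<not> a \<notin> Inr ` {?n..<?n + ?n}) (concat W) = concat (map (\<lambda>i. [Inr (?n + i)]) [0..<?n])"
      unfolding W_def filter_concat_map by (intro arg_cong[of _ _ concat] map_cong) auto
    then show "distinct (filter (\<lambda>a. \<not> a \<notin> Inr ` {?n..<?n + ?n}) (concat W))"
      by (simp add: concat_map_singleton distinct_map inj_on_def)
  qed
  have "homotopic W (beaded ?C)" unfolding WD[symmetric]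
  proof (rule homotopic_delete_beads[OF _ distW])
    fix w assume "w \<in> set W" then show "\<exists>l\<in>set w. l \<notin> Inr ` {?n..<?n + ?n}" by (auto simp: W_def)
  qed simp
  moreover have "homotopic W V" unfolding WV[symmetric]
  proof (rule homotopic_delete_beads[OF _ distW])
    fix w assume "w \<in> set W" then show "\<exists>l\<in>set w. l \<notin> Inr ` {..<?n}" by (auto simp: W_def)
  qed simp
  ultimately have hom: "homotopic (beaded ?C) V" by (meson homotopic_sym homotopic_trans)
  have distV: "distinct (concat V)" unfolding WV[symmetric] by (rule distinct_concat_filter[OF distW])
  have distD': "distinct (concat (beaded ?C'))" by (rule distinct_beaded[OF distinct_classical_part[OF assms(3)]])
  \<comment> \<open>Passages are renamed by \<open>\<psi>\<close>; the second bead
    \<open>?n + i\<close> of component \<open>i\<close> becomes the bead of component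
    \<open>\<pi> i\<close> of \<open>D'\<close>.\<close>
  define \<phi> :: "letter \<Rightarrow> letter" where "\<phi> l = (case l of Inl p \<Rightarrow> Inl (\<psi> p) | Inr j \<Rightarrow> Inr (\<pi> (j - ?n)))" for l
  let ?L = "set (concat V)"
  have Vi: "i < ?n \<Longrightarrow> V ! i = map Inl (take (k i) (?C ! i)) @ Inr (?n + i) # map Inl (drop (k i) (?C ! i))" for i
    by (simp add: V_def)
  have lenV: "length V = ?n" by (simp add: V_def)
  have L: "?L = Inr ` {?n..<?n + ?n} \<union> Inl ` passages ?C"
  proof -
    have "set (V ! i) = insert (Inr (?n + i)) (Inl ` set (?C ! i))" if i: "i < ?n" for i
    proof -
      have "set (take (k i) (?C ! i)) \<union> set (drop (k i) (?C ! i)) = set (?C ! i)"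
        by (metis append_take_drop_id set_append)
      then show ?thesis unfolding Vi[OF i] by auto
    qed
    then have "?L = (\<Union>i<?n. insert (Inr (?n + i)) (Inl ` set (?C ! i)))"
      unfolding set_concat_nth lenV by simp
    also have "\<dots> = (\<lambda>i. Inr (?n + i)) ` {..<?n} \<union> Inl ` (\<Union>i<?n. set (?C ! i))" by auto
    also have "(\<Union>i<?n. set (?C ! i)) = passages ?C" using passages_nth[of ?C] by simp
    also have "(\<lambda>i. Inr (?n + i)) ` {..<?n} = Inr ` {?n..<?n + ?n}"
    proof -
      have "(\<lambda>i. ?n + i) ` {..<?n} = {?n..<?n + ?n}"
        by (simp add: lessThan_atLeast0 image_add_atLeastLessThan)
      then show ?thesis by (metis image_image)
    qed
    finally show ?thesis .
  qed
  have word: "\<exists>j. rotate j (map \<phi> (V ! i)) = beaded ?C' ! \<pi> i" if i: "i < length V" for i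
  proof -
    have i: "i < ?n" using i lenV by simp
    then have "\<pi> i < length D'" using \<pi> by (auto simp: bij_betw_def)
    then have "beaded ?C' ! \<pi> i = Inr (\<pi> i) # map Inl (?C' ! \<pi> i)" by (simp add: beaded_def)
    also have "\<dots> = (Inr (\<pi> i) # map (\<lambda>p. Inl (\<psi> p)) (drop (k i) (?C ! i))) @ map (\<lambda>p. Inl (\<psi> p)) (take (k i) (?C ! i))"
      by (simp add: k[OF i])
    also have "\<dots> = rotate (length (take (k i) (?C ! i))) (map \<phi> (V ! i))"
      using rotate_append[of "map (\<lambda>p. Inl (\<psi> p)) (take (k i) (?C ! i))"
          "Inr (\<pi> i) # map (\<lambda>p. Inl (\<psi> p)) (drop (k i) (?C ! i))"]
      unfolding Vi[OF i] by (simp add: \<phi>_def o_def)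
    finally show ?thesis by metis
  qed
  have inj: "inj_on \<phi> ?L"
  proof (rule inj_onI)
    fix a b assume ab: "a \<in> ?L" "b \<in> ?L" "\<phi> a = \<phi> b"
    show "a = b"
    proof (cases a)
      case (Inl p)
      then obtain q where q: "b = Inl q" "\<psi> p = \<psi> q" using ab(3) by (cases b) (auto simp: \<phi>_def)
      have "p \<in> passages ?C" "q \<in> passages ?C" using ab(1,2) Inl q(1) unfolding L by auto
      then have "crossing p \<in> crossings D" "crossing q \<in> crossings D"
        by (auto simp: crossings_def passages_classical_part)
      then have "crossing p = crossing q" using q(2) inj_onD[OF f(1)] by (simp add: \<psi>_def)
      then have "p = q" using q(2) by (cases p; cases q) (auto simp: \<psi>_def)
      then show ?thesis using Inl q(1) by simp
    next
      case (Inr i)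
      then obtain j where j: "b = Inr j" "\<pi> (i - ?n) = \<pi> (j - ?n)" using ab(3) by (cases b) (auto simp: \<phi>_def)
      have ij: "i \<in> {?n..<?n + ?n}" "j \<in> {?n..<?n + ?n}" using ab(1,2) Inr j(1) unfolding L by auto
      then have "i - ?n = j - ?n" using inj_onD[OF bij_betw_imp_inj_on[OF \<pi>] j(2)] by auto
      then show ?thesis using Inr j(1) ij by auto
    qed
  qed
  have out: "out (\<phi> l) x = out l (\<lambda>m. x (\<phi> m))" if "l \<in> ?L" for l x
  proof (cases l)
    case (Inl p)
    have "partner (\<psi> p) = \<psi> (partner p)" by (rule passage_cases[of p]) (auto simp: \<psi>_def)
    then show ?thesis using Inl by (simp add: \<phi>_def) (simp add: \<psi>_def sign_def)
  qed (simp add: \<phi>_def)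
  have deps: "deps l \<subseteq> ?L" if "l \<in> ?L" for l
    using that wf_code_partner[OF assms(2)] unfolding L
    by (auto simp: deps_def passages_classical_part split: if_splits)
  have \<pi>': "bij_betw \<pi> {..<length V} {..<length (beaded ?C')}" using \<pi> lenV by simp
  note relabel = chain_relabel_words[OF distV distD' \<pi>' word inj out deps, folded letters_def next_letter_def component_def]
  have hom': "chain (letters D) (next_letter D) (\<lambda>l. \<pi> (component D l)) ?L (succ V) (\<lambda>l. \<pi> (word_index V l))"
    "chain ?L (succ V) (\<lambda>l. \<pi> (word_index V l)) (letters D) (next_letter D) (\<lambda>l. \<pi> (component D l))"
    using hom unfolding homotopic_def letters_def next_letter_def component_def
    by (simp_all only: chain_compose_label)
  show "chain (letters D) (next_letter D) (\<lambda>l. \<pi> (component D l)) (letters D') (next_letter D') (component D')"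
    by (rule chain_trans[OF hom'(1)])
      (use relabel(1) in \<open>simp only: letters_def next_letter_def component_def\<close>)
  show "chain (letters D') (next_letter D') (component D') (letters D) (next_letter D) (\<lambda>l. \<pi> (component D l))"
    by (rule chain_trans[OF _ hom'(2)])
      (use relabel(2) in \<open>simp only: letters_def next_letter_def component_def\<close>)
qed

section \<open>Births and deaths\<close>

lemma succ_append:
  assumes "distinct (concat (U @ V))" "l \<in> set (concat U)"
  shows "succ (U @ V) l = succ U l"
proof -
  have "distinct (concat U)" using assms(1) by simp
  then obtain w k v where w: "w \<in> set U" "w \<noteq> []" "rotate k w = l # v" by (rule aroundE[OF _ assms(2)])
  then show ?thesis
    using succ_eq[OF assms(1), of w k l v] succ_eq[OF \<open>distinct (concat U)\<close> w(1,3)] by simp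
qed

lemma word_index_append:
  assumes "distinct (concat (U @ V))"
  shows "l \<in> set (concat U) \<Longrightarrow> word_index (U @ V) l = word_index U l"
    and "l \<in> set (concat V) \<Longrightarrow> word_index (U @ V) l = length U + word_index V l"
proof -
  have d: "distinct (concat U)" "distinct (concat V)" using assms by simp_all
  show "word_index (U @ V) l = word_index U l" if l: "l \<in> set (concat U)"
  proof -
    obtain i where "i < length U" "l \<in> set (U ! i)" "word_index U l = i" by (rule word_indexE[OF d(1) l])
    then show ?thesis using word_index_eq[OF assms, of i l] by (simp add: nth_append)
  qed
  show "word_index (U @ V) l = length U + word_index V l" if l: "l \<in> set (concat V)"
  proof -
    obtain i where "i < length V" "l \<in> set (V ! i)" "word_index V l = i" by (rule word_indexE[OF d(2) l])
    then show ?thesis using word_index_eq[OF assms, of "length U + i" l] by simp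
  qed
qed

lemma beaded_append: "beaded (C @ [w]) = beaded C @ [Inr (length C) # map Inl w]"
  by (auto simp: beaded_def nth_append)

lemma classical_part_append: "classical_part (D @ D') = classical_part D @ classical_part D'"
  by (simp add: classical_part_def)

lemma
  assumes "wf_code D"
  defines "n \<equiv> length D"
  shows letters_trivial: "letters (D @ [[]]) = insert (Inr n) (letters D)" "Inr n \<notin> letters D"
    and next_trivial: "next_letter (D @ [[]]) (Inr n) = Inr n"
      "l \<in> letters D \<Longrightarrow> next_letter (D @ [[]]) l = next_letter D l"
    and component_trivial: "component (D @ [[]]) (Inr n) = n"
      "l \<in> letters D \<Longrightarrow> component (D @ [[]]) l = component D l"
proof -
  let ?B = "beaded (classical_part D)"
  have eq: "beaded (classical_part (D @ [[]])) = ?B @ [[Inr n]]"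
  proof -
    have "classical_part [[]] = [[]]" by (simp add: classical_part_def)
    then show ?thesis by (simp add: classical_part_append beaded_append n_def)
  qed
  show "letters (D @ [[]]) = insert (Inr n) (letters D)" "Inr n \<notin> letters D"
  proof -
    show "letters (D @ [[]]) = insert (Inr n) (letters D)" unfolding letters_def eq by simp
    show "Inr n \<notin> letters D" unfolding letters_eq n_def by auto
  qed
  have "distinct (concat (?B @ [[Inr n]]))"
    using distinct_beaded[OF distinct_classical_part[OF assms(1)]] \<open>Inr n \<notin> letters D\<close>
    by (simp add: letters_def)
  note d = this
  show "next_letter (D @ [[]]) (Inr n) = Inr n"
    unfolding next_letter_def eq using succ_last[OF d, of "[]"] by simp
  show "l \<in> letters D \<Longrightarrow> next_letter (D @ [[]]) l = next_letter D l"
    unfolding next_letter_def eq letters_def by (rule succ_append[OF d])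
  show "component (D @ [[]]) (Inr n) = n"
    unfolding component_def eq using word_index_eq[OF d, of n "Inr n"] by (simp add: n_def nth_append)
  show "l \<in> letters D \<Longrightarrow> component (D @ [[]]) l = component D l"
    unfolding component_def eq letters_def by (rule word_index_append(1)[OF d])
qed

lemma flow_birth:
  assumes "wf_code D"
  shows "\<exists>Q P f u g h. flow D Birth (Id_on {..<length D}) (D @ [[]]) Q P f u g h"
proof -
  let ?n = "length D" and ?D' = "D @ [[]]"
  note facts = letters_trivial[OF assms] next_trivial[OF assms] component_trivial[OF assms]
  define Q where "Q x = x(Inr ?n := 0)" for x :: labelling
  define P where "P r l = (if l \<in> letters D then r l else 0)" for r :: labelling and l
  \<comment> \<open>The new bead is its own successor and its relation is empty, so its label may be
    chosen freely.\<close>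
  define g :: labelling where "g = (\<lambda>_. 0)(Inr ?n := 1)"
  have out_same: "out l (x(Inr ?n := a)) = out l x" if "l \<in> letters D" for l x a
    using deps_letters[OF assms that] facts(2) by (intro out_cong) auto
  have neq: "next_letter D l \<noteq> Inr ?n" "l \<noteq> Inr ?n" "component D l \<noteq> ?n" if "l \<in> letters D" for l
    using next_letter_in[OF assms that] facts(2) that component_less[OF assms that] by auto
  have "linear_form (\<lambda>x. Q x l)" "linear_form (\<lambda>r. P r l)" for l
    by (auto simp: Q_def P_def linear_form_def)
  moreover have "defect ?D' (Q x) l = P (defect D x) l" for x l
    using neq[of l] facts by (auto simp: residue_def P_def Q_def out_same)
  moreover have "out l g = out l (\<lambda>_. 0)" if "l \<in> letters D" for l
    unfolding g_def by (rule out_same[OF that])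
  then have "defect ?D' g l = 0" for l
    using neq[of l] facts linear_form_zero[OF linear_form_out[of l]] by (auto simp: residue_def g_def)
  moreover have "\<exists>c'. (\<forall>l\<in>letters ?D'. aug (Q x l + a * g l) = c' (component ?D' l)) \<and>
      (\<forall>(i, i')\<in>Id_on {..<?n}. c i = c' i') \<and> (\<exists>i<length ?D'. c' i = aug a)"
    if x: "\<forall>l\<in>letters D. aug (x l) = c (component D l)" for x c a
  proof (intro exI[of _ "c(?n := aug a)"] conjI)
    show "\<forall>l\<in>letters ?D'. aug (Q x l + a * g l) = (c(?n := aug a)) (component ?D' l)"
      using x neq facts unfolding facts(1) by (auto simp: Q_def g_def)
  qed auto
  moreover have "\<exists>c. (\<forall>r. aug (y (P r)) = (\<Sum>l\<in>letters D. c (component D l) * aug (r l))) \<and>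
      (\<forall>(i, i')\<in>Id_on {..<?n}. c i = c' i')"
    if y: "\<forall>r. aug (y r) = (\<Sum>l\<in>letters ?D'. c' (component ?D' l) * aug (r l))" for y c'
  proof (intro exI[of _ c'] conjI allI)
    fix r
    show "aug (y (P r)) = (\<Sum>l\<in>letters D. c' (component D l) * aug (r l))"
      unfolding y[rule_format] facts(1) using facts by (simp add: P_def)
  qed auto
  ultimately have "flow D Birth (Id_on {..<?n}) ?D' Q P (\<lambda>_. 0) (\<lambda>_. 0) g (\<lambda>_. 0)"
    unfolding flow_def by (auto simp: linear_form_def fun_eq_iff)
  then show ?thesis by (intro exI)
qed

lemma flow_death:
  assumes "wf_code D"
  shows "\<exists>Q P f u g h. flow (D @ [[]]) Death (Id_on {..<length D}) D Q P f u g h"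
proof -
  let ?n = "length D" and ?D' = "D @ [[]]"
  note facts = letters_trivial[OF assms] next_trivial[OF assms] component_trivial[OF assms]
  define P where "P r l = (if l \<in> letters D then r l else 0)" for r :: labelling and l
  \<comment> \<open>Dually, the residue at the bead of a crossingless component is always 0.\<close>
  define h where "h r = r (Inr ?n)" for r :: labelling
  have neq: "l \<noteq> Inr ?n" if "l \<in> letters D" for l using facts(2) that by auto
  have "linear_form (\<lambda>x. x l)" "linear_form (\<lambda>r. P r l)" "linear_form h" for l
    by (auto simp: h_def P_def linear_form_def)
  moreover have "defect D x l = P (defect ?D' x) l" for x l
    using facts by (auto simp: residue_def P_def)
  moreover have "h (defect ?D' x) = 0" for x
    using facts by (simp add: residue_def h_def)
  moreover have "defect D (\<lambda>_. 0) = (\<lambda>_. 0)" using linear_form_zero[OF linear_form_residue] by auto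
  moreover have "\<exists>c'. (\<forall>l\<in>letters D. aug (x l) = c' (component D l)) \<and> (\<forall>(i, i')\<in>Id_on {..<?n}. c i = c' i')"
    if x: "\<forall>l\<in>letters ?D'. aug (x l) = c (component ?D' l)" for x c
    by (intro exI[of _ c]) (use x facts in auto)
  moreover have "\<exists>c. (\<forall>r. aug (y (P r) + e * h r) = (\<Sum>l\<in>letters ?D'. c (component ?D' l) * aug (r l))) \<and>
      (\<forall>(i, i')\<in>Id_on {..<?n}. c i = c' i') \<and> (\<exists>i<length ?D'. c i = aug e)"
    if y: "\<forall>r. aug (y r) = (\<Sum>l\<in>letters D. c' (component D l) * aug (r l))" for y c' e
  proof (intro exI[of _ "c'(?n := aug e)"] conjI allI)
    fix r
    have "(\<Sum>l\<in>letters D. c' (component D l) * aug (P r l)) =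
        (\<Sum>l\<in>letters D. (c'(?n := aug e)) (component ?D' l) * aug (r l))"
    proof (intro sum.cong refl)
      fix l assume "l \<in> letters D"
      then show "c' (component D l) * aug (P r l) = (c'(?n := aug e)) (component ?D' l) * aug (r l)"
        using component_less[OF assms, of l] facts by (simp add: P_def)
    qed
    then show "aug (y (P r) + e * h r) = (\<Sum>l\<in>letters ?D'. (c'(?n := aug e)) (component ?D' l) * aug (r l))"
      unfolding facts(1) using facts y by (simp add: h_def fun_upd_same del: fun_upd_apply)
  qed auto
  ultimately have "flow ?D' Death (Id_on {..<?n}) D (\<lambda>x. x) P (\<lambda>_. 0) (\<lambda>_. 0) (\<lambda>_. 0) h"
    unfolding flow_def by (auto simp: linear_form_def fun_eq_iff)
  then show ?thesis by (intro exI)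
qed

section \<open>Saddles\<close>

text \<open>Cutting the last word exchanges the successors of two letters, the last letters
  \<open>a\<close> and \<open>b\<close> of its halves, and nothing else; hence a saddle changes only
  two relations.\<close>

lemma
  fixes W :: "'a list list"
  assumes "distinct (concat (W @ [(m # u) @ m' # v]))"
  defines "joined \<equiv> W @ [(m # u) @ m' # v]" and "split \<equiv> W @ [m # u, m' # v]"
    and "a \<equiv> last (m # u)" and "b \<equiv> last (m' # v)"
  shows set_split_word: "set (concat split) = set (concat joined)"
    and last_split_word: "a \<in> set (concat joined)" "b \<in> set (concat joined)" "a \<noteq> b"
    and succ_joined: "succ joined a = m'" "succ joined b = m"
    and succ_split: "succ split a = m" "succ split b = m'"
    and succ_split_other: "l \<in> set (concat joined) \<Longrightarrow> l \<noteq> a \<Longrightarrow> l \<noteq> b \<Longrightarrow> succ split l = succ joined l"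
    and word_index_split: "word_index split a = length W" "word_index split b = Suc (length W)"
    and word_index_joined: "l \<in> set (concat joined) \<Longrightarrow>
      word_index joined l = word_index split l \<or> word_index joined l = length W \<and> word_index split l = Suc (length W)"
    and word_index_joined_split: "l \<in> set (concat joined) \<Longrightarrow> word_index joined l \<le> length W"
proof -
  have dj: "distinct (concat joined)" using assms(1) by (simp add: joined_def)
  have ds: "distinct (concat split)" using assms(1) by (simp add: split_def)
  show set: "set (concat split) = set (concat joined)" by (simp add: joined_def split_def)
  have ab: "a \<in> set (m # u)" "b \<in> set (m' # v)" unfolding a_def b_def by (rule last_in_set, simp)+
  then show "a \<in> set (concat joined)" "b \<in> set (concat joined)" by (auto simp: joined_def simp del: last.simps)
  show "a \<noteq> b" using ab assms(1) by auto
  have mu: "m # u = butlast (m # u) @ [a]" and mv: "m' # v = butlast (m' # v) @ [b]" by (simp_all add: a_def b_def)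
  have jw: "(m # u) @ m' # v \<in> set joined" and sw: "m # u \<in> set split" "m' # v \<in> set split"
    by (simp_all add: joined_def split_def)
  have "butlast (m # u) @ a # m' # v \<in> set joined" using jw mu by (metis append.assoc append_Cons append_Nil)
  then show "succ joined a = m'" by (rule succ_adjacent[OF dj])
  have "((m # u) @ butlast (m' # v)) @ [b] \<in> set joined" using jw mv by simp
  from succ_last[OF dj this] show "succ joined b = m" by simp
  have "butlast (m # u) @ [a] \<in> set split" using sw mu by simp
  from succ_last[OF ds this] show "succ split a = m" using mu by (metis list.sel(1))
  have "butlast (m' # v) @ [b] \<in> set split" using sw mv by simp
  from succ_last[OF ds this] show "succ split b = m'" using mv by (metis list.sel(1))
  show "succ split l = succ joined l" if l: "l \<in> set (concat joined)" "l \<noteq> a" "l \<noteq> b"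
  proof -
    have "l \<in> set (concat W) \<or> l \<in> set (m # u) \<or> l \<in> set (m' # v)" using l(1) by (auto simp: joined_def)
    then show ?thesis
    proof (elim disjE)
      assume "l \<in> set (concat W)"
      then show ?thesis using succ_append ds dj unfolding joined_def split_def by metis
    next
      assume "l \<in> set (m # u)"
      then obtain c where "(c, l) \<in> set (zip (tl (m # u)) (m # u))" using link_into l(2) unfolding a_def by metis
      then obtain x y where xy: "m # u = x @ l # c # y" using zip_tl_split by metis
      have "x @ l # c # y \<in> set split" "x @ l # c # (y @ m' # v) \<in> set joined"
        using sw(1) jw unfolding xy by simp_all
      then show ?thesis using succ_adjacent[OF ds] succ_adjacent[OF dj] by metis
    next
      assume "l \<in> set (m' # v)"
      then obtain c where "(c, l) \<in> set (zip (tl (m' # v)) (m' # v))" using link_into l(3) unfolding b_def by metis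
      then obtain x y where xy: "m' # v = x @ l # c # y" using zip_tl_split by metis
      have "x @ l # c # y \<in> set split" "((m # u) @ x) @ l # c # y \<in> set joined"
        using sw(2) jw unfolding xy by simp_all
      then show ?thesis using succ_adjacent[OF ds] succ_adjacent[OF dj] by metis
    qed
  qed
  have cs: "l \<in> set (m # u) \<Longrightarrow> word_index split l = length W" "l \<in> set (m' # v) \<Longrightarrow> word_index split l = Suc (length W)" for l
    by (rule word_index_eq[OF ds]; simp add: split_def nth_append)+
  then show "word_index split a = length W" "word_index split b = Suc (length W)" using ab by simp_all
  show "word_index joined l = word_index split l \<or> word_index joined l = length W \<and> word_index split l = Suc (length W)"
    "word_index joined l \<le> length W"
    if l: "l \<in> set (concat joined)"
  proof -
    have "l \<in> set (concat W) \<or> l \<in> set (m # u) \<or> l \<in> set (m' # v)" using l(1) by (auto simp: joined_def)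
    then show "word_index joined l = word_index split l \<or> word_index joined l = length W \<and> word_index split l = Suc (length W)"
    proof (elim disjE)
      assume "l \<in> set (concat W)"
      then have "word_index joined l = word_index W l" "word_index split l = word_index W l"
        unfolding joined_def split_def by (rule word_index_append(1)[rotated], use dj ds in \<open>simp add: joined_def split_def\<close>)+
      then show ?thesis by simp
    next
      assume "l \<in> set (m # u)"
      moreover from this have "word_index joined l = length W" by (intro word_index_eq[OF dj]) (auto simp: joined_def nth_append)
      ultimately show ?thesis using cs by simp
    next
      assume "l \<in> set (m' # v)"
      moreover from this have "word_index joined l = length W" by (intro word_index_eq[OF dj]) (auto simp: joined_def nth_append)
      ultimately show ?thesis using cs by simp
    qed
    show "word_index joined l \<le> length W" using word_index_less[OF dj l] by (simp add: joined_def)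
  qed
qed

text \<open>A bead is inserted in front of \<open>v\<close> into the joined word, so that both sides
  of the saddle have the same letters and their words differ only by the cut.\<close>

lemma saddle_words:
  fixes D u v
  defines "joined \<equiv> beaded (classical_part D) @
      [(Inr (length D) # map Inl (filter (\<lambda>p. level p \<noteq> Virtual) u)) @
       Inr (Suc (length D)) # map Inl (filter (\<lambda>p. level p \<noteq> Virtual) v)]"
  assumes "wf_code (D @ [u @ v])"
  shows "distinct (concat joined)" "homotopic joined (beaded (classical_part (D @ [u @ v])))"
    and "beaded (classical_part (D @ [u, v])) = beaded (classical_part D) @
      [Inr (length D) # map Inl (filter (\<lambda>p. level p \<noteq> Virtual) u),
       Inr (Suc (length D)) # map Inl (filter (\<lambda>p. level p \<noteq> Virtual) v)]"
proof -
  let ?m = "Inr (Suc (length D)) :: letter"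
  have "classical_part (D @ [u, v]) = (classical_part D @ [filter (\<lambda>p. level p \<noteq> Virtual) u]) @ [filter (\<lambda>p. level p \<noteq> Virtual) v]"
    by (simp add: classical_part_def)
  then show "beaded (classical_part (D @ [u, v])) = beaded (classical_part D) @
      [Inr (length D) # map Inl (filter (\<lambda>p. level p \<noteq> Virtual) u),
       Inr (Suc (length D)) # map Inl (filter (\<lambda>p. level p \<noteq> Virtual) v)]"
    by (simp only: beaded_append length_append length_classical_part) simp
  have cp: "classical_part (D @ [u @ v]) = classical_part D @ [filter (\<lambda>p. level p \<noteq> Virtual) (u @ v)]"
    by (simp add: classical_part_def)
  have sep: "filter (\<lambda>a. a \<noteq> ?m) (map Inl w) = map Inl w" for w by (rule filter_True) auto
  have "filter (\<lambda>a. a \<noteq> ?m) w = w" if "w \<in> set (beaded (classical_part D))" for w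
    using that by (intro filter_True) (auto simp: beaded_def)
  then have "map (filter (\<lambda>a. a \<noteq> ?m)) (beaded (classical_part D)) = beaded (classical_part D)"
    by (intro map_idI)
  then have del: "map (filter (\<lambda>a. a \<noteq> ?m)) joined = beaded (classical_part (D @ [u @ v]))"
    unfolding joined_def cp beaded_append by (simp add: sep)
  have notin: "?m \<notin> letters D" unfolding letters_eq by auto
  show dist: "distinct (concat joined)"
  proof (rule distinct_filterI[of "\<lambda>a. a \<noteq> ?m"])
    show "distinct (filter (\<lambda>a. a \<noteq> ?m) (concat joined))"
      unfolding filter_concat del by (rule distinct_beaded[OF distinct_classical_part[OF assms(2)]])
    have "filter (\<lambda>a. \<not> a \<noteq> ?m) (map Inl w) = []" for w by (rule filter_False) auto
    moreover have "filter (\<lambda>a. \<not> a \<noteq> ?m) (concat (beaded (classical_part D))) = []"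
      using notin unfolding letters_def by (intro filter_False) auto
    ultimately show "distinct (filter (\<lambda>a. \<not> a \<noteq> ?m) (concat joined))"
      unfolding joined_def by simp
  qed
  have "succ joined ?m \<noteq> ?m"
  proof
    assume "succ joined ?m = ?m"
    from singleton_word[OF dist _ _ this, of "last joined"] show False by (simp add: joined_def)
  qed
  then show "homotopic joined (beaded (classical_part (D @ [u @ v])))"
    unfolding del[symmetric] by (rule homotopic_delete_bead[OF dist])
qed

text \<open>For the splitting, the chain map to the joined word comes first and the rank one change
  afterwards. For the merging the change is undone first; therefore the form is \<open>- f\<close>
  there and the vector is \<open>P k\<close>, the image of \<open>k\<close> under the chain map that
  follows.\<close>

lemma flow_saddle:
  assumes "wf_code (D @ [u @ v])" "wf_code (D @ [u, v])"
  shows "\<exists>Q P f k g h. flow (D @ [u @ v]) Saddle (Id_on {..length D} \<union> {(length D, Suc (length D))})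
      (D @ [u, v]) Q P f k g h" (is ?split)
    and "\<exists>Q P f k g h. flow (D @ [u, v]) Saddle (Id_on {..length D} \<union> {(Suc (length D), length D)})
      (D @ [u @ v]) Q P f k g h" (is ?merge)
proof -
  let ?n = "length D" and ?S = "D @ [u @ v]" and ?T = "D @ [u, v]"
  let ?m = "Inr (length D) :: letter" and ?m' = "Inr (Suc (length D)) :: letter"
  let ?u = "map Inl (filter (\<lambda>p. level p \<noteq> Virtual) u) :: letter list"
  let ?v = "map Inl (filter (\<lambda>p. level p \<noteq> Virtual) v) :: letter list"
  define B where "B = beaded (classical_part D)"
  define J where "J = B @ [(?m # ?u) @ ?m' # ?v]"
  define L where "L = set (concat J)"
  define \<sigma> where "\<sigma> = succ J"
  define \<kappa> where "\<kappa> = word_index J"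
  define a where "a = last (?m # ?u)"
  define b where "b = last (?m' # ?v)"
  have lenB: "length B = ?n" by (simp add: B_def)
  note words = saddle_words[OF assms(1), folded B_def, folded J_def]
  note split = set_split_word last_split_word succ_joined succ_split succ_split_other word_index_split word_index_joined word_index_joined_split
  note split = split[OF words(1)[unfolded J_def], folded J_def words(3), folded a_def b_def, unfolded lenB]
  have T: "letters ?T = L" "next_letter ?T = succ (beaded (classical_part ?T))"
    "component ?T = word_index (beaded (classical_part ?T))"
    using split(1) by (simp_all only: letters_def next_letter_def component_def L_def)
  have chains: "chain L \<sigma> \<kappa> (letters ?S) (next_letter ?S) (component ?S)"
    "chain (letters ?S) (next_letter ?S) (component ?S) L \<sigma> \<kappa>"
    using words(2) unfolding homotopic_def letters_def next_letter_def component_def L_def \<sigma>_def \<kappa>_def by blast+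
  \<comment> \<open>The successors of \<open>a\<close> and \<open>b\<close> are interchanged between
    the two beads. So the residues change by the difference of the labels of the beads, at
    \<open>a\<close> and \<open>b\<close> with opposite signs.\<close>
  define f where "f x = x ?m - x ?m'" for x :: labelling
  define k :: labelling where "k = (\<lambda>_. 0)(a := 1, b := - 1)"
  have lin_f: "linear_form f" "linear_form (\<lambda>x. - f x)" by (auto simp: f_def linear_form_def algebra_simps)
  have ab: "a \<in> L" "b \<in> L" "a \<noteq> b" using split(2-4) by (simp_all only: L_def not_False_eq_True)
  have nT: "next_letter ?T a = ?m" "next_letter ?T b = ?m'" "\<And>l. l \<in> L \<Longrightarrow> l \<noteq> a \<Longrightarrow> l \<noteq> b \<Longrightarrow> next_letter ?T l = \<sigma> l"
    unfolding T(2) \<sigma>_def L_def by (fact split(7), fact split(8), fact split(9))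
  have nJ: "\<sigma> a = ?m'" "\<sigma> b = ?m" unfolding \<sigma>_def by (fact split(5), fact split(6))
  have \<kappa>T: "component ?T a = ?n" "component ?T b = Suc ?n"
    "\<And>l. l \<in> L \<Longrightarrow> \<kappa> l = component ?T l \<or> \<kappa> l = ?n \<and> component ?T l = Suc ?n"
    "\<And>l. l \<in> L \<Longrightarrow> \<kappa> l \<le> ?n"
    unfolding T(3) \<kappa>_def L_def by (fact split(10), fact split(11), fact split(12), fact split(13))
  have defect: "defect ?T x l = residue L \<sigma> x l + f x * k l" for x l
    using nT nJ ab unfolding T(1) by (auto simp: residue_def f_def k_def)
  have finL: "finite L" by (simp add: L_def)
  have sum_k: "(\<Sum>l\<in>L. c (component ?T l) * aug (k l)) = c ?n - c (Suc ?n)" for c :: "nat \<Rightarrow> real"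
  proof -
    have "(\<Sum>l\<in>L. c (component ?T l) * aug (k l)) =
        (\<Sum>l\<in>L. (if l = a then c ?n else 0) - (if l = b then c (Suc ?n) else 0))"
      using \<kappa>T ab by (intro sum.cong) (auto simp: k_def)
    then show ?thesis using ab finL by (simp add: sum_subtractf)
  qed
  have zero: "residue M \<tau> (\<lambda>_. 0) = (\<lambda>_. 0)" for M \<tau>
    using linear_form_zero[OF linear_form_residue] by auto
  have mem: "?m \<in> L" "?m' \<in> L" by (auto simp: L_def J_def)
  have \<kappa>m: "component ?T ?m = ?n" "component ?T ?m' = Suc ?n"
    using component_bead[OF assms(2)] by simp_all
  show ?split
  proof (rule chainE[OF chains(2)])
    fix Q P
    assume Q: "\<And>l. linear_form (\<lambda>x. Q x l)" and P: "\<And>l. linear_form (\<lambda>r. P r l)"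
      and QP: "\<And>x. residue L \<sigma> (Q x) = P (defect ?S x)"
      and augQ: "\<And>(c :: nat \<Rightarrow> real) x l. \<forall>l\<in>letters ?S. aug (x l) = c (component ?S l) \<Longrightarrow> l \<in> L \<Longrightarrow> aug (Q x l) = c (\<kappa> l)"
      and augP: "\<And>(c :: nat \<Rightarrow> real) r. (\<Sum>l\<in>L. c (\<kappa> l) * aug (P r l)) = (\<Sum>l\<in>letters ?S. c (component ?S l) * aug (r l))"
    have X: "\<exists>c'. (\<forall>l\<in>letters ?T. aug (Q x l) = c' (component ?T l)) \<and>
        (\<forall>(i, i')\<in>Id_on {..?n} \<union> {(?n, Suc ?n)}. c i = c' i')"
      if x: "\<forall>l\<in>letters ?S. aug (x l) = c (component ?S l)" for x and c :: "nat \<Rightarrow> real"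
    \<comment> \<open>Both halves inherit the value of the component that is cut.\<close>
    proof (intro exI[of _ "c(Suc ?n := c ?n)"] conjI ballI)
      fix l assume "l \<in> letters ?T"
      then have l: "l \<in> L" unfolding T(1) .
      then show "aug (Q x l) = (c(Suc ?n := c ?n)) (component ?T l)"
        using augQ[OF x l] \<kappa>T(3)[OF l] \<kappa>T(4)[OF l] by auto
    qed auto
    have Y: "\<exists>c. (\<forall>r. aug (y (P r)) = (\<Sum>l\<in>letters ?S. c (component ?S l) * aug (r l))) \<and>
        (\<forall>(i, i')\<in>Id_on {..?n} \<union> {(?n, Suc ?n)}. c i = c' i')"
      if y: "\<forall>r. aug (y r) = (\<Sum>l\<in>letters ?T. c' (component ?T l) * aug (r l))" "y k = 0"
      for y and c' :: "nat \<Rightarrow> real"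
    proof -
      \<comment> \<open>Modulo \<open>X\<close>, the value of \<open>y\<close> on \<open>k\<close>
        is the difference of its values on the two halves.\<close>
      have c': "c' ?n = c' (Suc ?n)" using y(1)[rule_format, of k] y(2) sum_k[of c'] unfolding T(1) by simp
      have "aug (y (P r)) = (\<Sum>l\<in>letters ?S. c' (component ?S l) * aug (r l))" for r
      proof -
        have "aug (y (P r)) = (\<Sum>l\<in>L. c' (\<kappa> l) * aug (P r l))"
          unfolding y(1)[rule_format] T(1)
        proof (intro sum.cong refl)
          fix l assume "l \<in> L"
          then show "c' (component ?T l) * aug (P r l) = c' (\<kappa> l) * aug (P r l)"
            using \<kappa>T(3)[of l] c' by auto
        qed
        then show ?thesis unfolding augP .
      qed
      then show ?thesis using c' by (intro exI[of _ c']) auto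
    qed
    have "linear_form (\<lambda>x. f (Q x))" by (rule linear_form_compose[OF lin_f(1) Q])
    moreover have "defect ?T (Q x) = (\<lambda>l. P (defect ?S x) l + f (Q x) * k l)" for x
      using defect QP by auto
    ultimately have "flow ?S Saddle (Id_on {..?n} \<union> {(?n, Suc ?n)}) ?T Q P (\<lambda>x. f (Q x)) k (\<lambda>_. 0) (\<lambda>_. 0)"
      unfolding flow_def using Q P zero X Y by (simp add: linear_form_def)
    then show ?split by (intro exI)
  qed
  show ?merge
  proof (rule chainE[OF chains(1)])
    fix Q P
    assume Q: "\<And>l. linear_form (\<lambda>x. Q x l)" and P: "\<And>l. linear_form (\<lambda>r. P r l)"
      and QP: "\<And>x. defect ?S (Q x) = P (residue L \<sigma> x)"
      and augQ: "\<And>(c :: nat \<Rightarrow> real) x l. \<forall>l\<in>L. aug (x l) = c (\<kappa> l) \<Longrightarrow> l \<in> letters ?S \<Longrightarrow> aug (Q x l) = c (component ?S l)"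
      and augP: "\<And>(c :: nat \<Rightarrow> real) r. (\<Sum>l\<in>letters ?S. c (component ?S l) * aug (P r l)) = (\<Sum>l\<in>L. c (\<kappa> l) * aug (r l))"
    have X: "\<exists>c'. (\<forall>l\<in>letters ?S. aug (Q x l) = c' (component ?S l)) \<and>
        (\<forall>(i, i')\<in>Id_on {..?n} \<union> {(Suc ?n, ?n)}. c i = c' i')"
      if x: "\<forall>l\<in>letters ?T. aug (x l) = c (component ?T l)" "- f x = 0" for x and c :: "nat \<Rightarrow> real"
    proof (intro exI[of _ c] conjI ballI)
      \<comment> \<open>That \<open>f\<close> vanishes on \<open>x\<close> means that the beads of
        both halves have the same label, so the reductions on the halves agree.\<close>
      have c: "c ?n = c (Suc ?n)"
        using x mem \<kappa>m unfolding T(1) by (metis f_def neg_0_equal_iff_equal eq_iff_diff_eq_0)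
      have "\<forall>l\<in>L. aug (x l) = c (\<kappa> l)"
      proof
        fix l assume l: "l \<in> L"
        then show "aug (x l) = c (\<kappa> l)" using x(1) \<kappa>T(3)[OF l] c unfolding T(1) by auto
      qed
      then show "aug (Q x l) = c (component ?S l)" if "l \<in> letters ?S" for l using augQ that by blast
      show "case i of (i, i') \<Rightarrow> c i = c i'" if "i \<in> Id_on {..?n} \<union> {(Suc ?n, ?n)}" for i
        using that c by auto
    qed
    have Y: "\<exists>c. (\<forall>r. aug (y (P r)) = (\<Sum>l\<in>letters ?T. c (component ?T l) * aug (r l))) \<and>
        (\<forall>(i, i')\<in>Id_on {..?n} \<union> {(Suc ?n, ?n)}. c i = c' i')"
      if y: "\<forall>r. aug (y r) = (\<Sum>l\<in>letters ?S. c' (component ?S l) * aug (r l))"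
      for y and c' :: "nat \<Rightarrow> real"
    proof (intro exI[of _ "c'(Suc ?n := c' ?n)"] conjI allI)
      fix r
      show "aug (y (P r)) = (\<Sum>l\<in>letters ?T. (c'(Suc ?n := c' ?n)) (component ?T l) * aug (r l))"
        unfolding y[rule_format] augP T(1)
      proof (intro sum.cong refl)
        fix l assume "l \<in> L"
        then show "c' (\<kappa> l) * aug (r l) = (c'(Suc ?n := c' ?n)) (component ?T l) * aug (r l)"
          using \<kappa>T(3)[of l] \<kappa>T(4)[of l] by auto
      qed
    qed auto
    have "defect ?S (Q x) = (\<lambda>l. P (defect ?T x) l + - f x * P k l)" for x
    proof -
      have "residue L \<sigma> x = (\<lambda>l. 1 * defect ?T x l + - f x * k l)" using defect by auto
      then have "P (residue L \<sigma> x) l = 1 * P (defect ?T x) l + - f x * P k l" for l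
        using P[of l] unfolding linear_form_def by metis
      then show ?thesis unfolding QP by auto
    qed
    then have "flow ?T Saddle (Id_on {..?n} \<union> {(Suc ?n, ?n)}) ?S Q P (\<lambda>x. - f x) (P k) (\<lambda>_. 0) (\<lambda>_. 0)"
      unfolding flow_def using Q P zero X Y lin_f(2) by (simp add: linear_form_def)
    then show ?merge by (intro exI)
  qed
qed

fun opposite :: "event \<Rightarrow> event" where
  "opposite Birth = Death"
| "opposite Death = Birth"
| "opposite ev = ev"

text \<open>The labelling is known at the final diagram of the concordance, so every step has to be
  traversed backwards: births and deaths change roles, and so do splittings and mergings.\<close>

lemma flow_reversed_step:
  assumes "cobordism_step D ev \<rho> D'" "wf_code D" "wf_code D'"
  shows "\<exists>Q P f u g h. flow D' (opposite ev) (\<rho>\<inverse>) D Q P f u g h"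
  using assms
proof (cases rule: cobordism_step.cases)
  case (isotopy \<pi>)
  have \<pi>: "bij_betw \<pi> {..<length D} {..<length D'}" using isotopy(3) by (simp add: plane_isotopy_def)
  have less: "component D l < length D" if "l \<in> letters D" for l using component_less[OF assms(2) that] .
  have \<rho>: "\<rho>\<inverse> = {(\<pi> i, i) |i. i < length D}" using isotopy(2) by auto
  have "\<exists>Q P f u g h. flow D' Equivalence (\<rho>\<inverse>) D Q P f u g h"
  proof (rule flow_of_chain[OF isotopy_chain(2)[OF isotopy(3) assms(2,3)]])
    fix c :: "nat \<Rightarrow> real"
    show "\<exists>d c'. (\<forall>l\<in>letters D'. c (component D' l) = d (component D' l)) \<and>
        (\<forall>l\<in>letters D. d (\<pi> (component D l)) = c' (component D l)) \<and> (\<forall>(i, i')\<in>\<rho>\<inverse>. c i = c' i')"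
      unfolding \<rho> by (rule exI[of _ c], rule exI[of _ "\<lambda>i. c (\<pi> i)"]) auto
  next
    fix c' :: "nat \<Rightarrow> real"
    \<comment> \<open>The components of \<open>D\<close> are renumbered by the inverse of
      \<open>\<pi>\<close>, which is bijective on the indices of the components.\<close>
    define d where "d j = c' (inv_into {..<length D} \<pi> j)" for j
    have "d (\<pi> i) = c' i" if "i < length D" for i
      using \<pi> that by (simp add: d_def bij_betw_def inv_into_f_f)
    then show "\<exists>d c. (\<forall>l\<in>letters D'. c (component D' l) = d (component D' l)) \<and>
        (\<forall>l\<in>letters D. d (\<pi> (component D l)) = c' (component D l)) \<and> (\<forall>(i, i')\<in>\<rho>\<inverse>. c i = c' i')"
      unfolding \<rho> using less by (intro exI[of _ d]) auto
  qed
  then show ?thesis using isotopy(1) by simp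
next
  case move
  have "homotopic (beaded (classical_part D)) (beaded (classical_part D'))"
    using homotopic_reidemeister[of D D'] homotopic_reidemeister[of D' D] move(3) assms(2,3) homotopic_sym by blast
  then have "chain (letters D') (next_letter D') (component D') (letters D) (next_letter D) (component D)"
    by (simp only: homotopic_def letters_def next_letter_def component_def)
  then have "\<exists>Q P f u g h. flow D' Equivalence (\<rho>\<inverse>) D Q P f u g h"
    by (rule flow_of_chain) (use move(2) in auto)
  then show ?thesis using move(1) by simp
next
  case birth
  then show ?thesis using flow_death[OF assms(2)] by simp
next
  case death
  then show ?thesis using flow_birth[OF assms(3)] by simp
next
  case (split E u v)
  have "\<rho>\<inverse> = Id_on {..length E} \<union> {(Suc (length E), length E)}" unfolding split(3) by auto
  then show ?thesis using flow_saddle(2)[of E u v] split(1,2,4) assms(2,3) by simp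
next
  case (merge E u v)
  have "\<rho>\<inverse> = Id_on {..length E} \<union> {(length E, Suc (length E))}" unfolding merge(3) by auto
  then show ?thesis using flow_saddle(1)[of E u v] merge(1,2,4) assms(2,3) by simp
qed

section \<open>Sequences of cobordisms\<close>

lemma linear_form_combination:
  "linear_form f \<Longrightarrow> f (\<lambda>l. a * x l + b * y l) = a * f x + b * f y"
  by (simp add: linear_form_def)

lemma linear_form_sum:
  assumes "linear_form F" "finite I"
  shows "F (\<lambda>l. \<Sum>i\<in>I. w i * x i l) = (\<Sum>i\<in>I. w i * F (x i))"
  using assms(2)
proof (induction I rule: finite_induct)
  case empty
  then show ?case using linear_form_zero[OF assms(1)] by simp
next
  case (insert i I)
  have "F (\<lambda>l. \<Sum>i\<in>insert i I. w i * x i l) = F (\<lambda>l. w i * x i l + 1 * (\<Sum>i\<in>I. w i * x i l))"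
    using insert.hyps by simp
  also have "\<dots> = w i * F (x i) + 1 * F (\<lambda>l. \<Sum>i\<in>I. w i * x i l)"
    by (rule linear_form_combination[OF assms(1)])
  finally show ?case using insert by simp
qed

text \<open>
  Prescribing the same nonzero reduction for all letters is no restriction for knots.
\<close>

definition colorable :: "code \<Rightarrow> bool" where
  "colorable D \<longleftrightarrow> (\<exists>x c. defect D x = (\<lambda>_. 0) \<and> c \<noteq> 0 \<and> (\<forall>l\<in>letters D. aug (x l) = c))"

lemma flowD:
  assumes "flow D ev \<rho> D' Q P f u g h"
  shows "linear_form (\<lambda>x. Q x l)" "linear_form (\<lambda>r. P r l)" "linear_form f" "linear_form h"
    and "defect D' (Q x) = (\<lambda>l. P (defect D x) l + f x * u l)"
    and "defect D' g = (\<lambda>_. 0)" "h (defect D x) = 0"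
    and "ev \<noteq> Birth \<Longrightarrow> g l = 0" "ev \<noteq> Death \<Longrightarrow> h r = 0" "ev \<noteq> Saddle \<Longrightarrow> f x = 0"
    and "ev \<noteq> Saddle \<Longrightarrow> u = (\<lambda>_. 0)"
    and "\<forall>l\<in>letters D. aug (x l) = c (component D l) \<Longrightarrow> f x = 0 \<Longrightarrow>
        \<exists>c'. (\<forall>l\<in>letters D'. aug (Q x l + a * g l) = c' (component D' l)) \<and>
           (\<forall>(i, i')\<in>\<rho>. c i = c' i') \<and> (ev = Birth \<longrightarrow> (\<exists>i<length D'. c' i = aug a))"
    and "linear_form y \<Longrightarrow> \<forall>r. aug (y r) = (\<Sum>l\<in>letters D'. c1 (component D' l) * aug (r l)) \<Longrightarrow> y u = 0 \<Longrightarrow>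
        \<exists>c. (\<forall>r. aug (y (P r) + e * h r) = (\<Sum>l\<in>letters D. c (component D l) * aug (r l))) \<and>
           (\<forall>(i, i')\<in>\<rho>. c i = c1 i') \<and> (ev = Death \<longrightarrow> (\<exists>i<length D. c i = aug e))"
  using assms unfolding flow_def by simp_all

lemma sum_delta_scale:
  fixes a :: "real fps"
  assumes "finite I" "j \<in> I"
  shows "(\<Sum>i\<in>I. w i * ((if j = i then 1 else 0) * a)) = w j * a"
proof -
  have "(\<Sum>i\<in>I. w i * ((if j = i then 1 else 0) * a)) = (\<Sum>i\<in>I. if j = i then w i * a else 0)"
    by (intro sum.cong) auto
  then show ?thesis using assms by simp
qed

text \<open>Connectedness enters in the form \<open>conn\<close>: a real function on the components
  of all the diagrams that is constant along the steps is constant. It is applied once to reduced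
  forms and once to reduced labellings.\<close>

theorem colorable_flow_sequence:
  fixes G :: "nat \<Rightarrow> code"
  assumes flow: "\<And>j. j < m \<Longrightarrow> \<exists>Q P f u g h. flow (G j) (ev j) (\<rho> j) (G (Suc j)) Q P f u g h"
    and count: "card {j. j < m \<and> ev j = Birth} + card {j. j < m \<and> ev j = Death} = card {j. j < m \<and> ev j = Saddle}"
    and conn: "\<And>(c :: nat \<Rightarrow> nat \<Rightarrow> real) j j' i i'.
      (\<And>j i i'. j < m \<Longrightarrow> (i, i') \<in> \<rho> j \<Longrightarrow> c j i = c (Suc j) i') \<Longrightarrow>
      j \<le> m \<Longrightarrow> j' \<le> m \<Longrightarrow> i < length (G j) \<Longrightarrow> i' < length (G j') \<Longrightarrow> c j i = c j' i'"
    and wf: "wf_code (G m)"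
    and ends: "0 < length (G 0)" "0 < length (G m)"
    and start: "colorable (G 0)"
  shows "colorable (G m)"
proof -
  have "\<forall>j. \<exists>Q P f u g h. j < m \<longrightarrow> flow (G j) (ev j) (\<rho> j) (G (Suc j)) Q P f u g h" using flow by blast
  then obtain Q P f u g h where
    fl: "\<And>j. j < m \<Longrightarrow> flow (G j) (ev j) (\<rho> j) (G (Suc j)) (Q j) (P j) (f j) (u j) (g j) (h j)"
    by metis
  obtain \<xi> c0 where \<xi>: "defect (G 0) \<xi> = (\<lambda>_. 0)" "c0 \<noteq> 0" "\<forall>l\<in>letters (G 0). aug (\<xi> l) = c0"
    using start unfolding colorable_def by blast
  \<comment> \<open>The labelling on level \<open>j\<close>: the given one with coefficient
    \<open>w 0\<close>, and the kernel vector of a birth in step \<open>j\<close> with coefficient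
    \<open>w (Suc j)\<close>. The index 0 is taken by the given labelling, whence the shift in
    \<open>I\<close>.\<close>
  define X where "X w = rec_nat (\<lambda>l. w 0 * \<xi> l) (\<lambda>j x l. Q j x l + w (Suc j) * g j l)" for w :: "nat \<Rightarrow> real fps"
  have X0: "X w 0 = (\<lambda>l. w 0 * \<xi> l)" and XS: "X w (Suc j) = (\<lambda>l. Q j (X w j) l + w (Suc j) * g j l)" for w j
    by (simp_all add: X_def)
  \<comment> \<open>Forms are transported downwards from the zero form at the upper end. The
    recursion counts steps below level \<open>m\<close>, and \<open>Y\<close> below translates this
    into levels; a death in step \<open>j\<close> contributes with coefficient
    \<open>e j\<close>.\<close>
  define Z where "Z e = rec_nat (\<lambda>_ :: labelling. 0) (\<lambda>k y r. y (P (m - Suc k) r) + e (m - Suc k) * h (m - Suc k) r)"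
    for e :: "nat \<Rightarrow> real fps"
  define Y where "Y e j = Z e (m - j)" for e j
  have Ym: "Y e m = (\<lambda>_. 0)" for e by (simp add: Y_def Z_def)
  have YS: "Y e j = (\<lambda>r. Y e (Suc j) (P j r) + e j * h j r)" if "j < m" for e j
  proof -
    have "m - j = Suc (m - Suc j)" "m - Suc (m - Suc j) = j" using that by auto
    then show ?thesis by (simp add: Y_def Z_def)
  qed
  have linY: "linear_form (Y e j)" if "j \<le> m" for e j
    using that
  proof (induction rule: inc_induct)
    case base
    then show ?case by (simp add: Ym linear_form_def)
  next
    case (step j)
    have "linear_form (\<lambda>r. Y e (Suc j) (P j r))"
      using step.IH flowD(2)[OF fl[OF step.hyps(2)]] by (rule linear_form_compose)
    then show ?case using flowD(4)[OF fl[OF step.hyps(2)]]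
      unfolding YS[OF step.hyps(2)] by (simp add: linear_form_def algebra_simps)
  qed
  define Births where "Births = {j. j < m \<and> ev j = Birth}"
  define I where "I = insert 0 (Suc ` Births)"
  define J where "J = {j. j < m \<and> ev j = Death}"
  define K where "K = {j. j < m \<and> ev j = Saddle}"
  have fin: "finite I" "finite J" "finite K" "finite Births" by (simp_all add: I_def J_def K_def Births_def)
  \<comment> \<open>There is one unknown for every birth and one more for the given labelling; thus
    \<open>card I + card J\<close> exceeds the number of saddles by one.\<close>
  have card: "card K < card I + card J"
  proof -
    have "card I = Suc (card Births)" using fin by (simp add: I_def card_image)
    then show ?thesis using count by (simp add: J_def K_def Births_def)
  qed
  define \<delta> :: "nat \<Rightarrow> nat \<Rightarrow> real fps" where "\<delta> i j = (if j = i then 1 else 0)" for i j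
  have X_lin: "X w j = (\<lambda>l. \<Sum>i\<in>I. w i * X (\<delta> i) j l)" if "j \<le> m" for w j
    using that
  proof (induction j)
    case 0
    show ?case unfolding X0 \<delta>_def using sum_delta_scale[OF fin(1), of 0 w] by (simp add: I_def)
  next
    case (Suc j)
    then have jm: "j < m" by simp
    have "w (Suc j) * g j l = (\<Sum>i\<in>I. w i * (\<delta> i (Suc j) * g j l))" for l
    proof (cases "ev j = Birth")
      case True
      then have "Suc j \<in> I" using jm by (simp add: I_def Births_def)
      then show ?thesis unfolding \<delta>_def by (rule sum_delta_scale[OF fin(1), symmetric])
    next
      case False
      then show ?thesis using flowD(8)[OF fl[OF jm]] by simp
    qed
    moreover have "Q j (X w j) l = (\<Sum>i\<in>I. w i * Q j (X (\<delta> i) j) l)" for l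
      using linear_form_sum[OF flowD(1)[OF fl[OF jm]] fin(1)] Suc by simp
    ultimately show ?case unfolding XS by (simp add: algebra_simps sum.distrib)
  qed
  have Y_lin: "Y e j r = (\<Sum>i\<in>J. e i * Y (\<delta> i) j r)" if "j \<le> m" for e j r
    using that
  proof (induction arbitrary: r rule: inc_induct)
    case base
    then show ?case by (simp add: Ym)
  next
    case (step j)
    have "e j * h j r = (\<Sum>i\<in>J. e i * (\<delta> i j * h j r))"
    proof (cases "ev j = Death")
      case True
      then have "j \<in> J" using step.hyps(2) by (simp add: J_def)
      then show ?thesis unfolding \<delta>_def by (rule sum_delta_scale[OF fin(2), symmetric])
    next
      case False
      then show ?thesis using flowD(9)[OF fl[OF step.hyps(2)]] by simp
    qed
    then show ?case unfolding YS[OF step.hyps(2)] step.IH by (simp add: algebra_simps sum.distrib)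
  qed
  have X_step: "defect (G (Suc j)) (X w (Suc j)) = (\<lambda>l. P j (defect (G j) (X w j)) l + f j (X w j) * u j l)"
    if j: "j < m" for w j
  proof
    fix l
    have "defect (G (Suc j)) (\<lambda>l. 1 * Q j (X w j) l + w (Suc j) * g j l) l =
        1 * defect (G (Suc j)) (Q j (X w j)) l + w (Suc j) * defect (G (Suc j)) (g j) l"
      by (rule linear_form_combination[OF linear_form_residue])
    then show "defect (G (Suc j)) (X w (Suc j)) l = P j (defect (G j) (X w j)) l + f j (X w j) * u j l"
      unfolding XS flowD(5,6)[OF fl[OF j]] by simp
  qed
  \<comment> \<open>A discrete summation by parts: transported forms and transported labellings are
    adjoint up to the rank one terms of the saddles. On level \<open>m\<close> the form is zero,
    which yields \<open>B A = 0\<close>.\<close>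
  have pairing: "Y e n (defect (G n) (X w n)) = (\<Sum>j<n. f j (X w j) * Y e (Suc j) (u j))" if "n \<le> m" for e w n
    using that
  proof (induction n)
    case 0
    have "defect (G 0) (X w 0) = (\<lambda>l. 0)"
      using linear_form_scale[OF linear_form_residue, of _ _ "w 0" \<xi>] \<xi>(1) unfolding X0 by (auto simp: fun_eq_iff)
    then show ?case using linear_form_zero[OF linY[of 0]] by simp
  next
    case (Suc n)
    then have n: "n < m" by simp
    have "Y e (Suc n) (\<lambda>l. 1 * P n (defect (G n) (X w n)) l + f n (X w n) * u n l) =
        1 * Y e (Suc n) (P n (defect (G n) (X w n))) + f n (X w n) * Y e (Suc n) (u n)"
      by (rule linear_form_combination[OF linY]) (use n in simp)
    then have "Y e (Suc n) (defect (G (Suc n)) (X w (Suc n))) =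
        Y e (Suc n) (P n (defect (G n) (X w n))) + f n (X w n) * Y e (Suc n) (u n)"
      unfolding X_step[OF n] by simp
    moreover have "Y e n (defect (G n) (X w n)) = Y e (Suc n) (P n (defect (G n) (X w n)))"
      unfolding YS[OF n] by (simp add: flowD(7)[OF fl[OF n]])
    ultimately show ?case using Suc by simp
  qed
  define A where "A k i = f k (X (\<delta> i) k)" for k i
  define B where "B j k = Y (\<delta> j) (Suc k) (u k)" for j k
  have complex: "(\<Sum>k\<in>K. B j k * A k i) = 0" for j i
  proof -
    have "0 = (\<Sum>k<m. f k (X (\<delta> i) k) * Y (\<delta> j) (Suc k) (u k))"
      using pairing[of m "\<delta> j" "\<delta> i"] by (simp add: Ym)
    also have "\<dots> = (\<Sum>k\<in>K. f k (X (\<delta> i) k) * Y (\<delta> j) (Suc k) (u k))"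
    proof (rule sum.mono_neutral_right)
      show "\<forall>k\<in>{..<m} - K. f k (X (\<delta> i) k) * Y (\<delta> j) (Suc k) (u k) = 0"
        using flowD(10)[OF fl] by (auto simp: K_def)
    qed (auto simp: K_def)
    finally show ?thesis by (simp add: A_def B_def mult.commute)
  qed
  have fX: "f k (X w k) = (\<Sum>i\<in>I. A k i * w i)" if "k < m" for k w
    using linear_form_sum[OF flowD(3)[OF fl[OF that]] fin(1)] X_lin[of k w] that
    by (simp add: A_def mult.commute)
  have independent: "\<forall>j\<in>J. e j = 0" if e: "\<forall>k\<in>K. (\<Sum>j\<in>J. e j * B j k) = 0" for e
  proof (rule ccontr)
    assume "\<not> ?thesis"
    \<comment> \<open>The relation survives the division by a power of \<open>X\<close>, as power
      series form a domain, and then some coefficient is nonzero modulo \<open>X\<close>.\<close>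
    then obtain n e' where e': "\<And>j. j \<in> J \<Longrightarrow> e j = fps_X ^ n * e' j" "\<exists>j\<in>J. aug (e' j) \<noteq> 0"
      using fps_primitive_scaling[OF fin(2), of e] by metis
    have Yu: "Y e' (Suc k) (u k) = 0" if "k < m" for k
    proof (cases "k \<in> K")
      case True
      have "0 = (\<Sum>j\<in>J. e j * B j k)" using e True by simp
      also have "\<dots> = fps_X ^ n * (\<Sum>j\<in>J. e' j * B j k)"
        using e'(1) by (simp add: sum_distrib_left mult.assoc)
      finally show ?thesis using Y_lin[of "Suc k" e' "u k"] that by (simp add: B_def)
    next
      case False
      then have "u k = (\<lambda>_. 0)" using flowD(11)[OF fl[OF that]] that by (simp add: K_def)
      then show ?thesis using linear_form_zero[OF linY[of "Suc k"]] that by simp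
    qed
    \<comment> \<open>Here \<open>c j i\<close> is the value of the reduced form of level
      \<open>j\<close> on component \<open>i\<close>. Levels are added downwards, starting with the
      zero form on level \<open>m\<close>; \<open>k\<close> is the number of steps treated so
      far.\<close>
    have "\<exists>c. c m = (\<lambda>_. 0) \<and>
        (\<forall>j. m - k \<le> j \<longrightarrow> j \<le> m \<longrightarrow> (\<forall>r. aug (Y e' j r) = (\<Sum>l\<in>letters (G j). c j (component (G j) l) * aug (r l)))) \<and>
        (\<forall>j. m - k \<le> j \<longrightarrow> j < m \<longrightarrow> (\<forall>(i, i')\<in>\<rho> j. c j i = c (Suc j) i') \<and>
          (ev j = Death \<longrightarrow> (\<exists>i<length (G j). c j i = aug (e' j))))" if "k \<le> m" for k
      using that
    proof (induction k)
      case 0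
      show ?case by (intro exI[of _ "\<lambda>_ _. 0"]) (auto simp: Ym)
    next
      case (Suc k)
      from Suc.IH[OF Suc_leD[OF Suc.prems]] obtain c where c': "c m = (\<lambda>_. 0)"
        "\<forall>j. m - k \<le> j \<longrightarrow> j \<le> m \<longrightarrow> (\<forall>r. aug (Y e' j r) = (\<Sum>l\<in>letters (G j). c j (component (G j) l) * aug (r l)))"
        "\<forall>j. m - k \<le> j \<longrightarrow> j < m \<longrightarrow> (\<forall>(i, i')\<in>\<rho> j. c j i = c (Suc j) i') \<and>
          (ev j = Death \<longrightarrow> (\<exists>i<length (G j). c j i = aug (e' j)))" by (elim exE conjE)
      note c = c'(1) c'(2)[THEN spec, THEN mp, THEN mp] c'(3)[THEN spec, THEN mp, THEN mp]
      define j where "j = m - Suc k"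
      have j: "j < m" "Suc j = m - k" "Suc j \<le> m" using Suc.prems by (auto simp: j_def)
      obtain d where d: "\<forall>r. aug (Y e' j r) = (\<Sum>l\<in>letters (G j). d (component (G j) l) * aug (r l))"
        "\<forall>(i, i')\<in>\<rho> j. d i = c (Suc j) i'" "ev j = Death \<longrightarrow> (\<exists>i<length (G j). d i = aug (e' j))"
        using flowD(13)[OF fl[OF j(1)] linY[OF j(3)] c(2)[of "Suc j"] Yu[OF j(1)], of "e' j"] j
        unfolding YS[OF j(1)] by auto
      have cases: "i = j \<or> m - k \<le> i" if "m - Suc k \<le> i" for i using that j by linarith
      show ?case
      proof (intro exI[of _ "c(j := d)"] conjI allI impI)
        show "(c(j := d)) m = (\<lambda>_. 0)" using c(1) j(1) by auto
        fix i assume i: "m - Suc k \<le> i"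
        show "aug (Y e' i r) = (\<Sum>l\<in>letters (G i). (c(j := d)) i (component (G i) l) * aug (r l))" if "i \<le> m" for r
          using cases[OF i] c(2)[of i] d(1) that j by auto
        show "\<forall>(a, b)\<in>\<rho> i. (c(j := d)) i a = (c(j := d)) (Suc i) b" if "i < m"
          using cases[OF i] c(3)[of i] d(2) that j by auto
        show "\<exists>a<length (G i). (c(j := d)) i a = aug (e' i)" if "i < m" "ev i = Death"
          using cases[OF i] c(3)[of i] d(3) that j by auto
      qed
    qed
    from this[of m] obtain c where c: "c m = (\<lambda>_. 0)"
        "\<And>j. j < m \<Longrightarrow> (\<forall>(i, i')\<in>\<rho> j. c j i = c (Suc j) i') \<and>
          (ev j = Death \<longrightarrow> (\<exists>i<length (G j). c j i = aug (e' j)))" by auto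
    obtain j where j: "j \<in> J" "aug (e' j) \<noteq> 0" using e'(2) by blast
    then obtain i where i: "j < m" "i < length (G j)" "c j i = aug (e' j)" using c(2)[of j] by (auto simp: J_def)
    have "c j i = c m 0"
      by (rule conn) (use c(2) i ends in auto)
    then show False using j i c(1) by simp
  qed
  have "\<exists>w. (\<exists>i\<in>I. w i \<noteq> 0) \<and> (\<forall>k\<in>K. (\<Sum>i\<in>I. A k i * w i) = 0)"
  proof (rule kernel_of_independent_rows_dependent[where A = A and B = B, OF fin(3,1,2) card])
    show "\<forall>j\<in>J. e j = 0" if "\<forall>k\<in>K. (\<Sum>j\<in>J. e j * B j k) = 0" for e
      using that by (rule independent)
  qed (rule complex)
  then obtain w where w: "\<exists>i\<in>I. w i \<noteq> 0" "\<forall>k\<in>K. (\<Sum>i\<in>I. A k i * w i) = 0"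
    by (elim exE conjE)
  obtain n w' where w': "\<And>i. i \<in> I \<Longrightarrow> w i = fps_X ^ n * w' i" "\<exists>i\<in>I. aug (w' i) \<noteq> 0"
    using fps_primitive_scaling[OF fin(1) w(1)] by metis
  \<comment> \<open>Division of \<open>w\<close> by a power of \<open>X\<close> keeps it in the
    kernel of \<open>A\<close>; steps other than saddles impose no condition.\<close>
  have fX0: "f k (X w' k) = 0" if k: "k < m" for k
  proof (cases "k \<in> K")
    case True
    have "0 = (\<Sum>i\<in>I. A k i * w i)" using w(2) True by simp
    also have "\<dots> = fps_X ^ n * (\<Sum>i\<in>I. A k i * w' i)"
      using w'(1) by (simp add: sum_distrib_left mult.left_commute)
    finally show ?thesis using fX[OF k] by simp
  next
    case False
    then show ?thesis using flowD(10)[OF fl[OF k]] k by (simp add: K_def)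
  qed
  have defect0: "defect (G j) (X w' j) = (\<lambda>_. 0)" if "j \<le> m" for j
    using that
  proof (induction j)
    case 0
    show ?case using linear_form_scale[OF linear_form_residue, of _ _ "w' 0" \<xi>] \<xi>(1) unfolding X0 by (auto simp: fun_eq_iff)
  next
    case (Suc j)
    then have j: "j < m" by simp
    then show ?case using X_step[OF j] Suc fX0[OF j] linear_form_zero[OF flowD(2)[OF fl[OF j]]] by simp
  qed
  \<comment> \<open>Now \<open>c j i\<close> is the reduction of the labelling on component
    \<open>i\<close> of level \<open>j\<close>. The induction runs upwards and records the value at
    the start and the value that every birth produces on some component.\<close>
  have "\<exists>c. c 0 = (\<lambda>_. aug (w' 0) * c0) \<and>
      (\<forall>j\<le>k. \<forall>l\<in>letters (G j). aug (X w' j l) = c j (component (G j) l)) \<and>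
      (\<forall>j<k. (\<forall>(i, i')\<in>\<rho> j. c j i = c (Suc j) i') \<and>
        (ev j = Birth \<longrightarrow> (\<exists>i<length (G (Suc j)). c (Suc j) i = aug (w' (Suc j)))))" if "k \<le> m" for k
    using that
  proof (induction k)
    case 0
    show ?case by (intro exI[of _ "\<lambda>_ _. aug (w' 0) * c0"]) (auto simp: X0 \<xi>(3))
  next
    case (Suc k)
    from Suc.IH[OF Suc_leD[OF Suc.prems]] obtain c where c': "c 0 = (\<lambda>_. aug (w' 0) * c0)"
      "\<forall>j\<le>k. \<forall>l\<in>letters (G j). aug (X w' j l) = c j (component (G j) l)"
      "\<forall>j<k. (\<forall>(i, i')\<in>\<rho> j. c j i = c (Suc j) i') \<and>
        (ev j = Birth \<longrightarrow> (\<exists>i<length (G (Suc j)). c (Suc j) i = aug (w' (Suc j))))" by (elim exE conjE)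
    note c = c'(1) c'(2)[THEN spec, THEN mp] c'(3)[THEN spec, THEN mp]
    have k: "k < m" using Suc.prems by simp
    obtain d where d: "\<forall>l\<in>letters (G (Suc k)). aug (X w' (Suc k) l) = d (component (G (Suc k)) l)"
      "\<forall>(i, i')\<in>\<rho> k. c k i = d i'" "ev k = Birth \<longrightarrow> (\<exists>i<length (G (Suc k)). d i = aug (w' (Suc k)))"
      using flowD(12)[OF fl[OF k] c(2)[of k] fX0[OF k], of "w' (Suc k)"] unfolding XS by auto
    show ?case
    proof (intro exI[of _ "c(Suc k := d)"] conjI allI impI)
      show "(c(Suc k := d)) 0 = (\<lambda>_. aug (w' 0) * c0)" using c(1) by simp
      show "\<forall>l\<in>letters (G j). aug (X w' j l) = (c(Suc k := d)) j (component (G j) l)" if "j \<le> Suc k" for j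
        using that c(2)[of j] d(1) by (cases "j = Suc k") auto
      show "\<forall>(i, i')\<in>\<rho> j. (c(Suc k := d)) j i = (c(Suc k := d)) (Suc j) i'" if "j < Suc k" for j
        using that c(3)[of j] d(2) by (cases "j = k") auto
      show "\<exists>i<length (G (Suc j)). (c(Suc k := d)) (Suc j) i = aug (w' (Suc j))" if "j < Suc k" "ev j = Birth" for j
        using that c(3)[of j] d(3) by (cases "j = k") auto
    qed
  qed
  from this[of m] obtain c where c: "c 0 = (\<lambda>_. aug (w' 0) * c0)"
      "\<And>l. l \<in> letters (G m) \<Longrightarrow> aug (X w' m l) = c m (component (G m) l)"
      "\<And>j. j < m \<Longrightarrow> (\<forall>(i, i')\<in>\<rho> j. c j i = c (Suc j) i') \<and>
        (ev j = Birth \<longrightarrow> (\<exists>i<length (G (Suc j)). c (Suc j) i = aug (w' (Suc j))))" by auto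
  have const: "c j i = c m 0" if "j \<le> m" "i < length (G j)" for j i
    by (rule conn) (use c(3) that ends in auto)
  \<comment> \<open>A coefficient that is nonzero modulo \<open>X\<close> shows up either on level
    0, multiplied by \<open>c0\<close>, or at a birth; the surface being connected, the same value
    is found at the upper end.\<close>
  have "c m 0 \<noteq> 0"
  proof -
    obtain i where i: "i \<in> I" "aug (w' i) \<noteq> 0" using w'(2) by blast
    show ?thesis
    proof (cases i)
      case 0
      have "aug (w' 0) * c0 = c m 0" using const[of 0 0] ends(1) unfolding c(1) by simp
      then show ?thesis using 0 i(2) \<xi>(2) by (metis mult_eq_0_iff)
    next
      case (Suc j)
      then have j: "j < m" "ev j = Birth" using i(1) by (auto simp: I_def Births_def)
      then obtain a where "a < length (G (Suc j))" "c (Suc j) a = aug (w' i)" using c(3) Suc by blast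
      then show ?thesis using const[of "Suc j" a] j i(2) by simp
    qed
  qed
  moreover have "aug (X w' m l) = c m 0" if "l \<in> letters (G m)" for l
    using c(2)[OF that] const[of m] component_less[OF wf that] by simp
  ultimately show ?thesis unfolding colorable_def using defect0[of m] by blast
qed

section \<open>Invariance of colorability under equivalence and concordance\<close>

lemma colorable_chain:
  assumes "chain (letters D) (next_letter D) \<kappa> (letters D') (next_letter D') \<kappa>'" "colorable D"
  shows "colorable D'"
proof (rule chainE[OF assms(1)])
  fix Q P
  assume P: "\<And>l. linear_form (\<lambda>r. P r l)" and QP: "\<And>x. defect D' (Q x) = P (defect D x)"
    and augQ: "\<And>(c :: nat \<Rightarrow> real) x l. \<forall>l\<in>letters D. aug (x l) = c (\<kappa> l) \<Longrightarrow> l \<in> letters D' \<Longrightarrow> aug (Q x l) = c (\<kappa>' l)"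
  obtain x c where x: "defect D x = (\<lambda>_. 0)" "c \<noteq> 0" "\<forall>l\<in>letters D. aug (x l) = c"
    using assms(2) unfolding colorable_def by blast
  have "defect D' (Q x) = (\<lambda>_. 0)" unfolding QP x(1) using linear_form_zero[OF P] by auto
  moreover have "aug (Q x l) = c" if "l \<in> letters D'" for l
    using augQ[of x "\<lambda>_. c" l] x(3) that by simp
  ultimately show ?thesis unfolding colorable_def using x(2) by blast
qed

lemma wf_code_diagram: "virtual_link_diagram D \<Longrightarrow> wf_code D"
  by (simp add: virtual_link_diagram_def)

lemma colorable_elementary:
  assumes "elementary_equivalence D D'"
  shows "colorable D \<longleftrightarrow> colorable D'" and "length D = length D'" and "wf_code D" "wf_code D'"
proof -
  show wf: "wf_code D" "wf_code D'"
    using assms wf_code_diagram by (auto simp: elementary_equivalence_def)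
  have cases: "(\<exists>\<pi>. plane_isotopy \<pi> D D') \<or> reidemeister_move D D'"
    using assms by (simp add: elementary_equivalence_def)
  have "(colorable D \<longleftrightarrow> colorable D') \<and> length D = length D'"
    using cases
  proof
    assume "\<exists>\<pi>. plane_isotopy \<pi> D D'"
    then obtain \<pi> where \<pi>: "plane_isotopy \<pi> D D'" by blast
    then have "bij_betw \<pi> {..<length D} {..<length D'}" by (simp add: plane_isotopy_def)
    then have "length D = length D'" using bij_betw_same_card by fastforce
    then show ?thesis
      using colorable_chain[OF isotopy_chain(1)[OF \<pi> wf]] colorable_chain[OF isotopy_chain(2)[OF \<pi> wf]] by blast
  next
    assume "reidemeister_move D D'"
    note hom = homotopic_reidemeister[OF this wf]
    then have "chain (letters D) (next_letter D) (component D) (letters D') (next_letter D') (component D')"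
      "chain (letters D') (next_letter D') (component D') (letters D) (next_letter D) (component D)"
      by (simp_all only: homotopic_def letters_def next_letter_def component_def)
    then show ?thesis using hom colorable_chain by blast
  qed
  then show "colorable D \<longleftrightarrow> colorable D'" "length D = length D'" by simp_all
qed

lemma colorable_equivalent:
  assumes "equivclp elementary_equivalence D D'" "wf_code D"
  shows "(colorable D \<longleftrightarrow> colorable D') \<and> length D = length D' \<and> wf_code D'"
  using assms(1)
proof (induction rule: equivclp_induct)
  case base
  then show ?case using assms(2) by simp
next
  case (step D1 D2)
  then show ?case using colorable_elementary[of D1 D2] colorable_elementary[of D2 D1] by metis
qed

lemma colorable_concordant:
  assumes "diagrams_concordant D D'" "colorable D'" "length D = 1" "length D' = 1"
  shows "colorable D"
proof -
  obtain m F ev \<rho> where F: "F 0 = D" "F m = D'" "\<forall>j\<le>m. virtual_link_diagram (F j)"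
    "\<forall>j<m. cobordism_step (F j) (ev j) (\<rho> j) (F (Suc j))"
    "card {j. j < m \<and> ev j = Birth} + card {j. j < m \<and> ev j = Death} = card {j. j < m \<and> ev j = Saddle}"
    "{(j, c). j \<le> m \<and> c < length (F j)} \<times> {(j, c). j \<le> m \<and> c < length (F j)} \<subseteq>
      ({((j, c), (Suc j, c')) | j c c'. j < m \<and> (c, c') \<in> \<rho> j} \<union>
       {((j, c), (Suc j, c')) | j c c'. j < m \<and> (c, c') \<in> \<rho> j}\<inverse>)\<^sup>*"
    using assms(1) unfolding diagrams_concordant_def Let_def by blast
  have wf: "wf_code (F j)" if "j \<le> m" for j using F(3) that wf_code_diagram by blast
  have reflect: "m - j = Suc (m - Suc j)" "m - Suc j < m" if "j < m" for j using that by auto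
  have opp: "card {j. j < m \<and> opposite (ev (m - Suc j)) = e} = card {j. j < m \<and> opposite (ev j) = e}" for e
  proof (rule bij_betw_same_card[of "\<lambda>j. m - Suc j"])
    show "bij_betw (\<lambda>j. m - Suc j) {j. j < m \<and> opposite (ev (m - Suc j)) = e} {j. j < m \<and> opposite (ev j) = e}"
      by (rule bij_betw_byWitness[of _ "\<lambda>j. m - Suc j"]) auto
  qed
  have opp_eq: "opposite e = Birth \<longleftrightarrow> e = Death" "opposite e = Death \<longleftrightarrow> e = Birth" "opposite e = Saddle \<longleftrightarrow> e = Saddle" for e
    by (cases e; simp)+
  \<comment> \<open>Level \<open>j\<close> of the reversed sequence is \<open>F (m - j)\<close>, and
    its step \<open>j\<close> is the reverse of step \<open>m - Suc j\<close>.\<close>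
  have "colorable (F (m - m))"
  proof (rule colorable_flow_sequence[where G = "\<lambda>j. F (m - j)" and ev = "\<lambda>j. opposite (ev (m - Suc j))"
        and \<rho> = "\<lambda>j. (\<rho> (m - Suc j))\<inverse>"])
    fix j assume j: "j < m"
    show "\<exists>Q P f u g h. flow (F (m - j)) (opposite (ev (m - Suc j))) ((\<rho> (m - Suc j))\<inverse>) (F (m - Suc j)) Q P f u g h"
      using flow_reversed_step[of "F (m - Suc j)" "ev (m - Suc j)" "\<rho> (m - Suc j)" "F (m - j)"] F(4) reflect[OF j]
        wf[of "m - j"] wf[of "m - Suc j"] by simp
  next
    show "card {j. j < m \<and> opposite (ev (m - Suc j)) = Birth} + card {j. j < m \<and> opposite (ev (m - Suc j)) = Death} =
        card {j. j < m \<and> opposite (ev (m - Suc j)) = Saddle}"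
      unfolding opp unfolding opp_eq using F(5) by (simp only: add.commute)
  next
    fix c :: "nat \<Rightarrow> nat \<Rightarrow> real" and j j' i i'
    assume c: "\<And>j i i'. j < m \<Longrightarrow> (i, i') \<in> (\<rho> (m - Suc j))\<inverse> \<Longrightarrow> c j i = c (Suc j) i'"
      and ij: "j \<le> m" "j' \<le> m" "i < length (F (m - j))" "i' < length (F (m - j'))"
    \<comment> \<open>In the original numbering of the levels, \<open>c\<close> becomes a function
      on the vertices of the graph of the surface that is constant along the edges.\<close>
    define d where "d = (\<lambda>(k, i). c (m - k) i)"
    let ?E = "{((j, c), (Suc j, c')) | j c c'. j < m \<and> (c, c') \<in> \<rho> j}"
    have edge: "d x = d y" if xy: "(x, y) \<in> ?E" for x y
    proof -
      obtain k a b where k: "x = (k, a)" "y = (Suc k, b)" "k < m" "(a, b) \<in> \<rho> k" using xy by blast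
      have "c (m - Suc k) b = c (Suc (m - Suc k)) a"
        by (rule c) (use k in auto)
      then show ?thesis using k reflect[OF k(3)] by (simp add: d_def)
    qed
    have "d x = d y" if "(x, y) \<in> (?E \<union> ?E\<inverse>)\<^sup>*" for x y
      using that
    proof (induction rule: rtrancl_induct)
      case (step y z)
      have "(y, z) \<in> ?E \<or> (z, y) \<in> ?E" using step.hyps(2) by (simp only: Un_iff converse_iff)
      then have "d y = d z" using edge[of y z] edge[of z y] by argo
      then show ?case using step.IH by simp
    qed simp
    moreover have "((m - j, i), (m - j', i')) \<in> {(j, c). j \<le> m \<and> c < length (F j)} \<times> {(j, c). j \<le> m \<and> c < length (F j)}"
      using ij by simp
    ultimately have "d (m - j, i) = d (m - j', i')" using F(6) by blast
    then show "c j i = c j' i'" using ij by (simp add: d_def)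
  next
    show "wf_code (F (m - m))" using wf[of 0] by simp
    show "0 < length (F (m - 0))" using F(2) assms(4) by simp
    show "0 < length (F (m - m))" using F(1) assms(3) by simp
    show "colorable (F (m - 0))" using F(2) assms(2) by simp
  qed
  then show ?thesis using F(1) by simp
qed

section \<open>The determinant\<close>

text \<open>\<open>F p\<close> is the number of the arc arriving at \<open>p\<close> and
  \<open>G p\<close> that of the arc leaving it. The predicate says that consecutive numbers match
  along the word, which begins on an arc numbered \<open>a\<close> and ends on one numbered
  \<open>b\<close>.\<close>

fun path :: "(passage \<Rightarrow> int) \<Rightarrow> (passage \<Rightarrow> int) \<Rightarrow> int \<Rightarrow> passage list \<Rightarrow> int \<Rightarrow> bool" where
  "path F G a [] b \<longleftrightarrow> a = b"
| "path F G a (p # w) b \<longleftrightarrow> F p = a \<and> path F G (G p) w b"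

text \<open>Passages that do not change the number can be skipped; this is applied to virtual
  crossings.\<close>

lemma path_filter:
  assumes "\<And>p. p \<in> set w \<Longrightarrow> \<not> P p \<Longrightarrow> F p = G p" "path F G a w b"
  shows "path F G a (filter P w) b"
  using assms by (induction w arbitrary: a) auto

lemma path_hd: "path F G a w b \<Longrightarrow> w \<noteq> [] \<Longrightarrow> F (hd w) = a"
  by (cases w) auto

lemma path_append: "path F G a (u @ v) b \<longleftrightarrow> (\<exists>c. path F G a u c \<and> path F G c v b)"
  by (induction u arbitrary: a) auto

lemma path_closed_word:
  assumes "\<And>j. j < length w \<Longrightarrow> G (w ! j) = F (w ! (Suc j mod length w))"
  shows "\<exists>a. path F G a w a"
proof (cases w)
  case (Cons p v)
  have "path F G (F (hd u)) u (G (last u))"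
    if "u \<noteq> []" "\<And>j. Suc j < length u \<Longrightarrow> G (u ! j) = F (u ! Suc j)" for u
    using that
  proof (induction u)
    case (Cons p u)
    show ?case
    proof (cases u)
      case (Cons q u')
      then show ?thesis using Cons.IH Cons.prems(2)[of 0] Cons.prems(2)[of "Suc j" for j] by auto
    qed simp
  qed simp
  from this[of w] have "path F G (F (hd w)) w (G (last w))"
    using assms Cons by (metis Suc_lessD list.discI mod_less)
  moreover have "G (last w) = F (hd w)"
  proof -
    have ne: "w \<noteq> []" using Cons by simp
    show ?thesis unfolding last_conv_nth[OF ne] hd_conv_nth[OF ne]
      using assms[of "length w - 1"] ne by simp
  qed
  ultimately show ?thesis by auto
qed simp

text \<open>Passing over changes the number by one, as does multiplication by
  \<open>over_unit\<close>. For the under strand of a positive crossing,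
  \<open>t^-1 s^k + (1 - s^-1 t^-1) s^(k+1) = s^(k+1)\<close>; at a negative one,
  \<open>t s^(k+1) + (1 - s t) s^k = s^k\<close>. So \<open>t\<close> drops out.\<close>

lemma passage_out_numbering:
  assumes "alexander_numbering D \<nu>" "wf_code D" "p \<in> passages D" "level p \<noteq> Virtual"
    and x: "\<And>p. x (Inl p) = fps_exp (real_of_int (\<nu> (Incoming p)))"
  shows "out (Inl p) x = fps_exp (real_of_int (\<nu> (Outgoing p)))"
proof -
  have q: "partner p \<in> passages D" by (rule wf_code_partner[OF assms(2,3)])
  have num: "\<nu> (Incoming l) = \<nu> (Outgoing r) \<and> \<nu> (Incoming r) = \<nu> (Outgoing l) \<and> \<nu> (Incoming l) = \<nu> (Incoming r) + 1"
    if "l \<in> passages D" "r \<in> passages D" "crossing l = crossing r" "side l = FromLeft" "side r = FromRight" "level l \<noteq> Virtual" for l r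
    using assms(1) that unfolding alexander_numbering_def by blast
  have e: "fps_exp a * fps_exp b = fps_exp (a + b)" for a b :: real by (simp add: fps_exp_add_mult)
  obtain c a l where p: "p = Passage c a l" by (cases p)
  consider "a = FromLeft" "l = Over" | "a = FromLeft" "l = Under" | "a = FromRight" "l = Over" | "a = FromRight" "l = Under"
    using assms(4) p by (cases a; cases l) auto
  then show ?thesis
  proof cases
    case 1
    then show ?thesis using num[OF assms(3) q] p
      by (simp add: sign_def over_unit_def x e)
  next
    case 2
    then show ?thesis using num[OF assms(3) q] p
      by (simp add: sign_def over_unit_def under_unit_def x e left_diff_distrib mult.assoc[symmetric])
  next
    case 3
    then show ?thesis using num[OF q assms(3)] p
      by (simp add: sign_def over_unit_def x e)
  next
    case 4
    then show ?thesis using num[OF q assms(3)] p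
      by (simp add: sign_def over_unit_def under_unit_def x e left_diff_distrib mult.assoc[symmetric])
  qed
qed

lemma letters_cases:
  assumes "l \<in> letters D"
  obtains i where "i < length D" "l \<in> set (Inr i # map Inl (classical_part D ! i))"
    "Inr i # map Inl (classical_part D ! i) \<in> set (beaded (classical_part D))"
  using assms unfolding letters_def by (auto simp: beaded_def)

lemma next_letter_cases:
  assumes "wf_code D" "i < length D" "classical_part D ! i = w"
  shows "next_letter D (Inr i) = (if w = [] then Inr i else Inl (hd w))"
    and "w = u @ p # q # v \<Longrightarrow> next_letter D (Inl p) = Inl q"
    and "w = u @ [p] \<Longrightarrow> next_letter D (Inl p) = Inr i"
proof -
  note dist = distinct_beaded[OF distinct_classical_part[OF assms(1)]]
  have word: "Inr i # map Inl w \<in> set (beaded (classical_part D))"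
    using assms(2,3) by (auto simp: beaded_def)
  show "next_letter D (Inr i) = (if w = [] then Inr i else Inl (hd w))"
    using succ_last[OF dist, of "[]" "Inr i"] succ_adjacent[OF dist, of "[]" "Inr i" "Inl (hd w)" "map Inl (tl w)"] word
    unfolding next_letter_def by (cases w) auto
  show "next_letter D (Inl p) = Inl q" if "w = u @ p # q # v"
    using succ_adjacent[OF dist, of "Inr i # map Inl u" "Inl p" "Inl q" "map Inl v"] word that
    unfolding next_letter_def by simp
  show "next_letter D (Inl p) = Inr i" if "w = u @ [p]"
    using succ_last[OF dist, of "Inr i # map Inl u" "Inl p"] word that
    unfolding next_letter_def by simp
qed

lemma colorable_numbering:
  assumes \<nu>: "alexander_numbering D \<nu>" and wf: "wf_code D"
  shows "colorable D"
proof -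
  let ?C = "classical_part D"
  define F where "F p = \<nu> (Incoming p)" for p
  define G where "G p = \<nu> (Outgoing p)" for p
  \<comment> \<open>A bead carries the label of the first classical passage behind it, and the label
    1 if there is none. Exponentials have constant term 1, so all reductions equal 1.\<close>
  define x :: labelling where "x l = (case l of Inl p \<Rightarrow> fps_exp (real_of_int (F p))
    | Inr i \<Rightarrow> if ?C ! i = [] then 1 else fps_exp (real_of_int (F (hd (?C ! i)))))" for l
  have path: "\<exists>a. path F G a (?C ! i) a" if i: "i < length D" for i
  proof -
    have mem: "p \<in> passages D" if "p \<in> set (D ! i)" for p
      using in_set_concatI[OF nth_mem[OF i] that] by (simp add: passages_def)
    have "G (D ! i ! j) = F (D ! i ! (Suc j mod length (D ! i)))" if "j < length (D ! i)" for j
    proof -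
      have "follows D (D ! i ! j) (D ! i ! (Suc j mod length (D ! i)))"
        unfolding follows_def using that nth_mem[OF i] by blast
      then have "(Outgoing (D ! i ! j), Incoming (D ! i ! (Suc j mod length (D ! i)))) \<in> edges D"
        unfolding edges_def by blast
      then show ?thesis using \<nu> unfolding alexander_numbering_def F_def G_def by blast
    qed
    then obtain a where "path F G a (D ! i) a" using path_closed_word by blast
    moreover have "F p = G p" if "p \<in> set (D ! i)" "\<not> level p \<noteq> Virtual" for p
      using \<nu> mem[OF that(1)] that(2) unfolding alexander_numbering_def F_def G_def by blast
    ultimately have "path F G a (filter (\<lambda>p. level p \<noteq> Virtual) (D ! i)) a" by (intro path_filter)
    then show ?thesis using i by (auto simp: classical_part_def)
  qed
  have out_x: "out (Inl p) x = fps_exp (real_of_int (G p))" if "p \<in> passages ?C" for p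
    unfolding G_def using that
    by (intro passage_out_numbering[OF \<nu> wf]) (auto simp: passages_classical_part x_def F_def)
  have "x (next_letter D l) = out l x" if l: "l \<in> letters D" for l
  proof -
    obtain i where i: "i < length D" "l \<in> set (Inr i # map Inl (?C ! i))" using l by (rule letters_cases)
    note nxt = next_letter_cases[OF wf i(1) refl]
    show ?thesis
    proof (cases "l = Inr i")
      case True
      then show ?thesis using nxt(1) by (simp add: x_def)
    next
      case False
      then obtain p where p: "l = Inl p" "p \<in> set (?C ! i)" using i(2) by auto
      obtain a where a: "path F G a (?C ! i) a" using path[OF i(1)] by blast
      obtain u v where uv: "?C ! i = u @ p # v" using split_list[OF p(2)] by blast
      have pass: "p \<in> passages ?C"
        using in_set_concatI[OF nth_mem p(2)] i(1) by (simp add: passages_def)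
      show ?thesis
      proof (cases v)
        case Nil
        have "F (hd (?C ! i)) = a" using path_hd[OF a] uv by simp
        moreover have "G p = a" using a unfolding uv Nil path_append by auto
        ultimately show ?thesis using nxt(3)[of u p] uv Nil out_x[OF pass] p(1) by (simp add: x_def)
      next
        case (Cons q v')
        have "G p = F q" using a unfolding uv Cons path_append by auto
        then show ?thesis using nxt(2)[of u p q v'] uv Cons out_x[OF pass] p(1) by (simp add: x_def)
      qed
    qed
  qed
  then have "defect D x = (\<lambda>_. 0)" by (auto simp: residue_def)
  moreover have "\<forall>l\<in>letters D. aug (x l) = 1" by (auto simp: x_def split: sum.split)
  ultimately show ?thesis unfolding colorable_def by (metis zero_neq_one)
qed

text \<open>This makes sliceness a special case of concordance to an almost classical knot; for the
  diagram without crossings all conditions are empty and all terms in Euler's formula are 0.\<close>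

lemma almost_classical_unknot: "almost_classical unknot"
proof -
  have empty: "passages [[]] = {}" by (simp add: passages_def)
  have "virtual_knot_diagram [[]]"
    by (simp add: virtual_knot_diagram_def virtual_link_diagram_def wf_code_def planar_def crossings_def
        empty edges_def follows_def faces_def pieces_def half_edges_def)
  then have "virtual_knot unknot" unfolding virtual_knot_def unknot_def by blast
  moreover have "[[]] \<in> unknot" by (simp add: unknot_def virtual_link_of_def)
  moreover have "alexander_numbering [[]] (\<lambda>_. 0)"
    by (simp add: alexander_numbering_def empty edges_def follows_def)
  ultimately show ?thesis unfolding almost_classical_def by blast
qed

lemma follows_succ:
  assumes "distinct (concat C)"
  shows "follows C p q \<longleftrightarrow> p \<in> passages C \<and> q = succ C p"
proof -
  have succ: "succ C (w ! j) = w ! (Suc j mod length w)" if "w \<in> set C" "j < length w" for w j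
  proof -
    have ne: "w \<noteq> []" using that(2) by auto
    then have "around C (w ! j) = rotate j w"
      using around_eq[OF assms that(1) ne, of j] that(2) by (simp add: hd_rotate_conv_nth)
    then have "succ C (w ! j) = hd (rotate (Suc j) w)" by (simp add: succ_def)
    then show ?thesis by (simp only: hd_rotate_conv_nth[OF ne])
  qed
  show ?thesis
  proof
    assume "follows C p q"
    then obtain w j where "w \<in> set C" "j < length w" "p = w ! j" "q = w ! (Suc j mod length w)"
      unfolding follows_def by blast
    then show "p \<in> passages C \<and> q = succ C p"
      using succ in_set_concatI[of w C p] by (simp add: passages_def)
  next
    assume pq: "p \<in> passages C \<and> q = succ C p"
    then obtain w where w: "w \<in> set C" "p \<in> set w" by (auto simp: passages_def)
    then obtain j where "j < length w" "p = w ! j" by (auto simp: in_set_conv_nth)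
    then show "follows C p q" unfolding follows_def using succ w(1) pq by blast
  qed
qed

text \<open>A bead passes its label on unchanged, so at the end of a word the bead can be skipped
  and the relation read off for the first passage.\<close>

lemma coloring_next_passage:
  assumes "wf_code D" "defect D x = (\<lambda>_. 0)" "p \<in> passages (classical_part D)"
  shows "x (Inl (succ (classical_part D) p)) = out (Inl p) x"
proof -
  let ?C = "classical_part D"
  note dist = distinct_classical_part[OF assms(1)]
  have col: "x (next_letter D l) = out l x" if "l \<in> letters D" for l
    using fun_cong[OF assms(2), of l] that by (simp add: residue_def)
  obtain i where i: "i < length ?C" "p \<in> set (?C ! i)"
    using assms(3) unfolding passages_nth[symmetric] by blast
  then have iD: "i < length D" by simp
  have mem: "Inl p \<in> letters D" "Inr i \<in> letters D" using assms(3) iD by (simp_all add: letters_eq)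
  note nxt = next_letter_cases[OF assms(1) iD refl]
  obtain u v where uv: "?C ! i = u @ p # v" using split_list[OF i(2)] by blast
  show ?thesis
  proof (cases v)
    case Nil
    have "succ ?C p = hd (?C ! i)" using succ_last[OF dist, of u p] nth_mem[OF i(1)] uv Nil by simp
    moreover have "x (Inl (hd (?C ! i))) = x (Inr i)" using col[OF mem(2)] nxt(1) uv by simp
    moreover have "x (Inr i) = out (Inl p) x" using col[OF mem(1)] nxt(3)[of u p] uv Nil by simp
    ultimately show ?thesis by simp
  next
    case (Cons q v')
    have "u @ p # q # v' \<in> set ?C" using nth_mem[OF i(1)] uv Cons by simp
    then have "succ ?C p = q" by (rule succ_adjacent[OF dist])
    then show ?thesis using col[OF mem(1)] nxt(2)[of u p q v'] uv Cons by simp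
  qed
qed

lemma diag_block_mat_index_two:
  assumes "\<And>B. B \<in> set Bs \<Longrightarrow> B \<in> carrier_mat 2 2" "i < 2 * length Bs" "j < 2 * length Bs"
  shows "diag_block_mat Bs $$ (i, j) =
    (if i div 2 = j div 2 then (Bs ! (i div 2)) $$ (i mod 2, j mod 2) else 0)"
  using assms
proof (induction Bs arbitrary: i j)
  case (Cons B Bs)
  have dims: "dim_row (diag_block_mat Bs) = 2 * length Bs" "dim_col (diag_block_mat Bs) = 2 * length Bs"
  proof -
    have d: "dim_row B' = 2" "dim_col B' = 2" if "B' \<in> set Bs" for B'
      using Cons.prems(1)[of B'] that by auto
    have "map dim_row Bs = replicate (length Bs) 2" "map dim_col Bs = replicate (length Bs) 2"
      using d by (auto intro!: replicate_eqI)
    then show "dim_row (diag_block_mat Bs) = 2 * length Bs" "dim_col (diag_block_mat Bs) = 2 * length Bs"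
      by (simp_all add: dim_diag_block_mat sum_list_replicate)
  qed
  have B: "dim_row B = 2" "dim_col B = 2" using Cons.prems(1)[of B] by auto
  have "diag_block_mat (B # Bs) $$ (i, j) =
      (if i < 2 then if j < 2 then B $$ (i, j) else 0 else if j < 2 then 0 else diag_block_mat Bs $$ (i - 2, j - 2))"
    using Cons.prems(2,3) by (simp add: Let_def dims B)
  also have "\<dots> = (if i div 2 = j div 2 then ((B # Bs) ! (i div 2)) $$ (i mod 2, j mod 2) else 0)"
  proof (cases "i < 2 \<or> j < 2")
    case True
    then show ?thesis by (auto simp: div_eq_0_iff)
  next
    case False
    then obtain i' j' where ij: "i = i' + 2" "j = j' + 2" by (metis le_add_diff_inverse2 not_less)
    have "diag_block_mat Bs $$ (i', j') =
        (if i' div 2 = j' div 2 then (Bs ! (i' div 2)) $$ (i' mod 2, j' mod 2) else 0)"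
      by (rule Cons.IH) (use Cons.prems ij in simp_all)
    then show ?thesis unfolding ij by simp
  qed
  finally show ?case .
qed simp

lemma specialize_monomial: "specialize (monomial a b) = fps_exp (of_int a + of_int b * sqrt 2)"
  by (simp add: monomial_def specialize_single weight_def)

lemma short_arc_cases:
  assumes "wf_code D" "distinct cs" "set cs = crossings (classical_part D)" "i < length cs"
  defines "c \<equiv> cs ! i"
  defines "po \<equiv> Passage c (over_side (positive D c)) Over"
    and "pu \<equiv> Passage c (under_side (positive D c)) Under"
  shows "po \<in> passages (classical_part D)" "pu \<in> passages (classical_part D)"
    "sign po = positive D c" "sign pu = positive D c" "partner pu = po"
    "{q \<in> passages (classical_part D). crossing q = c} = {po, pu}"
proof -
  have "c \<in> crossings (classical_part D)" using assms(3,4) nth_mem by (simp add: c_def flip: assms(3))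
  then obtain p where p: "p \<in> passages D" "level p \<noteq> Virtual" "crossing p = c"
    by (auto simp: crossings_def passages_classical_part)
  have eq: "{q \<in> passages D. crossing q = c} = {p, partner p}"
    using wf_code_same_crossing[OF assms(1) p(1)] p(3) by simp
  have "{p, partner p} = {po, pu}"
  proof -
    have pos: "positive D c \<longleftrightarrow> Passage c FromLeft Over \<in> {p, partner p}"
      unfolding positive_def eq[symmetric] by simp
    show ?thesis
      using p(2,3) pos by (cases p rule: passage_cases) (auto simp: po_def pu_def over_side_def under_side_def)
  qed
  then have *: "{q \<in> passages D. crossing q = c} = {po, pu}" using eq by simp
  then show "{q \<in> passages (classical_part D). crossing q = c} = {po, pu}"
  proof -
    have "{q \<in> passages (classical_part D). crossing q = c} = {q \<in> {q \<in> passages D. crossing q = c}. level q \<noteq> Virtual}"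
      unfolding passages_classical_part by blast
    also have "\<dots> = {po, pu}" unfolding * by (auto simp: po_def pu_def)
    finally show ?thesis .
  qed
  then show "po \<in> passages (classical_part D)" "pu \<in> passages (classical_part D)" by blast+
  show "sign po = positive D c" "sign pu = positive D c" "partner pu = po"
    by (auto simp: po_def pu_def sign_def over_side_def under_side_def)
qed

text \<open>The labels of the short arcs form a vector annihilated by the specialized matrix
  \<open>M - P\<close>: in each row, \<open>M\<close> computes the label leaving the crossing and
  \<open>P\<close> reads the label of the following arc. A nonzero kernel vector over a domain
  forces the determinant to vanish; specialization commutes with determinants and loses no
  polynomial.\<close>

theorem colorable_det:
  assumes wf: "wf_code D" and col: "colorable D"
    and cs: "cs \<noteq> []" "distinct cs" "set cs = crossings (classical_part D)"
  shows "det (crossing_matrix D cs - succession_matrix D cs) = 0"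
proof -
  let ?C = "classical_part D" and ?n = "2 * length cs"
  obtain x c where x: "defect D x = (\<lambda>_. 0)" "c \<noteq> 0" "\<forall>l\<in>letters D. aug (x l) = c"
    using col unfolding colorable_def by blast
  define arc where "arc = short_arc D cs"
  define po where "po i = Passage (cs ! i) (over_side (positive D (cs ! i))) Over" for i
  define pu where "pu i = Passage (cs ! i) (under_side (positive D (cs ! i))) Under" for i
  have arc: "arc j = (if positive D (cs ! (j div 2)) then (if even j then pu (j div 2) else po (j div 2))
      else (if even j then po (j div 2) else pu (j div 2)))" for j
    by (simp add: arc_def short_arc_def Let_def po_def pu_def)
  note cases = short_arc_cases[OF wf cs(2,3), folded po_def pu_def]
  have arc_in: "arc j \<in> passages ?C" if "j < ?n" for j
    using cases(1,2)[of "j div 2"] that by (auto simp: arc)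
  have arc_inj: "j = k" if jk: "j < ?n" "k < ?n" "arc j = arc k" for j k
  proof -
    have cr: "crossing (arc i) = cs ! (i div 2)" for i by (simp add: arc po_def pu_def)
    have "cs ! (j div 2) = cs ! (k div 2)" using cr jk(3) by metis
    then have div: "j div 2 = k div 2" using cs(2) jk(1,2) by (simp add: nth_eq_iff_index_eq)
    have "even j \<longleftrightarrow> even k" using jk(3) unfolding arc div by (auto simp: po_def pu_def split: if_splits)
    then have "j mod 2 = k mod 2" by presburger
    then show ?thesis using div by (metis div_mult_mod_eq)
  qed
  have arc_surj: "\<exists>j<?n. arc j = q" if q: "q \<in> passages ?C" for q
  proof -
    have "crossing q \<in> set cs" using q cs(3) by (simp add: crossings_def)
    then obtain i where i: "i < length cs" "cs ! i = crossing q" by (auto simp: in_set_conv_nth)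
    have "q \<in> {q \<in> passages ?C. crossing q = cs ! i}" using q i(2) by simp
    then have "q = po i \<or> q = pu i" unfolding cases(6)[OF i(1)] by blast
    moreover have "{arc (2 * i), arc (2 * i + 1)} = {po i, pu i}" by (auto simp: arc)
    ultimately have "q \<in> {arc (2 * i), arc (2 * i + 1)}" by blast
    moreover have "2 * i < ?n" "2 * i + 1 < ?n" using i(1) by auto
    ultimately show ?thesis by blast
  qed
  define N where "N = map_mat specialize (crossing_matrix D cs - succession_matrix D cs)"
  have blocks: "B \<in> carrier_mat 2 2" if "B \<in> set (map (\<lambda>c. if positive D c then M_plus else M_minus) cs)" for B
    using that by (auto simp: M_plus_def M_minus_def mat_of_rows_list_def)
  have cross_dim: "crossing_matrix D cs \<in> carrier_mat ?n ?n"
  proof -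
    have "map dim_row (map (\<lambda>c. if positive D c then M_plus else M_minus) cs) = replicate (length cs) 2"
      "map dim_col (map (\<lambda>c. if positive D c then M_plus else M_minus) cs) = replicate (length cs) 2"
      by (auto intro!: replicate_eqI simp: M_plus_def M_minus_def mat_of_rows_list_def)
    then show ?thesis unfolding crossing_matrix_def
      by (intro carrier_matI) (simp_all only: dim_diag_block_mat sum_list_replicate, simp_all)
  qed
  have succ_dim: "succession_matrix D cs \<in> carrier_mat ?n ?n" by (simp add: succession_matrix_def)
  have N: "N \<in> carrier_mat ?n ?n"
    using minus_carrier_mat[OF succ_dim, of "crossing_matrix D cs"] by (simp add: N_def)
  define v where "v = vec ?n (\<lambda>j. x (Inl (arc j)))"
  have row: "(\<Sum>j<?n. N $$ (i, j) * x (Inl (arc j))) = 0" if i: "i < ?n" for i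
  proof -
    define k where "k = i div 2"
    have k: "k < length cs" "2 * k < ?n" "2 * k + 1 < ?n" using i unfolding k_def by presburger+
    define B where "B = (if positive D (cs ! k) then M_plus else M_minus)"
    have cross: "crossing_matrix D cs $$ (i, j) = (if k = j div 2 then B $$ (i mod 2, j mod 2) else 0)" if "j < ?n" for j
    proof -
      let ?Bs = "map (\<lambda>c. if positive D c then M_plus else M_minus) cs"
      have "diag_block_mat ?Bs $$ (i, j) =
          (if i div 2 = j div 2 then (?Bs ! (i div 2)) $$ (i mod 2, j mod 2) else 0)"
        by (rule diag_block_mat_index_two[OF blocks]) (use i that in simp_all)
      then show ?thesis using k(1) by (simp add: crossing_matrix_def k_def B_def)
    qed
    have succ: "succession_matrix D cs $$ (i, j) = (if arc j = succ ?C (arc i) then 1 else 0)" if "j < ?n" for j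
      using i that arc_in[OF i] follows_succ[OF distinct_classical_part[OF wf]]
      by (simp add: succession_matrix_def arc_def)
    have N_entry: "N $$ (i, j) = specialize (crossing_matrix D cs $$ (i, j)) - specialize (succession_matrix D cs $$ (i, j))"
      if "j < ?n" for j
      using cross_dim succ_dim i that by (simp add: N_def specialize.hom_minus)
    \<comment> \<open>The short arcs enumerate the classical passages bijectively, so row
      \<open>i\<close> has exactly one entry 1, in the column of the arc that follows arc
      \<open>i\<close>.\<close>
    have "(\<Sum>j<?n. specialize (succession_matrix D cs $$ (i, j)) * x (Inl (arc j))) = out (Inl (arc i)) x"
    proof -
      have "succ ?C (arc i) \<in> passages ?C"
        using succ_in[OF distinct_classical_part[OF wf]] arc_in[OF i] by (simp add: passages_def)
      then obtain m where m: "m < ?n" "arc m = succ ?C (arc i)" using arc_surj by blast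
      have "(\<Sum>j<?n. specialize (succession_matrix D cs $$ (i, j)) * x (Inl (arc j))) =
          (\<Sum>j<?n. if j = m then x (Inl (arc m)) else 0)"
      proof (intro sum.cong refl)
        fix j assume "j \<in> {..<?n}"
        then have j: "j < ?n" by simp
        have "arc j = succ ?C (arc i) \<longleftrightarrow> j = m" using arc_inj[OF j m(1)] m(2) by auto
        then show "specialize (succession_matrix D cs $$ (i, j)) * x (Inl (arc j)) = (if j = m then x (Inl (arc m)) else 0)"
          unfolding succ[OF j] by simp
      qed
      also have "\<dots> = x (Inl (succ ?C (arc i)))" using m by simp
      finally show ?thesis unfolding coloring_next_passage[OF wf x(1) arc_in[OF i]] .
    qed
    \<comment> \<open>Only the two columns of the block of crossing \<open>k\<close> contribute;
      sign of the crossing and parity of \<open>i\<close> select the row of \<open>M_plus\<close> or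
      \<open>M_minus\<close> that defines \<open>out\<close>.\<close>
    moreover have "(\<Sum>j<?n. specialize (crossing_matrix D cs $$ (i, j)) * x (Inl (arc j))) = out (Inl (arc i)) x"
    proof -
      have "(\<Sum>j<?n. specialize (crossing_matrix D cs $$ (i, j)) * x (Inl (arc j))) =
          (\<Sum>j\<in>{2 * k, 2 * k + 1}. specialize (crossing_matrix D cs $$ (i, j)) * x (Inl (arc j)))"
      proof (rule sum.mono_neutral_right)
        show "\<forall>j\<in>{..<?n} - {2 * k, 2 * k + 1}. specialize (crossing_matrix D cs $$ (i, j)) * x (Inl (arc j)) = 0"
        proof
          fix j assume j: "j \<in> {..<?n} - {2 * k, 2 * k + 1}"
          then have "k \<noteq> j div 2" by auto
          then show "specialize (crossing_matrix D cs $$ (i, j)) * x (Inl (arc j)) = 0" using cross[of j] j by simp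
        qed
      qed (use k in auto)
      also have "\<dots> = specialize (B $$ (i mod 2, 0)) * x (Inl (arc (2 * k))) +
          specialize (B $$ (i mod 2, 1)) * x (Inl (arc (2 * k + 1)))"
        using cross[of "2 * k"] cross[of "2 * k + 1"] k by simp
      also have "\<dots> = out (Inl (arc i)) x"
      proof -
        have i2: "i = 2 * k \<or> i = 2 * k + 1" unfolding k_def by presburger
        have out_po: "out (Inl (po k)) x = over_unit (positive D (cs ! k)) * x (Inl (po k))"
          using cases(3)[OF k(1)] by (simp add: po_def)
        have out_pu: "out (Inl (pu k)) x = under_unit (positive D (cs ! k)) * x (Inl (pu k)) +
            (1 - over_unit (positive D (cs ! k)) * under_unit (positive D (cs ! k))) * x (Inl (po k))"
          using cases(4,5)[OF k(1)] by (simp add: pu_def)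
        have units: "specialize (monomial 0 (-1)) = under_unit True" "specialize (monomial (-1) 0) = over_unit True"
          "specialize (monomial 1 0) = over_unit False" "specialize (monomial 0 1) = under_unit False"
          "specialize (monomial (-1) (-1)) = over_unit True * under_unit True"
          "specialize (monomial 1 1) = over_unit False * under_unit False"
          by (simp_all add: specialize_monomial over_unit_def under_unit_def fps_exp_add_mult[symmetric])
        show ?thesis using i2
          by (cases "positive D (cs ! k)")
            (auto simp: arc out_po out_pu B_def M_plus_def M_minus_def mat_of_rows_list_def units
              specialize.hom_minus simp del: out.simps)
      qed
      finally show ?thesis .
    qed
    ultimately have "(\<Sum>j<?n. specialize (crossing_matrix D cs $$ (i, j)) * x (Inl (arc j))) -
        (\<Sum>j<?n. specialize (succession_matrix D cs $$ (i, j)) * x (Inl (arc j))) = 0" by simp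
    then show ?thesis using N_entry by (simp add: left_diff_distrib sum_subtractf)
  qed
  have "N *\<^sub>v v = 0\<^sub>v ?n"
  proof (rule eq_vecI)
    fix i assume "i < dim_vec (0\<^sub>v ?n)"
    then have i: "i < ?n" by simp
    then have "(N *\<^sub>v v) $ i = (\<Sum>j<?n. N $$ (i, j) * x (Inl (arc j)))"
      using N by (simp add: v_def scalar_prod_def atLeast0LessThan)
    then show "(N *\<^sub>v v) $ i = 0\<^sub>v ?n $ i" using row[OF i] i by simp
  qed (use N in simp)
  \<comment> \<open>There is at least one crossing, and the label of its arc is nonzero already
    modulo \<open>X\<close>.\<close>
  moreover have "v \<noteq> 0\<^sub>v ?n"
  proof
    assume v0: "v = 0\<^sub>v ?n"
    have n: "0 < ?n" using cs(1) by simp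
    then have "x (Inl (arc 0)) = 0" using arg_cong[OF v0, of "\<lambda>v. v $ 0"] by (simp add: v_def)
    moreover have "Inl (arc 0) \<in> letters D" using arc_in[OF n] by (simp add: letters_eq)
    ultimately show False using x(2,3) by fastforce
  qed
  moreover have "v \<in> carrier_vec ?n" by (simp add: v_def)
  ultimately have "det N = 0" using det_0_iff_vec_prod_zero[OF N] by blast
  then have "specialize (det (crossing_matrix D cs - succession_matrix D cs)) = 0"
    unfolding N_def by (simp add: specialize.hom_det)
  then show ?thesis by (rule specialize_eq_0D)
qed

text \<open>Numbering, concordance and determinant may each refer to a different diagram of
  \<open>K'\<close> or of \<open>K\<close>. Colorability is invariant under equivalence of diagrams
  and thereby links them.\<close>

theorem concordant_almost_classical_vanishing:
  assumes "almost_classical K'" "concordant K K'" "\<Delta> \<in> gen_alexander_polynomials K"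
  shows "\<Delta> = 0"
proof -
  have knot: "\<exists>D0. length D0 = 1 \<and> wf_code D0 \<and> L = virtual_link_of D0" if "virtual_knot L" for L
    using that unfolding virtual_knot_def virtual_knot_diagram_def virtual_link_diagram_def by blast
  have same: "(colorable D1 \<longleftrightarrow> colorable D2) \<and> length D1 = 1 \<and> wf_code D1" if L: "virtual_knot L" "D1 \<in> L" "D2 \<in> L" for L D1 D2
  proof -
    obtain D0 where D0: "length D0 = 1" "wf_code D0" "L = virtual_link_of D0" using knot[OF L(1)] by blast
    then have "equivclp elementary_equivalence D0 D1" "equivclp elementary_equivalence D0 D2"
      using L(2,3) by (simp_all add: virtual_link_of_def)
    then show ?thesis using colorable_equivalent[OF _ D0(2)] D0(1) by metis
  qed
  obtain D1 \<nu> where D1: "virtual_knot K'" "D1 \<in> K'" "alexander_numbering D1 \<nu>"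
    using assms(1) unfolding almost_classical_def by blast
  obtain D D' where D: "virtual_knot K" "D \<in> K" "D' \<in> K'" "diagrams_concordant D D'"
    using assms(2) unfolding concordant_def by blast
  obtain E cs where E: "E \<in> K" "cs \<noteq> []" "distinct cs" "set cs = crossings (classical_part E)"
    "\<Delta> = det (crossing_matrix E cs - succession_matrix E cs)"
    using assms(3) unfolding gen_alexander_polynomials_def by blast
  have "colorable D1" using colorable_numbering[OF D1(3)] same[OF D1(1,2,2)] by blast
  then have "colorable D'" using same[OF D1(1,2) D(3)] by blast
  then have "colorable D"
    using colorable_concordant[OF D(4)] same[OF D(1,2,2)] same[OF D1(1) D(3) D(3)] by blast
  then have "colorable E" using same[OF D(1,2) E(1)] by blast
  then show ?thesis unfolding E(5) using colorable_det same[OF D(1) E(1) E(1)] E(2-4) by blast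
qed

theorem corollary4p10:
  fixes K :: virtual_link
  assumes "virtual_knot K"
  shows "((\<exists>K'. almost_classical K' \<and> concordant K K') \<longrightarrow>
            (\<forall>\<Delta>\<in>gen_alexander_polynomials K. \<Delta> = 0)) \<and>
         (slice K \<longrightarrow> (\<forall>\<Delta>\<in>gen_alexander_polynomials K. \<Delta> = 0))"
  using concordant_almost_classical_vanishing almost_classical_unknot unfolding slice_def by blast

end
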